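(* Consider a sequence of problems with $n,p\to\infty$ and $p/n\to\gamma\in(0,1)$. Assume: - $(X^TX)^{-1}$ exists with probability $1$ and $\mathbb{E}_X[(X^TX)^{-1}]$ exists; - $x=\Sigma^{1/2}\tilde x$, where $\tilde x\in\mathbb{R}^p$ has i.i.d. entries with zero mean, unit variance, finite fourth moment and finite sixth moment, and $\Sigma=\Sigma_p$ is a positive definite (invertible) covariance matrix; - $\mathrm{tr}(\Sigma)\to c^2$ for some constant $c$. Let $$\eta_\infty=1-\frac{\gamma^4\sigma^2}{(1-\gamma)\gamma^2\tau^2c^2+\gamma^3\sigma^2},\qquad \alpha^*_\infty=\frac{\gamma^2\sigma^2}{(1-\gamma)\gamma\tau^2c^2+\gamma^2\sigma^2}.$$ Then for every $\epsilon>0$ there exists $n(\epsilon)$ such that $\eta\le\eta_\infty+\epsilon$ and $\alpha^*\ge\alpha^*_\infty-\epsilon$ for all $n>n(\epsilon)$.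
   Context: The labeled data $(x_i,y_i)_{i=1}^n$ are i.i.d., with $X\in\mathbb{R}^{n\times p}$ having rows $x_i^T$. The distribution $P_x$ is known and has $\mathbb{E}[x]=0$. The responses are $y_i=x_i^T\beta+\epsilon_i$, where: - the noise is mean-zero with variance $\sigma^2>0$; - $\beta$ is random, independent of the training data, with $\mathbb{E}[\beta]=0$ and $\mathbb{E}[\beta\beta^T]=\tau^2I_p$. Notation: - $H=\mathbb{E}[X^TX]$, $\bar X_j=\frac1n\sum_ix_{ij}$, $\bar Y=\frac1n\sum_iy_i$. Estimators: - $\hat\beta=(X^TX)^{-1}X^TY$; - $\breve\beta=H^{-1}(X^TY-n\bar X\bar Y)$; - $\dot\beta_\alpha=(1-\alpha)\hat\beta+\alpha\breve\beta$. Errors: the reducible error is $r(\beta_T)=\mathbb{E}_{\beta,X,Y,x_0}[(x_0^T\beta_T-x_0^T\beta)^2]$, with $x_0\sim P_x$ independent. Then $\alpha^*=\arg\min_{\alpha\in\mathbb{R}}r(\dot\beta_\alpha)$ and $\eta=r(\dot\beta_{\alpha^*})/r(\hat\beta)$. *)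

theory Defs
  imports "HOL-Probability.Probability" "Jordan_Normal_Form.Matrix"
begin

definition trace_mat :: "real mat \<Rightarrow> real" where
  "trace_mat A = (\<Sum>i<dim_row A. index_mat A (i, i))"

definition minv :: "real mat \<Rightarrow> real mat" where
  "minv A = (if invertible_mat A then (SOME B. inverts_mat A B \<and> inverts_mat B A)
             else 0\<^sub>m (dim_row A) (dim_col A))"

definition psd_mat :: "real mat \<Rightarrow> bool" where
  "psd_mat A \<longleftrightarrow> A \<in> carrier_mat (dim_row A) (dim_row A) \<and> transpose_mat A = A \<and>
     (\<forall>v \<in> carrier_vec (dim_row A). 0 \<le> scalar_prod v (A *\<^sub>v v))"

definition pd_mat :: "real mat \<Rightarrow> bool" where
  "pd_mat A \<longleftrightarrow> A \<in> carrier_mat (dim_row A) (dim_row A) \<and> transpose_mat A = A \<and>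
     (\<forall>v \<in> carrier_vec (dim_row A). v \<noteq> 0\<^sub>v (dim_row A) \<longrightarrow> 0 < scalar_prod v (A *\<^sub>v v))"

definition mat_sqrt :: "real mat \<Rightarrow> real mat" where
  "mat_sqrt A = (THE R. psd_mat R \<and> dim_row R = dim_row A \<and> R * R = A)"

text \<open>A sample point is (beta, (Xtilde, (xtilde0, noise))).  The joint law is the product of
  the law B of beta (on R^p), i.i.d. D entries for the n x p matrix Xtilde (rows xtilde_i),
  i.i.d. D entries for the test covariate xtilde0, and i.i.d. noise of law N.\<close>

type_synonym sample = "(nat \<Rightarrow> real) \<times> ((nat \<times> nat \<Rightarrow> real) \<times> ((nat \<Rightarrow> real) \<times> (nat \<Rightarrow> real)))"

definition sample_space ::
  "nat \<Rightarrow> nat \<Rightarrow> real measure \<Rightarrow> real measure \<Rightarrow> (nat \<Rightarrow> real) measure \<Rightarrow> sample measure" where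
  "sample_space n p D N B =
     B \<Otimes>\<^sub>M (PiM ({..<n} \<times> {..<p}) (\<lambda>_. D) \<Otimes>\<^sub>M (PiM {..<p} (\<lambda>_. D) \<Otimes>\<^sub>M PiM {..<n} (\<lambda>_. N)))"

definition beta_vec :: "nat \<Rightarrow> sample \<Rightarrow> real vec" where
  "beta_vec p \<omega> = vec p (fst \<omega>)"

definition design :: "nat \<Rightarrow> nat \<Rightarrow> real mat \<Rightarrow> sample \<Rightarrow> real mat" where
  "design n p S \<omega> =
     mat n p (\<lambda>(i, j). vec_index (mat_sqrt S *\<^sub>v vec p (\<lambda>k. fst (snd \<omega>) (i, k))) j)"

definition test_pt :: "nat \<Rightarrow> real mat \<Rightarrow> sample \<Rightarrow> real vec" where
  "test_pt p S \<omega> = mat_sqrt S *\<^sub>v vec p (fst (snd (snd \<omega>)))"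

definition resp :: "nat \<Rightarrow> nat \<Rightarrow> real mat \<Rightarrow> sample \<Rightarrow> real vec" where
  "resp n p S \<omega> = design n p S \<omega> *\<^sub>v beta_vec p \<omega> + vec n (snd (snd (snd \<omega>)))"

definition Hmat :: "sample measure \<Rightarrow> nat \<Rightarrow> nat \<Rightarrow> real mat \<Rightarrow> real mat" where
  "Hmat \<Omega> n p S = mat p p (\<lambda>(j, k).
     \<integral>\<omega>. index_mat (transpose_mat (design n p S \<omega>) * design n p S \<omega>) (j, k) \<partial>\<Omega>)"

definition xbar :: "real mat \<Rightarrow> real vec" where
  "xbar X = vec (dim_col X) (\<lambda>j. (\<Sum>i<dim_row X. index_mat X (i, j)) / real (dim_row X))"

definition ybar :: "real vec \<Rightarrow> real" where
  "ybar Y = (\<Sum>i<dim_vec Y. vec_index Y i) / real (dim_vec Y)"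

definition ols :: "real mat \<Rightarrow> real vec \<Rightarrow> real vec" where
  "ols X Y = minv (transpose_mat X * X) *\<^sub>v (transpose_mat X *\<^sub>v Y)"

definition breve :: "real mat \<Rightarrow> real mat \<Rightarrow> real vec \<Rightarrow> real vec" where
  "breve H X Y = minv H *\<^sub>v (transpose_mat X *\<^sub>v Y - (real (dim_row X) * ybar Y) \<cdot>\<^sub>v xbar X)"

definition dot_est :: "real \<Rightarrow> real mat \<Rightarrow> real mat \<Rightarrow> real vec \<Rightarrow> real vec" where
  "dot_est \<alpha> H X Y = (1 - \<alpha>) \<cdot>\<^sub>v ols X Y + \<alpha> \<cdot>\<^sub>v breve H X Y"

definition red_err ::
  "sample measure \<Rightarrow> nat \<Rightarrow> nat \<Rightarrow> real mat \<Rightarrow> (real mat \<Rightarrow> real vec \<Rightarrow> real vec) \<Rightarrow> real" where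
  "red_err \<Omega> n p S est = (\<integral>\<omega>.
     (scalar_prod (test_pt p S \<omega>) (est (design n p S \<omega>) (resp n p S \<omega>))
      - scalar_prod (test_pt p S \<omega>) (beta_vec p \<omega>))\<^sup>2 \<partial>\<Omega>)"

definition alpha_star :: "sample measure \<Rightarrow> nat \<Rightarrow> nat \<Rightarrow> real mat \<Rightarrow> real" where
  "alpha_star \<Omega> n p S =
     arg_min (\<lambda>\<alpha>. red_err \<Omega> n p S (dot_est \<alpha> (Hmat \<Omega> n p S))) (\<lambda>_. True)"

definition eta :: "sample measure \<Rightarrow> nat \<Rightarrow> nat \<Rightarrow> real mat \<Rightarrow> real" where
  "eta \<Omega> n p S =
     red_err \<Omega> n p S (dot_est (alpha_star \<Omega> n p S) (Hmat \<Omega> n p S)) / red_err \<Omega> n p S ols"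

end

theory Submission
  imports Defs "Jordan_Normal_Form.Determinant"
begin

text \<open>
  Write \<open>x\<close> for the whitened design, \<open>L = S (X\<^sup>T X)\<^sup>-\<^sup>1 X\<^sup>T\<close> with \<open>S = \<Sigma>\<^sup>1\<^sup>/\<^sup>2\<close>, and \<open>K = x\<^sup>T C / n\<close> with the
  centering projection \<open>C\<close>. The prediction error of the mixture is linear in \<open>(\<beta>, \<epsilon>)\<close> with coefficients
  \<open>\<alpha> (K x - I) S\<close> and \<open>(1 - \<alpha>) L + \<alpha> K\<close>, so its risk is
  \<open>(1 - \<alpha>)\<^sup>2 a + 2 \<alpha> (1 - \<alpha>) b + \<alpha>\<^sup>2 d\<close>, where \<open>a\<close> is the risk of ordinary least squares. Here
  \<open>b = \<sigma>\<^sup>2 p / n + o(1)\<close> because \<open>x L\<close> is a projection; \<open>d\<close> is at most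
  \<open>\<tau>\<^sup>2 tr(\<Sigma>) p / n + \<sigma>\<^sup>2 p / n + o(1)\<close> by fourth moments; and \<open>a \<ge> \<sigma>\<^sup>2 p / (n - p + 1)\<close>, since a
  diagonal entry of \<open>(x\<^sup>T x)\<^sup>-\<^sup>1\<close> is the reciprocal of the squared distance of a column of \<open>x\<close> to the
  span of the others, which has mean \<open>n - p + 1\<close>. The optimal weight and the relative gain are monotone
  in \<open>a\<close>, so no random matrix limit law is needed.
\<close>

section \<open>Square roots of positive semidefinite matrices\<close>

text \<open>The test point is \<open>S x0\<close> with \<open>S\<close> symmetric, so only
  \<open>S\<close> times an estimator enters the error. Then \<open>S H^-1 S = I / n\<close> removes
  Sigma from \<open>breve\<close>, and \<open>L x = I\<close> removes the signal from ordinary least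
  squares; Sigma survives only in the coefficient \<open>(K x - I) S\<close>, whose mean square is
  part of \<open>d\<close>. With \<open>u = a - b\<close> and \<open>e = d - b\<close> the risk is
  \<open>a - 2 \<alpha> u + \<alpha>^2 (u + e)\<close>. It is minimal at \<open>u / (u + e)\<close>,
  where it equals \<open>a\<close> times \<open>1 - (u / (u + e)) (1 - b / a)\<close>. This dictates
  which bounds are proved: \<open>a\<close> from below, \<open>d\<close> from above,
  \<open>b\<close> from both sides. Their limits are
  \<open>\<sigma>^2 \<gamma> / (1 - \<gamma>)\<close>,
  \<open>\<tau>^2 c^2 \<gamma> + \<sigma>^2 \<gamma>\<close> and \<open>\<sigma>^2 \<gamma>\<close>,
  so \<open>1 - b / a\<close> becomes \<open>\<gamma>\<close> and the limiting gain is
  \<open>\<gamma>\<close> times the limiting weight. Two definitions are opaque.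
  \<open>mat_sqrt\<close> is a definite description and says nothing before existence and uniqueness
  are known. \<open>minv\<close> is a choice, and its measurability is drawn from the integrability
  hypotheses on its entries.\<close>

definition op_bound :: "nat \<Rightarrow> (nat \<Rightarrow> nat \<Rightarrow> real) \<Rightarrow> real \<Rightarrow> bool" where
  "op_bound p M s \<longleftrightarrow>
     (\<forall>v. L2_set (\<lambda>i. \<Sum>j<p. M i j * v j) {..<p} \<le> s * L2_set v {..<p})"

lemma op_bound_add:
  assumes "op_bound p M s" "op_bound p N t"
  shows "op_bound p (\<lambda>i j. M i j + N i j) (s + t)"
  unfolding op_bound_def
proof
  fix v :: "nat \<Rightarrow> real"
  have "L2_set (\<lambda>i. \<Sum>j<p. (M i j + N i j) * v j) {..<p}
      = L2_set (\<lambda>i. (\<Sum>j<p. M i j * v j) + (\<Sum>j<p. N i j * v j)) {..<p}"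
    by (simp add: distrib_right sum.distrib)
  also have "\<dots> \<le> L2_set (\<lambda>i. \<Sum>j<p. M i j * v j) {..<p} + L2_set (\<lambda>i. \<Sum>j<p. N i j * v j) {..<p}"
    by (rule L2_set_triangle_ineq)
  also have "\<dots> \<le> s * L2_set v {..<p} + t * L2_set v {..<p}"
    using assms by (intro add_mono) (auto simp: op_bound_def)
  finally show "L2_set (\<lambda>i. \<Sum>j<p. (M i j + N i j) * v j) {..<p} \<le> (s + t) * L2_set v {..<p}"
    by (simp add: distrib_right)
qed

lemma op_bound_scale:
  assumes "op_bound p M s" "0 \<le> c"
  shows "op_bound p (\<lambda>i j. c * M i j) (c * s)"
  unfolding op_bound_def
proof
  fix v :: "nat \<Rightarrow> real"
  have "L2_set (\<lambda>i. \<Sum>j<p. c * M i j * v j) {..<p} = L2_set (\<lambda>i. c * (\<Sum>j<p. M i j * v j)) {..<p}"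
    by (simp add: sum_distrib_left mult.assoc)
  also have "\<dots> = c * L2_set (\<lambda>i. \<Sum>j<p. M i j * v j) {..<p}"
    using assms(2) by (simp add: L2_set_right_distrib)
  also have "\<dots> \<le> c * (s * L2_set v {..<p})"
    using assms by (intro mult_left_mono) (auto simp: op_bound_def)
  finally show "L2_set (\<lambda>i. \<Sum>j<p. c * M i j * v j) {..<p} \<le> c * s * L2_set v {..<p}"
    by simp
qed

lemma op_bound_mult:
  assumes "op_bound p M s" "op_bound p N t" "0 \<le> s"
  shows "op_bound p (\<lambda>i k. \<Sum>j<p. M i j * N j k) (s * t)"
  unfolding op_bound_def
proof
  fix v :: "nat \<Rightarrow> real"
  have "(\<Sum>k<p. (\<Sum>j<p. M i j * N j k) * v k) = (\<Sum>j<p. M i j * (\<Sum>k<p. N j k * v k))" for i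
    by (simp add: sum_distrib_left sum_distrib_right mult.assoc) (rule sum.swap)
  then have "L2_set (\<lambda>i. \<Sum>k<p. (\<Sum>j<p. M i j * N j k) * v k) {..<p}
      = L2_set (\<lambda>i. \<Sum>j<p. M i j * (\<Sum>k<p. N j k * v k)) {..<p}"
    by simp
  also have "\<dots> \<le> s * L2_set (\<lambda>j. \<Sum>k<p. N j k * v k) {..<p}"
    using assms(1) by (auto simp: op_bound_def)
  also have "\<dots> \<le> s * (t * L2_set v {..<p})"
    using assms by (intro mult_left_mono) (auto simp: op_bound_def)
  finally show "L2_set (\<lambda>i. \<Sum>k<p. (\<Sum>j<p. M i j * N j k) * v k) {..<p} \<le> s * t * L2_set v {..<p}"
    by simp
qed

text \<open>Apply the bound to a unit vector. This turns norm estimates into entrywise ones, so that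
  convergence of the iteration can be argued entry by entry.\<close>

lemma op_bound_entry:
  assumes "op_bound p M s" "i < p" "k < p"
  shows "\<bar>M i k\<bar> \<le> s"
proof -
  define v :: "nat \<Rightarrow> real" where "v j = (if j = k then 1 else 0)" for j
  have v2: "L2_set v {..<p} = 1"
    using assms(3) by (simp add: L2_set_def v_def if_distrib[of "\<lambda>x. x ^ 2"] cong: if_cong)
  have Mv: "(\<Sum>j<p. M i j * v j) = M i k" for i
    using assms(3) by (simp add: v_def if_distrib cong: if_cong)
  have "\<bar>M i k\<bar> \<le> L2_set (\<lambda>i. M i k) {..<p}"
  proof -
    have "(M i k)\<^sup>2 \<le> (\<Sum>i<p. (M i k)\<^sup>2)"
      using assms(2) by (intro member_le_sum) auto
    then have "sqrt ((M i k)\<^sup>2) \<le> L2_set (\<lambda>i. M i k) {..<p}"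
      unfolding L2_set_def by (rule real_sqrt_le_mono)
    then show ?thesis by simp
  qed
  also have "\<dots> \<le> s"
    using assms(1)[unfolded op_bound_def, rule_format, of v] by (simp add: Mv v2)
  finally show ?thesis .
qed

text \<open>Cauchy-Schwarz. The conclusion says that \<open>I - M\<close> is positive semidefinite,
  in a form that passes to limits.\<close>

lemma op_bound_quad_form:
  assumes "op_bound p M s" "s \<le> 1"
  shows "(\<Sum>i<p. \<Sum>j<p. v i * M i j * v j) \<le> (\<Sum>i<p. (v i)\<^sup>2)"
proof -
  have "(\<Sum>i<p. \<Sum>j<p. v i * M i j * v j) = (\<Sum>i<p. v i * (\<Sum>j<p. M i j * v j))"
    by (simp add: sum_distrib_left mult.assoc)
  also have "\<dots> \<le> (\<Sum>i<p. \<bar>v i\<bar> * \<bar>\<Sum>j<p. M i j * v j\<bar>)"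
    by (intro sum_mono) (metis abs_ge_self abs_mult)
  also have "\<dots> \<le> L2_set v {..<p} * L2_set (\<lambda>i. \<Sum>j<p. M i j * v j) {..<p}"
    by (rule L2_set_mult_ineq)
  also have "\<dots> \<le> L2_set v {..<p} * (s * L2_set v {..<p})"
    using assms by (intro mult_left_mono) (auto simp: op_bound_def)
  also have "\<dots> \<le> L2_set v {..<p} * (1 * L2_set v {..<p})"
    using assms by (intro mult_left_mono mult_right_mono) auto
  also have "\<dots> = (\<Sum>i<p. (v i)\<^sup>2)"
    by (simp add: L2_set_def sum_nonneg)
  finally show ?thesis .
qed

text \<open>
  The square root of a contraction \<open>I - B\<close> is \<open>I - Y\<close>, where \<open>Y = (B + Y\<^sup>2) / 2\<close>. The scalar
  iteration with \<open>B = 1\<close> majorizes the matrix iteration and stays below \<open>1\<close>, so the increments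
  are summable.
\<close>

fun sqrt_iter :: "nat \<Rightarrow> (nat \<Rightarrow> nat \<Rightarrow> real) \<Rightarrow> nat \<Rightarrow> nat \<Rightarrow> nat \<Rightarrow> real" where
  "sqrt_iter p B 0 = (\<lambda>i j. 0)"
| "sqrt_iter p B (Suc n) =
     (\<lambda>i j. (1 / 2) * (B i j + (\<Sum>l<p. sqrt_iter p B n i l * sqrt_iter p B n l j)))"

fun scalar_iter :: "nat \<Rightarrow> real" where
  "scalar_iter 0 = 0"
| "scalar_iter (Suc n) = (1 / 2) * (1 + scalar_iter n * scalar_iter n)"

text \<open>The successor equations stay out of the simplifier because the increment argument has to
  unfold one occurrence at a time.\<close>

declare sqrt_iter.simps(2) [simp del] and scalar_iter.simps(2) [simp del]

lemma scalar_iter_range: "0 \<le> scalar_iter n \<and> scalar_iter n \<le> 1"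
proof (induction n)
  case (Suc n)
  then have "scalar_iter n * scalar_iter n \<le> 1"
    by (simp add: mult_le_one)
  with Suc show ?case by (simp add: scalar_iter.simps)
qed simp

text \<open>The increment is \<open>(t - 1)^2 / 2\<close> for
  \<open>t = scalar_iter n\<close>.\<close>

lemma scalar_iter_mono: "scalar_iter n \<le> scalar_iter (Suc n)"
  using sum_squares_ge_zero[of "scalar_iter n - 1" 0] by (simp add: algebra_simps scalar_iter.simps)

lemma scalar_iter_convergent: "convergent scalar_iter"
proof (rule Bseq_monoseq_convergent)
  show "Bseq scalar_iter"
    by (rule BseqI'[of _ 1]) (use scalar_iter_range in auto)
  show "monoseq scalar_iter"
    by (simp add: monoseq_Suc scalar_iter_mono)
qed

text \<open>The factorization \<open>Y'^2 - Y^2 = Y' (Y' - Y) + (Y' - Y) Y\<close> holds without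
  commutativity. It bounds the next increment by the current one and by the norms of both iterates,
  hence the joint induction.\<close>

lemma sqrt_iter_bounds:
  assumes B: "op_bound p B 1"
  shows "op_bound p (sqrt_iter p B n) (scalar_iter n)
    \<and> op_bound p (\<lambda>i j. sqrt_iter p B (Suc n) i j - sqrt_iter p B n i j)
        (scalar_iter (Suc n) - scalar_iter n)"
proof (induction n)
  case 0
  have "op_bound p (sqrt_iter p B 0) 0"
    by (simp add: op_bound_def L2_set_def)
  moreover have "op_bound p (\<lambda>i j. (1 / 2) * B i j) ((1 / 2) * 1)"
    using B by (rule op_bound_scale) simp
  ultimately show ?case by (simp add: sqrt_iter.simps scalar_iter.simps)
next
  case (Suc n)
  let ?Y = "sqrt_iter p B n" and ?Y' = "sqrt_iter p B (Suc n)"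
  let ?y = "scalar_iter n" and ?y' = "scalar_iter (Suc n)"
  let ?D = "\<lambda>i j. ?Y' i j - ?Y i j"
  have YY: "op_bound p (\<lambda>i k. \<Sum>j<p. ?Y i j * ?Y j k) (?y * ?y)"
    using Suc scalar_iter_range[of n] by (intro op_bound_mult) auto
  have Y': "op_bound p ?Y' ?y'"
    using op_bound_scale[OF op_bound_add[OF B YY], of "1 / 2"] by (simp add: sqrt_iter.simps scalar_iter.simps)
  have "op_bound p (\<lambda>i k. (1 / 2) * ((\<Sum>j<p. ?Y' i j * ?D j k) + (\<Sum>j<p. ?D i j * ?Y j k)))
      ((1 / 2) * (?y' * (?y' - ?y) + (?y' - ?y) * ?y))"
    using Suc Y' scalar_iter_range[of "Suc n"] scalar_iter_mono[of n]
    by (intro op_bound_scale op_bound_add op_bound_mult) simp_all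
  moreover have e1: "(1 / 2) * ((\<Sum>j<p. ?Y' i j * ?D j k) + (\<Sum>j<p. ?D i j * ?Y j k))
      = sqrt_iter p B (Suc (Suc n)) i k - ?Y' i k" for i k
    unfolding sqrt_iter.simps(2)[of p B "Suc n"]
    by (subst (5) sqrt_iter.simps(2)) (simp add: algebra_simps sum.distrib sum_subtractf)
  moreover have e2: "(1 / 2) * (?y' * (?y' - ?y) + (?y' - ?y) * ?y) = scalar_iter (Suc (Suc n)) - ?y'"
    unfolding scalar_iter.simps(2)[of "Suc n"]
    by (subst (4) scalar_iter.simps(2)) (simp add: algebra_simps)
  ultimately show ?case using Y' unfolding e1 e2 by blast
qed

lemma sqrt_iter_symmetric:
  assumes "\<And>i j. i < p \<Longrightarrow> j < p \<Longrightarrow> B i j = B j i"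
  shows "i < p \<Longrightarrow> j < p \<Longrightarrow> sqrt_iter p B n i j = sqrt_iter p B n j i"
proof (induction n arbitrary: i j)
  case (Suc n)
  have "(\<Sum>l<p. sqrt_iter p B n i l * sqrt_iter p B n l j)
      = (\<Sum>l<p. sqrt_iter p B n j l * sqrt_iter p B n l i)"
  proof (rule sum.cong)
    fix l assume "l \<in> {..<p}"
    then have "sqrt_iter p B n i l = sqrt_iter p B n l i" "sqrt_iter p B n l j = sqrt_iter p B n j l"
      using Suc by auto
    then show "sqrt_iter p B n i l * sqrt_iter p B n l j = sqrt_iter p B n j l * sqrt_iter p B n l i"
      by (simp add: mult.commute)
  qed simp
  with assms Suc.prems show ?case by (simp add: sqrt_iter.simps)
qed simp

lemma sqrt_iter_convergent:
  assumes B: "op_bound p B 1" and ij: "i < p" "j < p"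
  shows "convergent (\<lambda>n. sqrt_iter p B n i j)"
proof -
  let ?d = "\<lambda>n. sqrt_iter p B (Suc n) i j - sqrt_iter p B n i j"
  obtain y where "scalar_iter \<longlonglongrightarrow> y"
    using scalar_iter_convergent by (auto simp: convergent_def)
  then have "summable (\<lambda>n. scalar_iter (Suc n) - scalar_iter n)"
    by (rule telescope_summable)
  moreover have "norm (?d n) \<le> scalar_iter (Suc n) - scalar_iter n" for n
    using op_bound_entry[OF sqrt_iter_bounds[OF B, THEN conjunct2] ij] by simp
  ultimately have "summable ?d"
    by (rule summable_comparison_test'[where N = 0])
  then have "convergent (\<lambda>n. \<Sum>m<n. ?d m)"
    by (simp add: summable_iff_convergent)
  moreover have "(\<Sum>m<n. ?d m) = sqrt_iter p B n i j" for n
    using sum_lessThan_telescope[of "\<lambda>m. sqrt_iter p B m i j" n] by simp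
  ultimately show ?thesis by simp
qed

text \<open>The last property rearranges to \<open>(I - Y)^2 = I - B\<close>, and the middle one
  makes \<open>I - Y\<close> positive semidefinite. Both are inherited entrywise from the
  iterates.\<close>

lemma contraction_fixed_point:
  assumes B: "op_bound p B 1" and sym: "\<And>i j. i < p \<Longrightarrow> j < p \<Longrightarrow> B i j = B j i"
  obtains Y where "\<And>i j. i < p \<Longrightarrow> j < p \<Longrightarrow> Y i j = Y j i"
    and "\<And>v. (\<Sum>i<p. \<Sum>j<p. v i * Y i j * v j) \<le> (\<Sum>i<p. (v i)\<^sup>2)"
    and "\<And>i j. i < p \<Longrightarrow> j < p \<Longrightarrow> 2 * Y i j = B i j + (\<Sum>l<p. Y i l * Y l j)"
proof
  define Y where "Y i j = lim (\<lambda>n. sqrt_iter p B n i j)" for i j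
  have lim: "(\<lambda>n. sqrt_iter p B n i j) \<longlonglongrightarrow> Y i j" if "i < p" "j < p" for i j
    using sqrt_iter_convergent[OF B that] by (simp add: Y_def convergent_LIMSEQ_iff)
  show "Y i j = Y j i" if "i < p" "j < p" for i j
    using sqrt_iter_symmetric[OF sym that] by (simp add: Y_def)
  show "(\<Sum>i<p. \<Sum>j<p. v i * Y i j * v j) \<le> (\<Sum>i<p. (v i)\<^sup>2)" for v
  proof (rule LIMSEQ_le_const2)
    show "(\<lambda>n. \<Sum>i<p. \<Sum>j<p. v i * sqrt_iter p B n i j * v j)
        \<longlonglongrightarrow> (\<Sum>i<p. \<Sum>j<p. v i * Y i j * v j)"
      by (intro tendsto_sum tendsto_mult tendsto_const lim) auto
    show "\<exists>N. \<forall>n\<ge>N. (\<Sum>i<p. \<Sum>j<p. v i * sqrt_iter p B n i j * v j) \<le> (\<Sum>i<p. (v i)\<^sup>2)"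
      using op_bound_quad_form[OF sqrt_iter_bounds[OF B, THEN conjunct1]] scalar_iter_range by blast
  qed
  show "2 * Y i j = B i j + (\<Sum>l<p. Y i l * Y l j)" if "i < p" "j < p" for i j
  proof -
    have "(\<lambda>n. sqrt_iter p B (Suc n) i j) \<longlonglongrightarrow> (1 / 2) * (B i j + (\<Sum>l<p. Y i l * Y l j))"
      unfolding sqrt_iter.simps using that
      by (intro tendsto_sum tendsto_mult tendsto_add tendsto_const lim) auto
    moreover have "(\<lambda>n. sqrt_iter p B (Suc n) i j) \<longlonglongrightarrow> Y i j"
      using lim[OF that] by (rule LIMSEQ_Suc)
    ultimately have "Y i j = (1 / 2) * (B i j + (\<Sum>l<p. Y i l * Y l j))"
      by (rule LIMSEQ_unique[rotated])
    then show ?thesis by simp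
  qed
qed

text \<open>Each product of two coordinates is at most the squared norm. The sum of absolute entries
  is a crude bound for the largest eigenvalue, but any finite bound serves for rescaling to a
  contraction.\<close>

lemma quad_form_bound:
  fixes A :: "nat \<Rightarrow> nat \<Rightarrow> real"
  shows "(\<Sum>i<p. \<Sum>j<p. v i * A i j * v j) \<le> (\<Sum>i<p. \<Sum>j<p. \<bar>A i j\<bar>) * (\<Sum>i<p. (v i)\<^sup>2)"
proof -
  have "v i * A i j * v j \<le> \<bar>A i j\<bar> * (\<Sum>i<p. (v i)\<^sup>2)" if "i < p" "j < p" for i j
  proof -
    have "\<bar>v i\<bar> * \<bar>v j\<bar> \<le> ((v i)\<^sup>2 + (v j)\<^sup>2) / 2"
      using sum_squares_bound[of "\<bar>v i\<bar>" "\<bar>v j\<bar>"] by simp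
    also have "\<dots> \<le> (\<Sum>i<p. (v i)\<^sup>2)"
      using member_le_sum[of i "{..<p}" "\<lambda>i. (v i)\<^sup>2"] member_le_sum[of j "{..<p}" "\<lambda>i. (v i)\<^sup>2"] that
      by simp
    finally have "\<bar>A i j\<bar> * (\<bar>v i\<bar> * \<bar>v j\<bar>) \<le> \<bar>A i j\<bar> * (\<Sum>i<p. (v i)\<^sup>2)"
      by (rule mult_left_mono) simp
    moreover have "v i * A i j * v j \<le> \<bar>v i * A i j * v j\<bar>" by simp
    ultimately show ?thesis by (simp add: abs_mult mult_ac)
  qed
  then show ?thesis
    unfolding sum_distrib_right by (intro sum_mono) auto
qed

text \<open>This is \<open>A^2 \<le> s A\<close> for \<open>0 \<le> A \<le> s\<close>, obtained
  without eigenvectors: evaluate the nonnegative form at \<open>v - A v / s\<close> and estimate the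
  last term by \<open>quad_form_bound\<close>.\<close>

lemma psd_image_bound:
  fixes A :: "nat \<Rightarrow> nat \<Rightarrow> real"
  assumes sym: "\<And>i j. i < p \<Longrightarrow> j < p \<Longrightarrow> A i j = A j i"
    and psd: "\<And>v. 0 \<le> (\<Sum>i<p. \<Sum>j<p. v i * A i j * v j)"
    and s: "(\<Sum>i<p. \<Sum>j<p. \<bar>A i j\<bar>) \<le> s" "0 < s"
  shows "(\<Sum>i<p. (\<Sum>j<p. A i j * v j)\<^sup>2) \<le> s * (\<Sum>i<p. \<Sum>j<p. v i * A i j * v j)"
proof -
  define u where "u i = (\<Sum>j<p. A i j * v j)" for i
  define U where "U = (\<Sum>i<p. (u i)\<^sup>2)"
  let ?q = "\<lambda>x y. \<Sum>i<p. \<Sum>j<p. x i * A i j * y j"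
  have uv: "?q u v = U"
    by (simp add: U_def u_def power2_eq_square sum_distrib_left mult.assoc)
  have "?q v u = (\<Sum>j<p. \<Sum>i<p. v i * A i j * u j)"
    by (rule sum.swap)
  also have "\<dots> = ?q u v"
    using sym by (intro sum.cong refl) (simp add: mult_ac)
  finally have vu: "?q v u = U"
    using uv by simp
  have "(v i - u i / s) * A i j * (v j - u j / s) = v i * A i j * v j - v i * A i j * u j / s
      - u i * A i j * v j / s + u i * A i j * u j / s\<^sup>2" for i j
    using s by (simp add: field_simps power2_eq_square)
  then have "?q (\<lambda>i. v i - u i / s) (\<lambda>i. v i - u i / s)
      = ?q v v - ?q v u / s - ?q u v / s + ?q u u / s\<^sup>2"
    by (simp add: sum.distrib sum_subtractf sum_divide_distrib)
  also have "\<dots> = ?q v v - 2 * U / s + ?q u u / s\<^sup>2"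
    using uv vu by simp
  finally have "0 \<le> ?q v v - 2 * U / s + ?q u u / s\<^sup>2"
    using psd[of "\<lambda>i. v i - u i / s"] by simp
  moreover have "?q u u \<le> s * U"
  proof -
    have "?q u u \<le> (\<Sum>i<p. \<Sum>j<p. \<bar>A i j\<bar>) * U"
      unfolding U_def by (rule quad_form_bound)
    also have "\<dots> \<le> s * U"
      using s by (intro mult_right_mono) (auto simp: U_def intro: sum_nonneg)
    finally show ?thesis .
  qed
  then have "?q u u / s\<^sup>2 \<le> U / s"
    using s by (simp add: field_simps power2_eq_square)
  moreover have "2 * U / s = U / s + U / s"
    by simp
  ultimately have "U / s \<le> ?q v v"
    by linarith
  then show ?thesis
    using s by (simp add: U_def u_def field_simps)
qed

lemma psd_square_root_exists:
  fixes A :: "nat \<Rightarrow> nat \<Rightarrow> real"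
  assumes sym: "\<And>i j. i < p \<Longrightarrow> j < p \<Longrightarrow> A i j = A j i"
    and psd: "\<And>v. 0 \<le> (\<Sum>i<p. \<Sum>j<p. v i * A i j * v j)"
  obtains R where "\<And>i j. i < p \<Longrightarrow> j < p \<Longrightarrow> R i j = R j i"
    and "\<And>v. 0 \<le> (\<Sum>i<p. \<Sum>j<p. v i * R i j * v j)"
    and "\<And>i j. i < p \<Longrightarrow> j < p \<Longrightarrow> (\<Sum>l<p. R i l * R l j) = A i j"
proof -
  \<comment> \<open>The summand 1 keeps \<open>s\<close> positive even when \<open>A\<close>
    vanishes.\<close>
  define s where "s = 1 + (\<Sum>i<p. \<Sum>j<p. \<bar>A i j\<bar>)"
  have s: "0 < s" "(\<Sum>i<p. \<Sum>j<p. \<bar>A i j\<bar>) \<le> s"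
    by (auto simp: s_def intro!: add_pos_nonneg sum_nonneg)
  define I where "I i j = (if i = j then 1 else 0 :: real)" for i j :: nat
  have I1: "(\<Sum>j<p. I i j * f j) = f i" if "i < p" for i f
    using that by (simp add: I_def if_distrib[of "\<lambda>x. x * _"] cong: if_cong)
  have I2: "(\<Sum>j<p. f j * I j i) = f i" if "i < p" for i f
    using that by (simp add: I_def if_distrib[of "\<lambda>x. _ * x"] cong: if_cong)
  define B where "B i j = I i j - A i j / s" for i j
  have "op_bound p B 1"
    unfolding op_bound_def
  proof
    fix v :: "nat \<Rightarrow> real"
    let ?q = "\<Sum>i<p. \<Sum>j<p. v i * A i j * v j" and ?u = "\<lambda>i. \<Sum>j<p. A i j * v j"
    have Bv: "(\<Sum>j<p. B i j * v j) = v i - ?u i / s" if "i < p" for i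
      using that by (simp add: B_def left_diff_distrib sum_subtractf I1 sum_divide_distrib)
    have "(\<Sum>i<p. (\<Sum>j<p. B i j * v j)\<^sup>2) = (\<Sum>i<p. (v i)\<^sup>2 - 2 * (v i * ?u i) / s + (?u i)\<^sup>2 / s\<^sup>2)"
      by (intro sum.cong refl) (simp add: Bv power2_diff power_divide mult.assoc)
    also have "\<dots> = (\<Sum>i<p. (v i)\<^sup>2) - 2 * ?q / s + (\<Sum>i<p. (?u i)\<^sup>2) / s\<^sup>2"
      by (simp add: sum.distrib sum_subtractf sum_divide_distrib sum_distrib_left mult.assoc)
    \<comment> \<open>With \<open>B = I - A / s\<close> the cross term contributes
      \<open>- 2 q / s\<close>. The quadratic term takes back at most \<open>q / s\<close>, so the
      norm does not grow.\<close>
    also have "(\<Sum>i<p. (?u i)\<^sup>2) / s\<^sup>2 \<le> s * ?q / s\<^sup>2"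
      by (intro divide_right_mono psd_image_bound sym psd s) auto
    also have "s * ?q / s\<^sup>2 = ?q / s"
      using s by (simp add: power2_eq_square)
    also have "(\<Sum>i<p. (v i)\<^sup>2) - 2 * ?q / s + ?q / s \<le> (\<Sum>i<p. (v i)\<^sup>2)"
      using psd[of v] s by (simp add: field_simps)
    finally show "L2_set (\<lambda>i. \<Sum>j<p. B i j * v j) {..<p} \<le> 1 * L2_set v {..<p}"
      by (simp add: L2_set_def)
  qed
  moreover have "B i j = B j i" if "i < p" "j < p" for i j
    using sym[OF that] by (simp add: B_def I_def)
  ultimately obtain Y where Ysym: "\<And>i j. i < p \<Longrightarrow> j < p \<Longrightarrow> Y i j = Y j i"
    and Yle: "\<And>v. (\<Sum>i<p. \<Sum>j<p. v i * Y i j * v j) \<le> (\<Sum>i<p. (v i)\<^sup>2)"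
    and Yeq: "\<And>i j. i < p \<Longrightarrow> j < p \<Longrightarrow> 2 * Y i j = B i j + (\<Sum>l<p. Y i l * Y l j)"
    by (rule contraction_fixed_point) auto
  define R where "R i j = sqrt s * (I i j - Y i j)" for i j
  show thesis
  proof
    show "R i j = R j i" if "i < p" "j < p" for i j
      using Ysym[OF that] by (simp add: R_def I_def)
    show "0 \<le> (\<Sum>i<p. \<Sum>j<p. v i * R i j * v j)" for v
    proof -
      have "(\<Sum>i<p. \<Sum>j<p. v i * R i j * v j)
          = sqrt s * ((\<Sum>i<p. v i * (\<Sum>j<p. I i j * v j)) - (\<Sum>i<p. \<Sum>j<p. v i * Y i j * v j))"
        by (simp add: R_def algebra_simps sum_subtractf sum_distrib_left)
      also have "(\<Sum>i<p. v i * (\<Sum>j<p. I i j * v j)) = (\<Sum>i<p. (v i)\<^sup>2)"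
        by (simp add: I1 power2_eq_square)
      finally show ?thesis
        using Yle[of v] s by simp
    qed
    show "(\<Sum>l<p. R i l * R l j) = A i j" if ij: "i < p" "j < p" for i j
    proof -
      have "(\<Sum>l<p. R i l * R l j) = (\<Sum>l<p. s * ((I i l - Y i l) * (I l j - Y l j)))"
      proof (rule sum.cong)
        fix l
        have "R i l * R l j = (sqrt s * sqrt s) * ((I i l - Y i l) * (I l j - Y l j))"
          by (simp add: R_def mult_ac)
        also have "sqrt s * sqrt s = s" using s by simp
        finally show "R i l * R l j = s * ((I i l - Y i l) * (I l j - Y l j))" .
      qed simp
      also have "\<dots> = s * ((\<Sum>l<p. I i l * I l j) - (\<Sum>l<p. I i l * Y l j) - (\<Sum>l<p. Y i l * I l j)
          + (\<Sum>l<p. Y i l * Y l j))"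
        by (simp add: sum_distrib_left sum.distrib sum_subtractf algebra_simps)
      also have "\<dots> = s * (I i j - 2 * Y i j + (\<Sum>l<p. Y i l * Y l j))"
        using ij by (simp add: I1 I2)
      also have "\<dots> = A i j"
        using s by (simp add: Yeq[OF ij] B_def)
      finally show ?thesis .
    qed
  qed
qed

section \<open>Passage from coordinate functions to matrices, and the properties of
  \<open>mat_sqrt\<close>\<close>

lemma quad_form_eq_sum:
  fixes A :: "real mat"
  assumes "A \<in> carrier_mat p p" "v \<in> carrier_vec p"
  shows "v \<bullet> (A *\<^sub>v v) = (\<Sum>i<p. \<Sum>j<p. v $ i * A $$ (i, j) * v $ j)"
  using assms by (simp add: scalar_prod_def lessThan_atLeast0 sum_distrib_left mult.assoc)

lemma psd_mat_iff:
  assumes A: "A \<in> carrier_mat p p"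
  shows "psd_mat A \<longleftrightarrow> (\<forall>i<p. \<forall>j<p. A $$ (i, j) = A $$ (j, i))
    \<and> (\<forall>v. 0 \<le> (\<Sum>i<p. \<Sum>j<p. v i * A $$ (i, j) * v j))"
proof -
  have "(transpose_mat A = A) \<longleftrightarrow> (\<forall>i<p. \<forall>j<p. A $$ (i, j) = A $$ (j, i))"
    using A by (auto simp: mat_eq_iff)
  moreover have "(\<forall>v\<in>carrier_vec p. 0 \<le> v \<bullet> (A *\<^sub>v v))
      \<longleftrightarrow> (\<forall>v. 0 \<le> (\<Sum>i<p. \<Sum>j<p. v i * A $$ (i, j) * v j))"
  proof safe
    fix v :: "nat \<Rightarrow> real"
    assume "\<forall>v\<in>carrier_vec p. 0 \<le> v \<bullet> (A *\<^sub>v v)"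
    then have "0 \<le> vec p v \<bullet> (A *\<^sub>v vec p v)" by simp
    then show "0 \<le> (\<Sum>i<p. \<Sum>j<p. v i * A $$ (i, j) * v j)"
      by (subst (asm) quad_form_eq_sum[OF A]) auto
  next
    fix v :: "real vec"
    assume "\<forall>v. 0 \<le> (\<Sum>i<p. \<Sum>j<p. v i * A $$ (i, j) * v j)" "v \<in> carrier_vec p"
    then show "0 \<le> v \<bullet> (A *\<^sub>v v)"
      by (subst quad_form_eq_sum[OF A]) auto
  qed
  ultimately show ?thesis
    using A by (auto simp: psd_mat_def)
qed

text \<open>By \<open>psd_image_bound\<close>, a zero of the quadratic form has an image of norm
  zero.\<close>

lemma psd_kernel:
  fixes A :: "nat \<Rightarrow> nat \<Rightarrow> real"
  assumes sym: "\<And>i j. i < p \<Longrightarrow> j < p \<Longrightarrow> A i j = A j i"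
    and psd: "\<And>v. 0 \<le> (\<Sum>i<p. \<Sum>j<p. v i * A i j * v j)"
    and "(\<Sum>i<p. \<Sum>j<p. v i * A i j * v j) = 0" "i < p"
  shows "(\<Sum>j<p. A i j * v j) = 0"
proof -
  have "(\<Sum>i<p. (\<Sum>j<p. A i j * v j)\<^sup>2)
      \<le> (1 + (\<Sum>i<p. \<Sum>j<p. \<bar>A i j\<bar>)) * (\<Sum>i<p. \<Sum>j<p. v i * A i j * v j)"
    by (rule psd_image_bound[OF sym psd]) (auto intro!: add_pos_nonneg sum_nonneg)
  then have "(\<Sum>i<p. (\<Sum>j<p. A i j * v j)\<^sup>2) = 0"
    using assms(3) by (simp add: sum_nonneg order_antisym)
  then show ?thesis
    using \<open>i < p\<close> by (subst (asm) sum_nonneg_eq_0_iff) auto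
qed

text \<open>
  If \<open>R\<^sup>2 = T\<^sup>2\<close>, then \<open>K = R + T\<close> and \<open>E = R - T\<close> anticommute, so that the trace of \<open>E K E\<close>
  equals its own negative.
\<close>

lemma psd_square_root_unique:
  fixes A R T :: "nat \<Rightarrow> nat \<Rightarrow> real"
  assumes R: "\<And>i j. i < p \<Longrightarrow> j < p \<Longrightarrow> R i j = R j i"
      "\<And>v. 0 \<le> (\<Sum>i<p. \<Sum>j<p. v i * R i j * v j)"
      "\<And>i j. i < p \<Longrightarrow> j < p \<Longrightarrow> (\<Sum>l<p. R i l * R l j) = A i j"
    and T: "\<And>i j. i < p \<Longrightarrow> j < p \<Longrightarrow> T i j = T j i"
      "\<And>v. 0 \<le> (\<Sum>i<p. \<Sum>j<p. v i * T i j * v j)"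
      "\<And>i j. i < p \<Longrightarrow> j < p \<Longrightarrow> (\<Sum>l<p. T i l * T l j) = A i j"
    and inj: "\<forall>v. (\<forall>i<p. (\<Sum>j<p. A i j * v j) = 0) \<longrightarrow> (\<forall>i<p. v i = 0)"
    and ij: "i < p" "j < p"
  shows "R i j = T i j"
proof -
  define K where "K i j = R i j + T i j" for i j
  define E where "E i j = R i j - T i j" for i j
  have Esym: "E i j = E j i" if "i < p" "j < p" for i j
    using R(1)[OF that] T(1)[OF that] by (simp add: E_def)
  have anti: "(\<Sum>c<p. K b c * E c a) = - (\<Sum>c<p. E b c * K c a)" if "a < p" "b < p" for a b
  proof -
    have "(\<Sum>c<p. K b c * E c a) + (\<Sum>c<p. E b c * K c a)
        = 2 * (\<Sum>c<p. R b c * R c a) - 2 * (\<Sum>c<p. T b c * T c a)"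
      unfolding sum_distrib_left sum.distrib[symmetric] sum_subtractf[symmetric]
      by (intro sum.cong refl) (simp add: K_def E_def algebra_simps)
    then show ?thesis using R(3) T(3) that by simp
  qed
  define Z where "Z = (\<Sum>a<p. \<Sum>b<p. \<Sum>c<p. E a b * K b c * E c a)"
  have "Z = (\<Sum>a<p. \<Sum>b<p. E a b * (\<Sum>c<p. K b c * E c a))"
    by (simp add: Z_def sum_distrib_left mult.assoc)
  also have "\<dots> = - (\<Sum>a<p. \<Sum>b<p. \<Sum>c<p. E a b * E b c * K c a)"
    by (simp add: anti sum_negf sum_distrib_left mult.assoc)
  also have "(\<Sum>a<p. \<Sum>b<p. \<Sum>c<p. E a b * E b c * K c a) = (\<Sum>b<p. \<Sum>a<p. \<Sum>c<p. E a b * E b c * K c a)"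
    by (rule sum.swap)
  also have "\<dots> = (\<Sum>b<p. \<Sum>c<p. \<Sum>a<p. E b c * K c a * E a b)"
    by (subst sum.swap[of _ "{..<p}" "{..<p}"]) (simp add: mult_ac)
  also have "\<dots> = Z"
    by (simp add: Z_def)
  finally have "Z = 0" by simp
  \<comment> \<open>By symmetry of \<open>E\<close>, the trace is a sum over the columns of
    \<open>E\<close> of the forms of \<open>R\<close> and \<open>T\<close>. All summands are
    nonnegative and the total is zero, so each one vanishes.\<close>
  moreover have "Z = (\<Sum>a<p. \<Sum>b<p. \<Sum>c<p. E b a * K b c * E c a)"
    using Esym by (simp add: Z_def)
  moreover have "(\<Sum>b<p. \<Sum>c<p. E b a * K b c * E c a)
      = (\<Sum>b<p. \<Sum>c<p. E b a * R b c * E c a) + (\<Sum>b<p. \<Sum>c<p. E b a * T b c * E c a)" for a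
    by (simp add: K_def algebra_simps sum.distrib)
  ultimately have "(\<Sum>a<p. (\<Sum>b<p. \<Sum>c<p. E b a * R b c * E c a) + (\<Sum>b<p. \<Sum>c<p. E b a * T b c * E c a)) = 0"
    by simp
  then have "\<forall>a\<in>{..<p}. (\<Sum>b<p. \<Sum>c<p. E b a * R b c * E c a) + (\<Sum>b<p. \<Sum>c<p. E b a * T b c * E c a) = 0"
    by (subst (asm) sum_nonneg_eq_0_iff)
      (auto intro!: add_nonneg_nonneg R(2)[of "\<lambda>b. E b _"] T(2)[of "\<lambda>b. E b _"])
  then have "(\<Sum>b<p. \<Sum>c<p. E b j * R b c * E c j) + (\<Sum>b<p. \<Sum>c<p. E b j * T b c * E c j) = 0"
    using ij by blast
  then have RE: "(\<Sum>b<p. \<Sum>c<p. E b j * R b c * E c j) = 0"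
    using R(2)[of "\<lambda>b. E b j"] T(2)[of "\<lambda>b. E b j"] by linarith
  \<comment> \<open>\<open>psd_kernel\<close> gives \<open>R (E e_j) = 0\<close>. Since
    \<open>A = R R\<close>, also \<open>A (E e_j) = 0\<close>, and injectivity of \<open>A\<close>
    kills the column.\<close>
  have "\<forall>b<p. (\<Sum>c<p. A b c * E c j) = 0"
  proof safe
    fix b assume "b < p"
    have "(\<Sum>c<p. A b c * E c j) = (\<Sum>c<p. \<Sum>l<p. R b l * R l c * E c j)"
      using \<open>b < p\<close> by (intro sum.cong refl) (simp add: R(3)[symmetric] sum_distrib_right)
    also have "\<dots> = (\<Sum>l<p. R b l * (\<Sum>c<p. R l c * E c j))"
      by (subst sum.swap) (simp add: sum_distrib_left mult.assoc)
    also have "\<dots> = 0"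
      using psd_kernel[OF R(1,2) RE] by simp
    finally show "(\<Sum>c<p. A b c * E c j) = 0" .
  qed
  then have "\<forall>i<p. E i j = 0"
    using inj[rule_format, of "\<lambda>c. E c j"] by blast
  then show ?thesis
    using ij by (simp add: E_def)
qed

text \<open>Unfolding the definite description takes existence and uniqueness together. Strict
  positivity supplies the injectivity for uniqueness: \<open>A v = 0\<close> would make the form
  vanish at \<open>v\<close>.\<close>

lemma mat_sqrt_pd:
  assumes pd: "pd_mat A" and A: "A \<in> carrier_mat p p"
  shows "mat_sqrt A \<in> carrier_mat p p" "transpose_mat (mat_sqrt A) = mat_sqrt A"
    "mat_sqrt A * mat_sqrt A = A"
proof -
  have sym: "A $$ (i, j) = A $$ (j, i)" if "i < p" "j < p" for i j
    using pd A that unfolding pd_mat_def by (metis carrier_matD index_transpose_mat(1))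
  have pos: "0 < (\<Sum>i<p. \<Sum>j<p. v i * A $$ (i, j) * v j)" if "i < p" "v i \<noteq> 0" for v :: "nat \<Rightarrow> real" and i
  proof -
    have "vec p v \<noteq> 0\<^sub>v p"
      using that by (metis index_vec index_zero_vec(1))
    then have "0 < vec p v \<bullet> (A *\<^sub>v vec p v)"
      using pd A by (auto simp: pd_mat_def)
    then show ?thesis by (subst (asm) quad_form_eq_sum[OF A]) auto
  qed
  have psd: "0 \<le> (\<Sum>i<p. \<Sum>j<p. v i * A $$ (i, j) * v j)" for v
  proof (cases "\<exists>i<p. v i \<noteq> 0")
    case False
    then show ?thesis by simp
  qed (use pos in \<open>auto intro: less_imp_le\<close>)
  have inj: "\<forall>v. (\<forall>i<p. (\<Sum>j<p. A $$ (i, j) * v j) = 0) \<longrightarrow> (\<forall>i<p. v i = 0)"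
  proof (intro allI impI, rule ccontr)
    fix v :: "nat \<Rightarrow> real" and i
    assume that: "\<forall>i<p. (\<Sum>j<p. A $$ (i, j) * v j) = 0" "i < p"
    assume "v i \<noteq> 0"
    moreover have "(\<Sum>i<p. \<Sum>j<p. v i * A $$ (i, j) * v j) = (\<Sum>i<p. v i * (\<Sum>j<p. A $$ (i, j) * v j))"
      by (simp add: sum_distrib_left mult.assoc)
    ultimately show False
      using pos[of i v] that by simp
  qed
  have mult_eq: "R * R = A \<longleftrightarrow> (\<forall>i<p. \<forall>j<p. (\<Sum>l<p. R $$ (i, l) * R $$ (l, j)) = A $$ (i, j))"
    if "R \<in> carrier_mat p p" for R
    using A that by (auto simp: mat_eq_iff scalar_prod_def lessThan_atLeast0)
  obtain R where R: "\<And>i j. i < p \<Longrightarrow> j < p \<Longrightarrow> R i j = R j i"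
      "\<And>v. 0 \<le> (\<Sum>i<p. \<Sum>j<p. v i * R i j * v j)"
      "\<And>i j. i < p \<Longrightarrow> j < p \<Longrightarrow> (\<Sum>l<p. R i l * R l j) = A $$ (i, j)"
    using psd_square_root_exists[of p "\<lambda>i j. A $$ (i, j)", OF sym psd] by auto
  let ?P = "\<lambda>R. psd_mat R \<and> dim_row R = dim_row A \<and> R * R = A"
  have "\<exists>!R. ?P R"
  proof
    let ?R = "mat p p (\<lambda>(i, j). R i j)"
    show "?P ?R"
      using A R by (auto simp: psd_mat_iff[of _ p] mult_eq)
  next
    fix T assume T: "?P T"
    then have Tc: "T \<in> carrier_mat p p"
      using A by (auto simp: psd_mat_def)
    have T': "\<And>i j. i < p \<Longrightarrow> j < p \<Longrightarrow> T $$ (i, j) = T $$ (j, i)"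
        "\<And>v. 0 \<le> (\<Sum>i<p. \<Sum>j<p. v i * T $$ (i, j) * v j)"
        "\<And>i j. i < p \<Longrightarrow> j < p \<Longrightarrow> (\<Sum>l<p. T $$ (i, l) * T $$ (l, j)) = A $$ (i, j)"
      using T psd_mat_iff[OF Tc] mult_eq[OF Tc] by blast+
    have "R i j = T $$ (i, j)" if "i < p" "j < p" for i j
      using psd_square_root_unique[where p = p and R = R and T = "\<lambda>i j. T $$ (i, j)"
          and A = "\<lambda>i j. A $$ (i, j)", OF R T' inj that] .
    then show "T = mat p p (\<lambda>(i, j). R i j)"
      using Tc by (auto simp: mat_eq_iff)
  qed
  then have "?P (mat_sqrt A)"
    unfolding mat_sqrt_def by (rule theI')
  then show "mat_sqrt A \<in> carrier_mat p p" "transpose_mat (mat_sqrt A) = mat_sqrt A"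
    "mat_sqrt A * mat_sqrt A = A"
    using A by (auto simp: psd_mat_def)
qed

section \<open>Projections and dual systems\<close>

text \<open>
  The projection off the columns \<open>b \<in> set bs\<close> of \<open>x\<close>, by Gram--Schmidt. A column that depends
  linearly on its predecessors contributes nothing because \<open>u = 0\<close> and \<open>0 / 0 = 0\<close>. Unlike a
  formula with a matrix inverse, the recursion is visibly measurable in \<open>x\<close>.
\<close>

fun gs_proj :: "nat \<Rightarrow> (nat \<times> nat \<Rightarrow> real) \<Rightarrow> nat list \<Rightarrow> nat \<Rightarrow> nat \<Rightarrow> real" where
  "gs_proj n x [] = (\<lambda>i k. if i = k then 1 else 0)"
| "gs_proj n x (b # bs) =
     (let Q = gs_proj n x bs; u = (\<lambda>i. \<Sum>l<n. Q i l * x (l, b))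
      in (\<lambda>i k. Q i k - u i * u k / (\<Sum>l<n. (u l)\<^sup>2)))"

lemma gs_proj_sym: "gs_proj n x bs i k = gs_proj n x bs k i"
proof (induction bs arbitrary: i k)
  case (Cons b bs)
  then show ?case
    by (simp add: Let_def mult.commute)
qed auto

text \<open>The vector \<open>u = Q x_b\<close> lies in the range of \<open>Q\<close>, so
  \<open>Q u = u\<close> and subtracting \<open>u u^T / s\<close> removes a rank-one projection. For
  \<open>s = 0\<close> every correction term is a quotient by zero and disappears.\<close>

lemma gs_proj_idem:
  "i < n \<Longrightarrow> k < n \<Longrightarrow> (\<Sum>l<n. gs_proj n x bs i l * gs_proj n x bs l k) = gs_proj n x bs i k"
proof (induction bs arbitrary: i k)
  case Nil
  then show ?case
    by (simp add: if_distrib[of "\<lambda>y. y * _"] cong: if_cong)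
next
  case (Cons b bs)
  define Q where "Q = gs_proj n x bs"
  define u where "u i = (\<Sum>l<n. Q i l * x (l, b))" for i
  define s where "s = (\<Sum>l<n. (u l)\<^sup>2)"
  have Q': "gs_proj n x (b # bs) i k = Q i k - u i * u k / s" for i k
    by (simp add: Q_def u_def s_def Let_def)
  have idem: "(\<Sum>l<n. Q i l * Q l k) = Q i k" if "i < n" "k < n" for i k
    unfolding Q_def using that by (rule Cons.IH)
  have sym: "Q i k = Q k i" for i k
    unfolding Q_def by (rule gs_proj_sym)
  have Qu: "(\<Sum>l<n. Q i l * u l) = u i" if "i < n" for i
  proof -
    have "(\<Sum>l<n. Q i l * u l) = (\<Sum>j<n. (\<Sum>l<n. Q i l * Q l j) * x (j, b))"
      unfolding u_def sum_distrib_left sum_distrib_right by (subst sum.swap) (simp add: mult.assoc)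
    then show ?thesis using that by (simp add: idem u_def)
  qed
  have uQ: "(\<Sum>l<n. u l * Q l i) = u i" if "i < n" for i
    using Qu[OF that] by (simp add: sym mult.commute)
  have "(\<Sum>l<n. (Q i l - u i * u l / s) * (Q l k - u l * u k / s))
      = (\<Sum>l<n. Q i l * Q l k - (Q i l * u l) * (u k / s) - (u i / s) * (u l * Q l k)
          + (u i * u k / s\<^sup>2) * (u l)\<^sup>2)"
    by (intro sum.cong refl) (simp add: algebra_simps power2_eq_square)
  also have "\<dots> = (\<Sum>l<n. Q i l * Q l k) - (\<Sum>l<n. Q i l * u l) * (u k / s)
      - (u i / s) * (\<Sum>l<n. u l * Q l k) + (u i * u k / s\<^sup>2) * s"
    by (simp only: sum.distrib sum_subtractf sum_distrib_left sum_distrib_right s_def)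
  also have "\<dots> = Q i k - u i * u k / s - u i * u k / s + (u i * u k / s\<^sup>2) * s"
    using Cons.prems by (simp add: idem Qu uQ)
  also have "\<dots> = Q i k - u i * u k / s"
    by (cases "s = 0") (simp_all add: power2_eq_square)
  finally show ?case
    by (simp only: Q')
qed

text \<open>The rank-one corrections do not see \<open>w\<close>, because
  \<open>w . u = (Q w) . x_b = w . x_b = 0\<close> by induction.\<close>

lemma gs_proj_fixes:
  assumes "\<And>b. b \<in> set bs \<Longrightarrow> (\<Sum>i<n. w i * x (i, b)) = 0" "k < n"
  shows "(\<Sum>i<n. w i * gs_proj n x bs i k) = w k"
  using assms
proof (induction bs arbitrary: k)
  case Nil
  then show ?case
    by (simp add: if_distrib[of "\<lambda>y. _ * y"] cong: if_cong)
next
  case (Cons b bs)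
  define Q where "Q = gs_proj n x bs"
  define u where "u i = (\<Sum>l<n. Q i l * x (l, b))" for i
  define s where "s = (\<Sum>l<n. (u l)\<^sup>2)"
  have IH: "(\<Sum>i<n. w i * Q i k) = w k" if "k < n" for k
    unfolding Q_def using Cons.prems that by (intro Cons.IH) auto
  have "(\<Sum>i<n. w i * u i) = (\<Sum>l<n. (\<Sum>i<n. w i * Q i l) * x (l, b))"
    unfolding u_def sum_distrib_left sum_distrib_right by (subst sum.swap) (simp add: mult.assoc)
  also have "\<dots> = 0"
    using Cons.prems(1)[of b] by (simp add: IH)
  finally have wu: "(\<Sum>i<n. w i * u i) = 0" .
  have "(\<Sum>i<n. w i * gs_proj n x (b # bs) i k) = (\<Sum>i<n. w i * Q i k - (w i * u i) * (u k / s))"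
    by (intro sum.cong refl) (simp add: Q_def u_def s_def Let_def algebra_simps)
  also have "\<dots> = (\<Sum>i<n. w i * Q i k) - (\<Sum>i<n. w i * u i) * (u k / s)"
    by (simp only: sum_subtractf sum_distrib_right)
  finally show ?case
    using IH[OF Cons.prems(2)] wu by simp
qed

text \<open>Move the symmetric projection onto \<open>w\<close>, which it fixes. If the right-hand
  side is 1, the residual of column \<open>b\<close> cannot be zero.\<close>

lemma gs_proj_dual_nonzero:
  assumes "\<And>b. b \<in> set bs \<Longrightarrow> (\<Sum>i<n. w i * x (i, b)) = 0"
  shows "(\<Sum>i<n. w i * (\<Sum>l<n. gs_proj n x bs i l * x (l, b))) = (\<Sum>i<n. w i * x (i, b))"
proof -
  have "(\<Sum>i<n. w i * (\<Sum>l<n. gs_proj n x bs i l * x (l, b)))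
      = (\<Sum>l<n. (\<Sum>i<n. w i * gs_proj n x bs i l) * x (l, b))"
    unfolding sum_distrib_left sum_distrib_right by (subst sum.swap) (simp add: mult.assoc)
  also have "\<dots> = (\<Sum>l<n. w l * x (l, b))"
    by (intro sum.cong refl) (simp add: gs_proj_fixes assms)
  finally show ?thesis .
qed

text \<open>The dual system \<open>L\<close> encodes linear independence of the columns: pairing
  with \<open>L b\<close> shows that the residual of \<open>b\<close> is nonzero, so each step
  lowers the trace by exactly \<open>s / s = 1\<close>.\<close>

lemma gs_proj_trace:
  assumes "distinct bs"
    and "\<And>b b'. b \<in> set bs \<Longrightarrow> b' \<in> set bs \<Longrightarrow> (\<Sum>i<n. L b i * x (i, b')) = (if b = b' then 1 else 0)"
  shows "(\<Sum>i<n. gs_proj n x bs i i) = real n - real (length bs)"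
  using assms
proof (induction bs)
  case (Cons b bs)
  define Q where "Q = gs_proj n x bs"
  define u where "u i = (\<Sum>l<n. Q i l * x (l, b))" for i
  define s where "s = (\<Sum>l<n. (u l)\<^sup>2)"
  have "(\<Sum>i<n. L b i * u i) = (\<Sum>i<n. L b i * x (i, b))"
    unfolding u_def Q_def using Cons.prems by (intro gs_proj_dual_nonzero) auto
  also have "\<dots> = 1"
    using Cons.prems(2)[of b b] by simp
  finally have dual: "(\<Sum>i<n. L b i * u i) = 1" .
  have "s \<noteq> 0"
  proof
    assume "s = 0"
    then have "\<forall>i\<in>{..<n}. (u i)\<^sup>2 = 0"
      unfolding s_def by (subst (asm) sum_nonneg_eq_0_iff) auto
    then show False
      using dual by simp
  qed
  have "(\<Sum>i<n. gs_proj n x (b # bs) i i) = (\<Sum>i<n. Q i i - (u i)\<^sup>2 / s)"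
    by (simp add: Q_def u_def s_def Let_def power2_eq_square)
  also have "\<dots> = (\<Sum>i<n. Q i i) - s / s"
    by (simp add: sum_subtractf s_def flip: sum_divide_distrib)
  also have "(\<Sum>i<n. Q i i) = real n - real (length bs)"
    unfolding Q_def using Cons.prems by (intro Cons.IH) auto
  finally show ?case
    using \<open>s \<noteq> 0\<close> by simp
qed simp

text \<open>A symmetric idempotent has \<open>Q_ii = \<Sum> Q_il^2\<close>, so
  \<open>Q_ii^2 \<le> Q_ii \<le> 1\<close> and every entry of row \<open>i\<close> has square at
  most \<open>Q_ii\<close>. This gives integrability of the entries for free.\<close>

lemma gs_proj_bounded:
  assumes "i < n" "k < n"
  shows "\<bar>gs_proj n x bs i k\<bar> \<le> 1"
proof -
  let ?Q = "gs_proj n x bs"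
  have diag: "?Q i i = (\<Sum>l<n. (?Q i l)\<^sup>2)"
  proof -
    have "(\<Sum>l<n. (?Q i l)\<^sup>2) = (\<Sum>l<n. ?Q i l * ?Q l i)"
      unfolding power2_eq_square by (intro sum.cong refl arg_cong2[where f = "(*)"] gs_proj_sym)
    then show ?thesis
      using gs_proj_idem[of i n i x bs] assms by simp
  qed
  have le: "(?Q i l)\<^sup>2 \<le> ?Q i i" if "l < n" for l
    unfolding diag using that by (intro member_le_sum) auto
  have "?Q i i \<le> 1"
    using le[OF assms(1)] by (cases "?Q i i \<le> 0") (auto simp: power2_eq_square mult_le_cancel_right2)
  then have "(?Q i k)\<^sup>2 \<le> 1"
    using le[OF assms(2)] by simp
  then show ?thesis
    by (simp add: abs_square_le_1)
qed

text \<open>Expresses that the projection off the other columns is independent of column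
  \<open>a\<close>, in the form that the product-measure lemmas use.\<close>

lemma gs_proj_update:
  "a \<notin> set bs \<Longrightarrow> gs_proj n (x((i, a) := y)) bs = gs_proj n x bs"
  by (induction bs) (auto simp: Let_def)

lemma sum_rotate3:
  "(\<Sum>i\<in>A. \<Sum>k\<in>B. \<Sum>l\<in>C. f i k l) = (\<Sum>k\<in>B. \<Sum>l\<in>C. \<Sum>i\<in>A. f i k l)"
proof -
  have "(\<Sum>i\<in>A. \<Sum>k\<in>B. \<Sum>l\<in>C. f i k l) = (\<Sum>k\<in>B. \<Sum>i\<in>A. \<Sum>l\<in>C. f i k l)"
    by (rule sum.swap)
  also have "\<dots> = (\<Sum>k\<in>B. \<Sum>l\<in>C. \<Sum>i\<in>A. f i k l)"
    by (intro sum.cong refl sum.swap)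
  finally show ?thesis .
qed

text \<open>Expand \<open>|w - v / m|^2 \<ge> 0\<close> for the residual \<open>v = Q x_a\<close>,
  using \<open>w . v = 1\<close> and \<open>|v|^2 = x_a . Q x_a\<close>. The bound is affine in that
  quadratic form, so its expectation can be computed, and nothing is divided by
  \<open>|v|^2\<close>.\<close>

lemma dual_row_norm_ge:
  fixes m :: real
  assumes a: "(\<Sum>i<n. w i * x (i, a)) = 1"
    and bs: "\<And>b. b \<in> set bs \<Longrightarrow> (\<Sum>i<n. w i * x (i, b)) = 0"
    and m: "0 < m"
  shows "2 / m - (\<Sum>i<n. \<Sum>k<n. gs_proj n x bs i k * (x (i, a) * x (k, a))) / m\<^sup>2 \<le> (\<Sum>i<n. (w i)\<^sup>2)"
proof -
  define Q where "Q = gs_proj n x bs"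
  define v where "v i = (\<Sum>k<n. Q i k * x (k, a))" for i
  have wv: "(\<Sum>i<n. w i * v i) = 1"
    unfolding v_def Q_def by (rule trans[OF gs_proj_dual_nonzero a]) (rule bs)
  have "(v i)\<^sup>2 = (\<Sum>k<n. Q k i * x (k, a)) * (\<Sum>l<n. Q i l * x (l, a))" for i
    unfolding power2_eq_square v_def Q_def by (subst (1) gs_proj_sym) simp
  then have "(\<Sum>i<n. (v i)\<^sup>2) = (\<Sum>i<n. \<Sum>k<n. \<Sum>l<n. x (k, a) * (Q k i * Q i l) * x (l, a))"
    by (simp add: sum_product mult_ac)
  also have "\<dots> = (\<Sum>k<n. \<Sum>l<n. \<Sum>i<n. x (k, a) * (Q k i * Q i l) * x (l, a))"
    by (rule sum_rotate3)
  also have "\<dots> = (\<Sum>k<n. \<Sum>l<n. x (k, a) * (\<Sum>i<n. Q k i * Q i l) * x (l, a))"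
    by (simp only: sum_distrib_left sum_distrib_right)
  also have "\<dots> = (\<Sum>k<n. \<Sum>l<n. Q k l * (x (k, a) * x (l, a)))"
    by (intro sum.cong refl) (simp add: Q_def gs_proj_idem)
  finally have vv: "(\<Sum>i<n. (v i)\<^sup>2) = (\<Sum>k<n. \<Sum>l<n. Q k l * (x (k, a) * x (l, a)))" .
  have "0 \<le> (\<Sum>i<n. (w i - v i / m)\<^sup>2)"
    by (intro sum_nonneg) auto
  also have "\<dots> = (\<Sum>i<n. (w i)\<^sup>2 - (2 / m) * (w i * v i) + (v i)\<^sup>2 / m\<^sup>2)"
    by (intro sum.cong refl) (simp add: power2_diff power_divide)
  also have "\<dots> = (\<Sum>i<n. (w i)\<^sup>2) - (2 / m) * (\<Sum>i<n. w i * v i) + (\<Sum>i<n. (v i)\<^sup>2) / m\<^sup>2"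
    by (simp add: sum.distrib sum_subtractf sum_distrib_left sum_divide_distrib)
  finally show ?thesis
    unfolding wv vv Q_def by simp
qed

text \<open>\<open>P i k = \<Sum>a. x (i, a) * L a k\<close> is the orthogonal projection onto the column space.\<close>

lemma projection_sum_bounds:
  fixes L :: "nat \<Rightarrow> nat \<Rightarrow> real"
  assumes dual: "\<And>a b. a < p \<Longrightarrow> b < p \<Longrightarrow> (\<Sum>i<n. L a i * x (i, b)) = (if a = b then 1 else 0)"
    and sym: "\<And>i k. i < n \<Longrightarrow> k < n \<Longrightarrow> (\<Sum>a<p. x (i, a) * L a k) = (\<Sum>a<p. x (k, a) * L a i)"
  shows "0 \<le> (\<Sum>i<n. \<Sum>k<n. \<Sum>a<p. x (i, a) * L a k)"
    and "(\<Sum>i<n. \<Sum>k<n. \<Sum>a<p. x (i, a) * L a k) \<le> real n"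
proof -
  define P where "P i k = (\<Sum>a<p. x (i, a) * L a k)" for i k
  define r where "r i = (\<Sum>k<n. P i k)" for i
  define q where "q = (\<Sum>i<n. r i)"
  have idem: "(\<Sum>l<n. P i l * P l k) = P i k" for i k
  proof -
    have "(\<Sum>l<n. P i l * P l k) = (\<Sum>l<n. \<Sum>a<p. \<Sum>b<p. x (i, a) * (L a l * x (l, b)) * L b k)"
      by (simp add: P_def sum_product mult.assoc)
    also have "\<dots> = (\<Sum>a<p. \<Sum>b<p. \<Sum>l<n. x (i, a) * (L a l * x (l, b)) * L b k)"
      by (rule sum_rotate3)
    also have "\<dots> = (\<Sum>a<p. \<Sum>b<p. x (i, a) * (\<Sum>l<n. L a l * x (l, b)) * L b k)"
      by (simp only: sum_distrib_left sum_distrib_right)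
    also have "\<dots> = (\<Sum>a<p. \<Sum>b<p. (if a = b then x (i, a) * L b k else 0))"
      by (intro sum.cong refl) (simp add: dual)
    also have "\<dots> = P i k"
      by (simp add: P_def)
    finally show ?thesis .
  qed
  \<comment> \<open>\<open>r\<close> is the projection of the all-ones vector and \<open>q\<close>
    their inner product, so \<open>|r|^2 = q\<close>. Cauchy-Schwarz against the all-ones vector
    then yields \<open>q^2 \<le> n q\<close>.\<close>
  have sq: "(\<Sum>l<n. (r l)\<^sup>2) = q"
  proof -
    have "(\<Sum>l<n. (r l)\<^sup>2) = (\<Sum>l<n. \<Sum>i<n. \<Sum>k<n. P i l * P l k)"
      unfolding power2_eq_square r_def sum_product
      using sym by (intro sum.cong refl) (simp add: P_def)
    also have "\<dots> = (\<Sum>i<n. \<Sum>k<n. \<Sum>l<n. P i l * P l k)"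
      by (rule sum_rotate3)
    finally show ?thesis
      by (simp add: idem q_def r_def)
  qed
  have "0 \<le> q"
    unfolding sq[symmetric] by (intro sum_nonneg) auto
  then show "0 \<le> (\<Sum>i<n. \<Sum>k<n. \<Sum>a<p. x (i, a) * L a k)"
    unfolding q_def r_def P_def .
  have "q\<^sup>2 \<le> real n * q"
    using Cauchy_Schwarz_ineq_sum[of "\<lambda>_. 1" r "{..<n}"] sq by (simp add: q_def)
  then have "q \<le> real n"
    by (cases "q \<le> 0") (auto simp: power2_eq_square)
  then show "(\<Sum>i<n. \<Sum>k<n. \<Sum>a<p. x (i, a) * L a k) \<le> real n"
    by (simp add: q_def r_def P_def)
qed

section \<open>The prediction error for a fixed design\<close>

lemma minv_inverse:
  assumes A: "A \<in> carrier_mat p p" and inv: "invertible_mat A"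
  shows "minv A \<in> carrier_mat p p" "A * minv A = 1\<^sub>m p" "minv A * A = 1\<^sub>m p"
proof -
  have "\<exists>B. inverts_mat A B \<and> inverts_mat B A"
    using inv by (simp add: invertible_mat_def)
  then have "inverts_mat A (minv A) \<and> inverts_mat (minv A) A"
    unfolding minv_def using inv by (simp only: if_True) (rule someI_ex)
  then have 1: "A * minv A = 1\<^sub>m p" and 2: "minv A * A = 1\<^sub>m (dim_row (minv A))"
    using A by (simp_all add: inverts_mat_def)
  have "dim_col (minv A) = p"
    using arg_cong[OF 1, of dim_col] by simp
  moreover have "dim_row (minv A) = p"
    using arg_cong[OF 2, of dim_col] A by simp
  ultimately show "minv A \<in> carrier_mat p p" "A * minv A = 1\<^sub>m p" "minv A * A = 1\<^sub>m p"
    using 1 2 by auto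
qed

text \<open>The zero matrix that \<open>minv\<close> returns for singular arguments has the right
  dimensions, so shapes are known at every sample point.\<close>

lemma minv_carrier: "A \<in> carrier_mat p p \<Longrightarrow> minv A \<in> carrier_mat p p"
  using minv_inverse(1)[of A p] by (cases "invertible_mat A") (simp_all add: minv_def[of A])

lemma minv_eqI:
  assumes A: "A \<in> carrier_mat p p" and B: "B \<in> carrier_mat p p"
    and AB: "A * B = 1\<^sub>m p"
  shows "minv A = B"
proof -
  have "B * A = 1\<^sub>m p"
    by (rule mat_mult_left_right_inverse[OF A B AB])
  then have "invertible_mat A"
    using A B AB by (auto simp: invertible_mat_def inverts_mat_def)
  note m = minv_inverse[OF A this]
  have "minv A = minv A * (A * B)"
    using m B AB by simp
  also have "\<dots> = (minv A * A) * B"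
    by (rule assoc_mult_mat[symmetric]) (use m A B in auto)
  finally show ?thesis
    using m B by simp
qed

lemma smult_mat_vec:
  fixes M :: "real mat"
  assumes "M \<in> carrier_mat r c" "v \<in> carrier_vec c"
  shows "(k \<cdot>\<^sub>m M) *\<^sub>v v = k \<cdot>\<^sub>v (M *\<^sub>v v)"
  using assms by (auto simp: vec_eq_iff scalar_prod_def sum_distrib_left mult.assoc)

lemma pd_sqrt_inverse:
  assumes pd: "pd_mat A" and A: "A \<in> carrier_mat p p"
  obtains T where "T \<in> carrier_mat p p" "mat_sqrt A * T = 1\<^sub>m p" "T * mat_sqrt A = 1\<^sub>m p"
proof -
  note S = mat_sqrt_pd[OF pd A]
  have "det A \<noteq> 0"
  proof
    assume "det A = 0"
    then obtain v where v: "v \<in> carrier_vec p" "v \<noteq> 0\<^sub>v p" "A *\<^sub>v v = 0\<^sub>v p"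
      using det_0_iff_vec_prod_zero[OF A] by blast
    then show False
      using pd A by (auto simp: pd_mat_def)
  qed
  then have "A \<in> Units (ring_mat TYPE(real) p ())"
    by (rule det_non_zero_imp_unit[OF A])
  then obtain B where B: "B \<in> carrier_mat p p" "B * A = 1\<^sub>m p"
    by (auto simp: Units_def ring_mat_def)
  let ?S = "mat_sqrt A"
  \<comment> \<open>The inverse of the root is \<open>A^-1 S\<close>, because
    \<open>A^-1 S S = A^-1 A\<close>.\<close>
  have TS: "(B * ?S) * ?S = 1\<^sub>m p"
    using S B by (simp add: assoc_mult_mat[of _ p p _ p _ p])
  moreover have "?S * (B * ?S) = 1\<^sub>m p"
    by (rule mat_mult_left_right_inverse[OF _ _ TS]) (use S B in auto)
  ultimately show ?thesis
    using that[of "B * ?S"] S B by auto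
qed

text \<open>The leading factor \<open>S\<close> comes from the test point. On an invertible Gram
  matrix it cancels the roots hidden in \<open>X\<close>, and the result is the pseudoinverse of the
  whitened design.\<close>

definition ols_rows :: "nat \<Rightarrow> nat \<Rightarrow> real mat \<Rightarrow> (nat \<times> nat \<Rightarrow> real) \<Rightarrow> real mat" where
  "ols_rows n p S x = (let X = mat n p x * S in S * (minv (transpose_mat X * X) * transpose_mat X))"

definition col_mean :: "nat \<Rightarrow> (nat \<times> nat \<Rightarrow> real) \<Rightarrow> nat \<Rightarrow> real" where
  "col_mean n x a = (\<Sum>i<n. x (i, a)) / real n"

text \<open>Row \<open>a\<close> of the matrix \<open>K\<close>. Centering the covariate alone is
  enough, since \<open>n\<close> times the product of the two means is the column mean times the sum
  of the responses.\<close>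

definition centered_rows :: "nat \<Rightarrow> (nat \<times> nat \<Rightarrow> real) \<Rightarrow> nat \<Rightarrow> nat \<Rightarrow> real" where
  "centered_rows n x a i = (x (i, a) - col_mean n x a) / real n"

text \<open>The rows of the design are \<open>S\<close> applied to the whitened rows, so the right
  factor is the transpose of \<open>S\<close>; symmetry removes the transpose.\<close>

lemma design_eq:
  assumes "pd_mat A" "A \<in> carrier_mat p p"
  shows "design n p A \<omega> = mat n p (fst (snd \<omega>)) * mat_sqrt A"
proof -
  note S = mat_sqrt_pd[OF assms]
  have sym: "mat_sqrt A $$ (i, j) = mat_sqrt A $$ (j, i)" if "i < p" "j < p" for i j
    using S that by (metis carrier_matD index_transpose_mat(1))
  show ?thesis
  proof (rule eq_matI)
    fix i j assume "i < dim_row (mat n p (fst (snd \<omega>)) * mat_sqrt A)" "j < dim_col (mat n p (fst (snd \<omega>)) * mat_sqrt A)"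
    then have "i < n" "j < p" using S by auto
    then show "design n p A \<omega> $$ (i, j) = (mat n p (fst (snd \<omega>)) * mat_sqrt A) $$ (i, j)"
      using S(1) by (auto simp: design_def scalar_prod_def sym mult.commute intro!: sum.cong)
  qed (use S in \<open>auto simp: design_def\<close>)
qed

text \<open>One fixed outcome \<open>x\<close>, so this is pure linear algebra. Invertibility of the
  Gram matrix, which holds only almost surely, is assumed in an inner context, after the error
  identity.\<close>

locale whitened_design =
  fixes n p :: nat and S T :: "real mat" and x :: "nat \<times> nat \<Rightarrow> real"
  assumes S: "S \<in> carrier_mat p p" "transpose_mat S = S"
    and T: "T \<in> carrier_mat p p" "S * T = 1\<^sub>m p" "T * S = 1\<^sub>m p"
    and n: "0 < n"
begin

abbreviation "Xt \<equiv> mat n p x"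
abbreviation "X \<equiv> Xt * S"
abbreviation "A \<equiv> transpose_mat X * X"
abbreviation "L \<equiv> ols_rows n p S x"

lemma carriers:
  "Xt \<in> carrier_mat n p" "X \<in> carrier_mat n p" "transpose_mat X \<in> carrier_mat p n"
  "transpose_mat Xt \<in> carrier_mat p n"
  "A \<in> carrier_mat p p" "minv A \<in> carrier_mat p p" "L \<in> carrier_mat p n"
proof -
  show 1: "Xt \<in> carrier_mat n p" "X \<in> carrier_mat n p" "transpose_mat X \<in> carrier_mat p n"
    "transpose_mat Xt \<in> carrier_mat p n" "A \<in> carrier_mat p p"
    using S by auto
  then show m: "minv A \<in> carrier_mat p p"
    by (intro minv_carrier)
  show "L \<in> carrier_mat p n"
    unfolding ols_rows_def Let_def by (rule mult_carrier_mat[OF S(1) mult_carrier_mat[OF m 1(3)]])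
qed

lemma transpose_X: "transpose_mat X = S * transpose_mat Xt"
  using S carriers by (simp add: transpose_mult[of _ n p])

lemma S_ols:
  assumes "Y \<in> carrier_vec n"
  shows "S *\<^sub>v ols X Y = L *\<^sub>v Y"
  using S carriers assms
  by (simp add: ols_def ols_rows_def Let_def assoc_mult_mat_vec[of _ p p _ n] assoc_mult_mat_vec[of _ p p _ p])

text \<open>\<open>X^T Y\<close> and the mean vector of \<open>X\<close> both carry a left factor
  \<open>S\<close>, and \<open>S H^-1 S = I / n\<close>, so the covariance cancels
  completely.\<close>

lemma S_breve:
  assumes Y: "Y \<in> carrier_vec n" and H: "H = real n \<cdot>\<^sub>m (S * S)"
  shows "S *\<^sub>v breve H X Y = vec p (\<lambda>a. \<Sum>i<n. centered_rows n x a i * Y $ i)"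
proof -
  have "minv H = (1 / real n) \<cdot>\<^sub>m (T * T)"
  proof (rule minv_eqI)
    show "H \<in> carrier_mat p p" "(1 / real n) \<cdot>\<^sub>m (T * T) \<in> carrier_mat p p"
      using S T H by auto
    have "S * S * (T * T) = S * ((S * T) * T)"
      using S T(1) by (simp add: assoc_mult_mat[of _ p p _ p _ p])
    also have "\<dots> = 1\<^sub>m p"
      using S T by simp
    finally show "H * ((1 / real n) \<cdot>\<^sub>m (T * T)) = 1\<^sub>m p"
      using n S(1) T(1) unfolding H
      by (simp add: mult_smult_distrib[of _ p p _ p] mult_smult_assoc_mat[of _ p p _ p]) (auto simp: mat_eq_iff)
  qed
  define m where "m = vec p (col_mean n x)"
  define z where "z = transpose_mat Xt *\<^sub>v Y - (real n * ybar Y) \<cdot>\<^sub>v m"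
  have sym: "S $$ (i, j) = S $$ (j, i)" if "i < p" "j < p" for i j
    using S that by (metis carrier_matD index_transpose_mat(1))
  have "xbar X = S *\<^sub>v m"
  proof (rule eq_vecI)
    fix j assume "j < dim_vec (S *\<^sub>v m)"
    then have j: "j < p" using S by simp
    have "(\<Sum>i<n. \<Sum>k<p. x (i, k) * S $$ (k, j)) = (\<Sum>k<p. S $$ (j, k) * (\<Sum>i<n. x (i, k)))"
      using j by (subst sum.swap) (simp add: sum_distrib_left sym mult.commute)
    then have "xbar X $ j = (\<Sum>k<p. S $$ (j, k) * (\<Sum>i<n. x (i, k))) / real n"
      using j S by (simp add: xbar_def scalar_prod_def lessThan_atLeast0)
    also have "\<dots> = (\<Sum>k<p. S $$ (j, k) * col_mean n x k)"
      by (simp only: sum_divide_distrib[of _ "{..<p}"] col_mean_def times_divide_eq_right)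
    also have "\<dots> = (S *\<^sub>v m) $ j"
      using j S by (simp add: m_def scalar_prod_def lessThan_atLeast0)
    finally show "xbar X $ j = (S *\<^sub>v m) $ j" .
  qed (use S in \<open>simp add: xbar_def\<close>)
  moreover have "transpose_mat X *\<^sub>v Y = S *\<^sub>v (transpose_mat Xt *\<^sub>v Y)"
    unfolding transpose_X by (rule assoc_mult_mat_vec) (use S carriers Y in auto)
  moreover have mc: "m \<in> carrier_vec p" "transpose_mat Xt *\<^sub>v Y \<in> carrier_vec p"
    using mult_mat_vec_carrier[OF carriers(4) Y] by (simp_all add: m_def)
  ultimately have "transpose_mat X *\<^sub>v Y - (real (dim_row X) * ybar Y) \<cdot>\<^sub>v xbar X = S *\<^sub>v z"
    using S by (simp add: z_def mult_minus_distrib_mat_vec[of _ p p] mult_mat_vec[of _ p p])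
  then have e1: "S *\<^sub>v breve H X Y = S *\<^sub>v (((1 / real n) \<cdot>\<^sub>m (T * T)) *\<^sub>v (S *\<^sub>v z))"
    by (simp add: breve_def \<open>minv H = _\<close>)
  have e2: "S *\<^sub>v (((1 / real n) \<cdot>\<^sub>m (T * T)) *\<^sub>v (S *\<^sub>v z)) = (1 / real n) \<cdot>\<^sub>v z"
  proof -
    have z: "z \<in> carrier_vec p" using mc by (auto simp: z_def)
    have "((1 / real n) \<cdot>\<^sub>m (T * T)) *\<^sub>v (S *\<^sub>v z) = (1 / real n) \<cdot>\<^sub>v ((T * T) *\<^sub>v (S *\<^sub>v z))"
      by (rule smult_mat_vec) (use S T z in auto)
    also have "(T * T) *\<^sub>v (S *\<^sub>v z) = T *\<^sub>v (T *\<^sub>v (S *\<^sub>v z))"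
      by (rule assoc_mult_mat_vec) (use S T z in auto)
    also have "T *\<^sub>v (S *\<^sub>v z) = (T * S) *\<^sub>v z"
      by (rule assoc_mult_mat_vec[symmetric]) (use S T z in auto)
    also have "\<dots> = z"
      using T z by simp
    finally have "S *\<^sub>v (((1 / real n) \<cdot>\<^sub>m (T * T)) *\<^sub>v (S *\<^sub>v z)) = S *\<^sub>v ((1 / real n) \<cdot>\<^sub>v (T *\<^sub>v z))"
      by simp
    also have "\<dots> = (1 / real n) \<cdot>\<^sub>v (S *\<^sub>v (T *\<^sub>v z))"
      by (rule mult_mat_vec) (use S T z in auto)
    also have "S *\<^sub>v (T *\<^sub>v z) = (S * T) *\<^sub>v z"
      by (rule assoc_mult_mat_vec[symmetric]) (use S T z in auto)
    finally show ?thesis using T z by simp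
  qed
  have dz: "dim_vec z = p"
    using mc by (simp add: z_def)
  have e3: "(1 / real n) \<cdot>\<^sub>v z = vec p (\<lambda>a. \<Sum>i<n. centered_rows n x a i * Y $ i)"
  proof (rule eq_vecI)
    fix a assume "a < dim_vec (vec p (\<lambda>a. \<Sum>i<n. centered_rows n x a i * Y $ i))"
    then have a: "a < p" by simp
    have "z $ a = (\<Sum>i<n. x (i, a) * Y $ i) - (\<Sum>i<n. Y $ i) * col_mean n x a"
      using a Y n carriers by (simp add: z_def m_def scalar_prod_def lessThan_atLeast0 ybar_def)
    also have "\<dots> = (\<Sum>i<n. (x (i, a) - col_mean n x a) * Y $ i)"
      by (simp add: left_diff_distrib sum_subtractf mult.commute[of "\<Sum>i<n. Y $ i"] sum_distrib_left)
    finally have "((1 / real n) \<cdot>\<^sub>v z) $ a = (\<Sum>i<n. (x (i, a) - col_mean n x a) * Y $ i) / real n"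
      using a dz by simp
    also have "\<dots> = (\<Sum>i<n. centered_rows n x a i * Y $ i)"
      unfolding sum_divide_distrib centered_rows_def by simp
    finally show "((1 / real n) \<cdot>\<^sub>v z) $ a = vec p (\<lambda>a. \<Sum>i<n. centered_rows n x a i * Y $ i) $ a"
      using a by simp
  qed (use dz in simp)
  show ?thesis
    by (rule trans[OF e1 trans[OF e2 e3]])
qed

text \<open>Move \<open>S\<close> from the test point onto the estimator and insert the model for
  \<open>Y\<close>; the identity matrix in \<open>V\<close> accounts for the target
  \<open>\<beta>\<close>. The equation holds at every \<open>x\<close>, singular Gram matrix
  included, so it can be rewritten under the integral.\<close>

lemma prediction_error:
  fixes b x0 e :: "nat \<Rightarrow> real" and \<alpha> :: real
  assumes H: "H = real n \<cdot>\<^sub>m (S * S)"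
  defines "U \<equiv> \<lambda>a i. (1 - \<alpha>) * L $$ (a, i) + \<alpha> * centered_rows n x a i"
  defines "V \<equiv> \<lambda>a l. (\<Sum>i<n. U a i * x (i, l)) - (if a = l then 1 else 0)"
  shows "(S *\<^sub>v vec p x0) \<bullet> dot_est \<alpha> H X (X *\<^sub>v vec p b + vec n e) - (S *\<^sub>v vec p x0) \<bullet> vec p b
    = (\<Sum>a<p. x0 a * ((\<Sum>k<p. (\<Sum>l<p. V a l * S $$ (l, k)) * b k) + (\<Sum>i<n. U a i * e i)))"
proof -
  define Y where "Y = X *\<^sub>v vec p b + vec n e"
  define t where "t = S *\<^sub>v vec p b"
  have Y: "Y \<in> carrier_vec n" and t: "t \<in> carrier_vec p"
    using S by (auto simp: Y_def t_def intro: carrier_vecI)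
  have Yi: "Y $ i = (\<Sum>l<p. x (i, l) * t $ l) + e i" if "i < n" for i
  proof -
    have "X *\<^sub>v vec p b = Xt *\<^sub>v t"
      using carriers S by (simp add: t_def assoc_mult_mat_vec[of _ n p _ p])
    then show ?thesis
      using that t by (simp add: Y_def scalar_prod_def lessThan_atLeast0)
  qed
  have ols_c: "ols X Y \<in> carrier_vec p"
    unfolding ols_def by (rule mult_mat_vec_carrier[OF carriers(6) mult_mat_vec_carrier[OF carriers(3) Y]])
  have breve_c: "breve H X Y \<in> carrier_vec p"
  proof -
    have "H \<in> carrier_mat p p" using S H by auto
    then have "minv H \<in> carrier_mat p p" by (rule minv_carrier)
    then show ?thesis by (auto simp: breve_def intro: carrier_vecI)
  qed
  have dot_c: "dot_est \<alpha> H X Y \<in> carrier_vec p"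
    using ols_c breve_c by (simp add: dot_est_def)
  have swap: "(S *\<^sub>v vec p x0) \<bullet> w = vec p x0 \<bullet> (S *\<^sub>v w)" if "w \<in> carrier_vec p" for w
    by (rule transpose_vec_mult_scalar[OF S(1) that vec_carrier, unfolded S(2)])
  have Sdot: "S *\<^sub>v dot_est \<alpha> H X Y = (1 - \<alpha>) \<cdot>\<^sub>v (L *\<^sub>v Y) + \<alpha> \<cdot>\<^sub>v vec p (\<lambda>a. \<Sum>i<n. centered_rows n x a i * Y $ i)"
    unfolding dot_est_def S_ols[OF Y, symmetric] S_breve[OF Y H, symmetric]
    by (subst mult_add_distrib_mat_vec[OF S(1)])
      (use ols_c breve_c in \<open>auto simp: mult_mat_vec[OF S(1)]\<close>)
  then have Sd: "(S *\<^sub>v dot_est \<alpha> H X Y) $ a = (\<Sum>i<n. U a i * Y $ i)" if "a < p" for a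
  proof -
    have "(L *\<^sub>v Y) $ a = (\<Sum>i<n. L $$ (a, i) * Y $ i)"
      using that carriers(7) Y by (simp add: scalar_prod_def lessThan_atLeast0)
    then show ?thesis
      using that carriers(7)
      by (simp add: Sdot U_def distrib_right sum.distrib sum_distrib_left mult.assoc del: index_mult_mat_vec)
  qed
  have "(S *\<^sub>v vec p x0) \<bullet> dot_est \<alpha> H X Y - (S *\<^sub>v vec p x0) \<bullet> vec p b
      = vec p x0 \<bullet> (S *\<^sub>v dot_est \<alpha> H X Y) - vec p x0 \<bullet> t"
    using dot_c by (simp add: swap t_def)
  also have "\<dots> = (\<Sum>a<p. x0 a * ((\<Sum>i<n. U a i * Y $ i) - t $ a))"
  proof -
    have sp: "vec p x0 \<bullet> w = (\<Sum>a<p. x0 a * w $ a)" if "w \<in> carrier_vec p" for w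
      using that by (simp add: scalar_prod_def lessThan_atLeast0)
    have "vec p x0 \<bullet> (S *\<^sub>v dot_est \<alpha> H X Y) = (\<Sum>a<p. x0 a * (S *\<^sub>v dot_est \<alpha> H X Y) $ a)"
      by (rule sp[OF mult_mat_vec_carrier[OF S(1) dot_c]])
    also have "\<dots> = (\<Sum>a<p. x0 a * (\<Sum>i<n. U a i * Y $ i))"
      by (intro sum.cong refl) (simp only: Sd lessThan_iff)
    finally show ?thesis
      using sp[OF t] by (simp add: right_diff_distrib sum_subtractf)
  qed
  also have "\<dots> = (\<Sum>a<p. x0 a * ((\<Sum>k<p. (\<Sum>l<p. V a l * S $$ (l, k)) * b k) + (\<Sum>i<n. U a i * e i)))"
  proof (intro sum.cong refl arg_cong2[where f = "(*)"])
    fix a assume "a \<in> {..<p}"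
    then have a: "a < p" by simp
    have "(\<Sum>i<n. U a i * Y $ i) = (\<Sum>i<n. \<Sum>l<p. U a i * x (i, l) * t $ l) + (\<Sum>i<n. U a i * e i)"
      by (simp add: Yi distrib_left sum.distrib sum_distrib_left mult.assoc)
    also have "(\<Sum>i<n. \<Sum>l<p. U a i * x (i, l) * t $ l) = (\<Sum>l<p. (\<Sum>i<n. U a i * x (i, l)) * t $ l)"
      by (subst sum.swap) (simp add: sum_distrib_right)
    also have "\<dots> = (\<Sum>l<p. V a l * t $ l + (if l = a then t $ l else 0))"
      by (intro sum.cong refl) (auto simp: V_def left_diff_distrib)
    also have "\<dots> = (\<Sum>l<p. V a l * t $ l) + t $ a"
      using a by (simp add: sum.distrib)
    also have "(\<Sum>l<p. V a l * t $ l) = (\<Sum>l<p. \<Sum>k<p. V a l * S $$ (l, k) * b k)"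
      using S by (simp add: t_def scalar_prod_def lessThan_atLeast0 sum_distrib_left mult.assoc)
    also have "\<dots> = (\<Sum>k<p. (\<Sum>l<p. V a l * S $$ (l, k)) * b k)"
      by (subst sum.swap) (simp add: sum_distrib_right)
    finally show "(\<Sum>i<n. U a i * Y $ i) - t $ a
        = (\<Sum>k<p. (\<Sum>l<p. V a l * S $$ (l, k)) * b k) + (\<Sum>i<n. U a i * e i)"
      by simp
  qed
  finally show ?thesis
    by (simp add: Y_def)
qed

context
  assumes inv: "invertible_mat A"
begin

text \<open>Inserting \<open>S T\<close> on the right rebuilds \<open>X = x S\<close>, and the Gram
  matrix cancels. This is the unbiasedness of least squares: its error has no signal part.\<close>

lemma L_Xt: "L * Xt = 1\<^sub>m p"
proof -
  note m = minv_inverse[OF carriers(5) inv]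
  have "L * Xt = L * Xt * (S * T)"
    using carriers T by simp
  also have "\<dots> = L * X * T"
    using carriers S T(1) by (simp add: assoc_mult_mat[of _ p n _ p _ p] assoc_mult_mat[of _ n p _ p _ p]
        assoc_mult_mat[of _ p p _ p _ p])
  also have "L * X = S * (minv A * A)"
    using carriers S m(1)
    by (simp add: ols_rows_def Let_def assoc_mult_mat[of _ p p _ n _ p])
  finally show ?thesis
    using m S T by simp
qed

lemma L_eq: "L = (S * minv A * S) * transpose_mat Xt"
  using carriers S
  by (simp add: ols_rows_def Let_def transpose_X assoc_mult_mat[of _ p p _ p _ n] assoc_mult_mat[of _ p p _ p _ p])

text \<open>Since \<open>L = N x^T\<close> with \<open>N = S A^-1 S\<close>, the product is
  \<open>(L x) N^T = N^T\<close>. It ties the row norms of \<open>L\<close> to entries of the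
  inverse Gram matrix, whose integrability is assumed.\<close>

lemma L_LT: "L * transpose_mat L = transpose_mat (S * minv A * S)"
proof -
  let ?N = "S * minv A * S"
  have N: "?N \<in> carrier_mat p p" using S carriers by auto
  have "transpose_mat L = Xt * transpose_mat ?N"
    using carriers N by (subst L_eq) (simp add: transpose_mult[of _ p p _ n])
  then have "L * transpose_mat L = (L * Xt) * transpose_mat ?N"
    using carriers N by (simp add: assoc_mult_mat[of _ p n _ p _ p])
  then show ?thesis
    unfolding L_Xt using N by (simp only: left_mult_one_mat[OF transpose_carrier_mat[THEN iffD2, OF N]])
qed

lemma dual_rows: "a < p \<Longrightarrow> b < p \<Longrightarrow> (\<Sum>i<n. L $$ (a, i) * x (i, b)) = (if a = b then 1 else 0)"
  using arg_cong[OF L_Xt, of "\<lambda>M. M $$ (a, b)"] carriers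
  by (simp add: scalar_prod_def lessThan_atLeast0)

lemma L_row_norm: "a < p \<Longrightarrow> (\<Sum>i<n. (L $$ (a, i))\<^sup>2) = (S * minv A * S) $$ (a, a)"
  using arg_cong[OF L_LT, of "\<lambda>M. M $$ (a, a)"] carriers S
  by (simp add: scalar_prod_def lessThan_atLeast0 power2_eq_square)

text \<open>The hat matrix is \<open>x N x^T\<close>. Symmetry of \<open>N\<close> is read off from
  \<open>L_LT\<close>, as \<open>L L^T\<close> equals its own transpose.\<close>

lemma hat_symmetric:
  assumes "i < n" "k < n"
  shows "(\<Sum>a<p. x (i, a) * L $$ (a, k)) = (\<Sum>a<p. x (k, a) * L $$ (a, i))"
proof -
  let ?N = "S * minv A * S"
  have N: "?N \<in> carrier_mat p p" using S carriers by auto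
  have "transpose_mat (L * transpose_mat L) = L * transpose_mat L"
    using carriers(7) by (simp add: transpose_mult[of _ p n])
  then have N_sym: "transpose_mat ?N = ?N"
    unfolding L_LT using N by simp
  have "transpose_mat (Xt * L) = transpose_mat L * transpose_mat Xt"
    using carriers by (simp add: transpose_mult[of _ n p])
  also have "transpose_mat L = Xt * ?N"
    using carriers N N_sym by (subst L_eq) (simp add: transpose_mult[of _ p p _ n])
  also have "Xt * ?N * transpose_mat Xt = Xt * L"
    using carriers N by (subst L_eq) (simp add: assoc_mult_mat[of _ n p _ p _ n])
  finally have "(Xt * L) $$ (i, k) = (Xt * L) $$ (k, i)"
    using assms carriers by (metis carrier_matD index_mult_mat(2,3) index_transpose_mat(1))
  then show ?thesis
    using assms carriers by (simp add: scalar_prod_def lessThan_atLeast0)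
qed

text \<open>The sum is the trace of \<open>L K^T\<close>, that is \<open>(p - q / n) / n\<close>,
  where \<open>q\<close> is the sum of all entries of the hat matrix. Because
  \<open>0 \<le> q \<le> n\<close>, centering costs at most one degree of freedom.\<close>

lemma L_centered_bounds:
  shows "(real p - 1) / real n \<le> (\<Sum>a<p. \<Sum>i<n. L $$ (a, i) * centered_rows n x a i)"
    and "(\<Sum>a<p. \<Sum>i<n. L $$ (a, i) * centered_rows n x a i) \<le> real p / real n"
proof -
  let ?P = "\<Sum>i<n. \<Sum>k<n. \<Sum>a<p. x (i, a) * L $$ (a, k)"
  have "(\<Sum>a<p. \<Sum>i<n. L $$ (a, i) * centered_rows n x a i)
      = (\<Sum>a<p. (\<Sum>i<n. L $$ (a, i) * x (i, a)) / real n - (\<Sum>k<n. \<Sum>i<n. x (k, a) * L $$ (a, i)) / (real n)\<^sup>2)"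
  proof (intro sum.cong refl)
    fix a
    have "L $$ (a, i) * centered_rows n x a i
        = L $$ (a, i) * x (i, a) / real n - (\<Sum>k<n. x (k, a)) * L $$ (a, i) / (real n)\<^sup>2" for i
      using n by (simp add: centered_rows_def col_mean_def field_simps power2_eq_square)
    then have "(\<Sum>i<n. L $$ (a, i) * centered_rows n x a i)
        = (\<Sum>i<n. L $$ (a, i) * x (i, a)) / real n - (\<Sum>k<n. x (k, a)) * (\<Sum>i<n. L $$ (a, i)) / (real n)\<^sup>2"
      by (simp only: sum_subtractf sum_divide_distrib sum_distrib_left)
    then show "(\<Sum>i<n. L $$ (a, i) * centered_rows n x a i)
        = (\<Sum>i<n. L $$ (a, i) * x (i, a)) / real n - (\<Sum>k<n. \<Sum>i<n. x (k, a) * L $$ (a, i)) / (real n)\<^sup>2"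
      by (simp only: sum_product)
  qed
  also have "\<dots> = (real p - ?P / real n) / real n"
  proof -
    have "(\<Sum>a<p. \<Sum>k<n. \<Sum>i<n. x (k, a) * L $$ (a, i)) = ?P"
      by (rule sum_rotate3)
    then show ?thesis
      by (simp add: dual_rows sum_subtractf flip: sum_divide_distrib)
        (simp add: power2_eq_square diff_divide_distrib)
  qed
  finally have eq: "(\<Sum>a<p. \<Sum>i<n. L $$ (a, i) * centered_rows n x a i) = (real p - ?P / real n) / real n" .
  have "0 \<le> ?P" "?P \<le> real n"
    by (rule projection_sum_bounds[where L = "\<lambda>a i. L $$ (a, i)" and x = x];
        simp add: dual_rows hat_symmetric)+
  then show "(real p - 1) / real n \<le> (\<Sum>a<p. \<Sum>i<n. L $$ (a, i) * centered_rows n x a i)"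
    "(\<Sum>a<p. \<Sum>i<n. L $$ (a, i) * centered_rows n x a i) \<le> real p / real n"
    unfolding eq using n by (auto intro!: divide_right_mono simp: divide_le_eq)
qed

end

end

section \<open>Product measures and the error model\<close>

lemma pair_product_integral:
  fixes f :: "'a \<Rightarrow> real" and g :: "'b \<Rightarrow> real"
  assumes MN: "prob_space M" "prob_space N" and f: "integrable M f" and g: "integrable N g"
  shows "integrable (M \<Otimes>\<^sub>M N) (\<lambda>\<omega>. f (fst \<omega>) * g (snd \<omega>))"
    and "(\<integral>\<omega>. f (fst \<omega>) * g (snd \<omega>) \<partial>(M \<Otimes>\<^sub>M N)) = (\<integral>x. f x \<partial>M) * (\<integral>y. g y \<partial>N)"
proof -
  interpret M: prob_space M by fact
  interpret N: prob_space N by fact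
  interpret pair_prob_space M N ..
  have [measurable]: "f \<in> borel_measurable M" "g \<in> borel_measurable N"
    using f g by auto
  show int: "integrable (M \<Otimes>\<^sub>M N) (\<lambda>\<omega>. f (fst \<omega>) * g (snd \<omega>))"
  proof (rule Fubini_integrable)
    show "integrable M (\<lambda>x. \<integral>y. norm (f (fst (x, y)) * g (snd (x, y))) \<partial>N)"
      using f by (simp add: abs_mult integrable_abs)
    show "AE x in M. integrable N (\<lambda>y. f (fst (x, y)) * g (snd (x, y)))"
      using g by simp
  qed measurable
  have "(\<integral>\<omega>. f (fst \<omega>) * g (snd \<omega>) \<partial>(M \<Otimes>\<^sub>M N)) = (\<integral>x. \<integral>y. f x * g y \<partial>N \<partial>M)"
    using integral_fst'[OF int] by simp
  then show "(\<integral>\<omega>. f (fst \<omega>) * g (snd \<omega>) \<partial>(M \<Otimes>\<^sub>M N)) = (\<integral>x. f x \<partial>M) * (\<integral>y. g y \<partial>N)"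
    by simp
qed

text \<open>This and the next lemmas pull integrability and almost sure statements, which are
  assumed on the full sample space, back to the law of the design.\<close>

lemma integrable_pair_fstD:
  fixes f :: "'a \<Rightarrow> real"
  assumes MN: "prob_space M" "prob_space N" and f: "integrable (M \<Otimes>\<^sub>M N) (\<lambda>\<omega>. f (fst \<omega>))"
  shows "integrable M f"
proof -
  interpret M: prob_space M by fact
  interpret N: prob_space N by fact
  interpret pair_prob_space M N ..
  show ?thesis
    using integrable_fst'[OF f] by (simp add: N.prob_space)
qed

lemma integrable_pair_sndD:
  fixes f :: "'b \<Rightarrow> real"
  assumes MN: "prob_space M" "prob_space N" and f: "integrable (M \<Otimes>\<^sub>M N) (\<lambda>\<omega>. f (snd \<omega>))"
  shows "integrable N f"
proof -
  interpret M: prob_space M by fact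
  interpret N: prob_space N by fact
  interpret pair_prob_space M N ..
  have "AE x in M. integrable N f"
    using AE_integrable_fst'[OF f] by simp
  then show ?thesis by simp
qed

lemma AE_pair_fstD:
  assumes MN: "prob_space M" "prob_space N" and P: "AE \<omega> in M \<Otimes>\<^sub>M N. P (fst \<omega>)"
  shows "AE x in M. P x"
proof -
  interpret M: prob_space M by fact
  interpret N: prob_space N by fact
  interpret pair_prob_space M N ..
  show ?thesis
    using AE_pair[OF P] by simp
qed

lemma AE_pair_sndD:
  assumes MN: "prob_space M" "prob_space N" and P: "AE \<omega> in M \<Otimes>\<^sub>M N. P (snd \<omega>)"
  shows "AE x in N. P x"
proof -
  interpret M: prob_space M by fact
  interpret N: prob_space N by fact
  interpret pair_prob_space M N ..
  have "AE x in M. AE y in N. P y"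
    using AE_pair[OF P] by simp
  then show ?thesis by simp
qed

text \<open>Integrability of the square does not make \<open>f\<close> measurable, hence the
  separate conjunct.\<close>

definition square_integrable :: "'a measure \<Rightarrow> ('a \<Rightarrow> real) \<Rightarrow> bool" where
  "square_integrable M f \<longleftrightarrow> f \<in> borel_measurable M \<and> integrable M (\<lambda>x. (f x)\<^sup>2)"

lemma square_integrable_mult:
  assumes "square_integrable M f" "square_integrable M g"
  shows "integrable M (\<lambda>x. f x * g x)"
proof (rule Bochner_Integration.integrable_bound)
  show "integrable M (\<lambda>x. (f x)\<^sup>2 + (g x)\<^sup>2)" "(\<lambda>x. f x * g x) \<in> borel_measurable M"
    using assms by (auto simp: square_integrable_def)
  have "\<bar>u * v\<bar> \<le> u\<^sup>2 + v\<^sup>2" for u v :: real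
  proof -
    have "2 * \<bar>u\<bar> * \<bar>v\<bar> \<le> u\<^sup>2 + v\<^sup>2" "0 \<le> \<bar>u\<bar> * \<bar>v\<bar>"
      using sum_squares_bound[of "\<bar>u\<bar>" "\<bar>v\<bar>"] by simp_all
    then show ?thesis
      unfolding abs_mult by linarith
  qed
  then show "AE x in M. norm (f x * g x) \<le> norm ((f x)\<^sup>2 + (g x)\<^sup>2)"
    by auto
qed

lemma square_integrable_add:
  assumes "square_integrable M f" "square_integrable M g"
  shows "square_integrable M (\<lambda>x. f x + g x)"
proof -
  have "integrable M (\<lambda>x. (f x)\<^sup>2 + 2 * (f x * g x) + (g x)\<^sup>2)"
    using assms square_integrable_mult[OF assms] by (auto simp: square_integrable_def)
  then show ?thesis
    using assms by (auto simp: square_integrable_def power2_sum algebra_simps)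
qed

lemma square_integrable_cmult:
  "square_integrable M f \<Longrightarrow> square_integrable M (\<lambda>x. c * f x)"
  by (auto simp: square_integrable_def power_mult_distrib)

lemma square_integrable_const:
  "prob_space M \<Longrightarrow> square_integrable M (\<lambda>x. c)"
  using finite_measure.integrable_const[OF prob_space.finite_measure] by (auto simp: square_integrable_def)

lemma square_integrable_sum:
  assumes "prob_space M" "\<And>i. i \<in> I \<Longrightarrow> square_integrable M (f i)"
  shows "square_integrable M (\<lambda>x. \<Sum>i\<in>I. f i x)"
  using assms(2)
  by (induction I rule: infinite_finite_induct)
    (auto intro!: square_integrable_add square_integrable_const[OF assms(1)])

lemma square_integrable_AE_cong:
  assumes "square_integrable M f" "g \<in> borel_measurable M" "AE x in M. f x = g x"
  shows "square_integrable M g"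
proof -
  have "integrable M (\<lambda>x. (f x)\<^sup>2) = integrable M (\<lambda>x. (g x)\<^sup>2)"
    by (rule integrable_cong_AE) (use assms in \<open>auto simp: square_integrable_def\<close>)
  then show ?thesis
    using assms by (simp add: square_integrable_def)
qed

text \<open>Fubini after splitting off coordinate \<open>e\<close>. Independence is phrased as
  invariance under updates at \<open>e\<close>, a condition that simplification can check for
  explicit functions of the entries.\<close>

lemma PiM_coordinate_independent:
  fixes F :: "('i \<Rightarrow> 'a) \<Rightarrow> real" and u :: "'a \<Rightarrow> real"
  assumes D: "prob_space D" and e: "e \<in> I"
    and F: "integrable (PiM I (\<lambda>_. D)) F" and indep: "\<And>x y. F (x(e := y)) = F x"
    and u: "integrable D u"
  shows "integrable (PiM I (\<lambda>_. D)) (\<lambda>x. F x * u (x e))"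
    and "(\<integral>x. F x * u (x e) \<partial>PiM I (\<lambda>_. D)) = (\<integral>x. F x \<partial>PiM I (\<lambda>_. D)) * (\<integral>y. u y \<partial>D)"
proof -
  let ?J = "I - {e}" and ?P = "PiM I (\<lambda>_. D)" and ?Q = "PiM (I - {e}) (\<lambda>_. D)"
  let ?\<phi> = "\<lambda>(y, X). X(e := y)"
  interpret D: prob_space D by fact
  have Q: "prob_space ?Q"
    by (rule prob_space_PiM) (rule D)
  have I: "insert e ?J = I"
    using e by auto
  \<comment> \<open>Drawing coordinate \<open>e\<close> separately and inserting it into a draw of
    the others reproduces the product law.\<close>
  have distr: "distr (D \<Otimes>\<^sub>M ?Q) ?P ?\<phi> = ?P"
    using distr_pair_PiM_eq_PiM[of ?J "\<lambda>_. D" e] D I by simp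
  have \<phi>: "?\<phi> \<in> measurable (D \<Otimes>\<^sub>M ?Q) ?P"
  proof -
    have "?\<phi> \<in> measurable (D \<Otimes>\<^sub>M ?Q) (PiM (insert e ?J) (\<lambda>_. D))"
      by measurable
    then show ?thesis by (simp only: I)
  qed
  have [measurable]: "F \<in> borel_measurable ?P" "u \<in> borel_measurable D" "(\<lambda>x. x e) \<in> measurable ?P D"
    using F u e by auto
  have int_iff: "integrable ?P h \<longleftrightarrow> integrable (D \<Otimes>\<^sub>M ?Q) (\<lambda>z. h (?\<phi> z))"
    and int_eq: "(\<integral>x. h x \<partial>?P) = (\<integral>z. h (?\<phi> z) \<partial>(D \<Otimes>\<^sub>M ?Q))"
    if "h \<in> borel_measurable ?P" for h :: "('i \<Rightarrow> 'a) \<Rightarrow> real"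
    using integrable_distr_eq[OF \<phi> that] integral_distr[OF \<phi> that] distr by simp_all
  have F_eq: "F (?\<phi> z) = F (snd z)" for z
    using indep by (cases z) simp
  have "integrable (D \<Otimes>\<^sub>M ?Q) (\<lambda>z. F (snd z))"
    using F int_iff[of F] by (simp add: F_eq)
  then have FQ: "integrable ?Q F"
    by (rule integrable_pair_sndD[OF D Q])
  have h_eq: "F (?\<phi> z) * u (?\<phi> z e) = u (fst z) * F (snd z)" for z
    unfolding F_eq by (cases z) simp
  show "integrable ?P (\<lambda>x. F x * u (x e))"
    using pair_product_integral(1)[OF D Q u FQ] by (subst int_iff) (simp_all only: h_eq, measurable)
  have "(\<integral>x. F x * u (x e) \<partial>?P) = (\<integral>z. u (fst z) * F (snd z) \<partial>(D \<Otimes>\<^sub>M ?Q))"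
    by (subst int_eq) (simp_all only: h_eq, measurable)
  also have "\<dots> = (\<integral>y. u y \<partial>D) * (\<integral>X. F X \<partial>?Q)"
    by (rule pair_product_integral(2)[OF D Q u FQ])
  also have "(\<integral>X. F X \<partial>?Q) = (\<integral>x. F x \<partial>?P)"
  proof -
    have "(\<integral>x. F x \<partial>?P) = (\<integral>z. 1 * F (snd z) \<partial>(D \<Otimes>\<^sub>M ?Q))"
      by (subst int_eq) (simp_all only: F_eq mult_1_left, measurable)
    also have "\<dots> = (\<integral>y. 1 \<partial>D) * (\<integral>X. F X \<partial>?Q)"
      by (rule pair_product_integral(2)[OF D Q _ FQ]) simp
    finally show ?thesis
      by (simp add: D.prob_space)
  qed
  finally show "(\<integral>x. F x * u (x e) \<partial>?P) = (\<integral>x. F x \<partial>?P) * (\<integral>y. u y \<partial>D)"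
    by simp
qed

lemma iid_second_moments:
  assumes D: "prob_space D"
    and int: "integrable D (\<lambda>x. x)" "integrable D (\<lambda>x. x ^ 2)"
    and mean: "(\<integral>x. x \<partial>D) = 0" and var: "(\<integral>x. x ^ 2 \<partial>D) = (v :: real)"
    and ef: "e \<in> I" "f \<in> I"
  shows "integrable (PiM I (\<lambda>_. D)) (\<lambda>x. x e * x f)"
    and "(\<integral>x. x e * x f \<partial>PiM I (\<lambda>_. D)) = (if e = f then v else 0)"
    and "integrable (PiM I (\<lambda>_. D)) (\<lambda>x. x e)"
    and "(\<integral>x. x e \<partial>PiM I (\<lambda>_. D)) = 0"
proof -
  interpret P: prob_space "PiM I (\<lambda>_. D)"
    by (rule prob_space_PiM) (rule D)
  have x: "integrable (PiM I (\<lambda>_. D)) (\<lambda>x. x e)" "(\<integral>x. x e \<partial>PiM I (\<lambda>_. D)) = 0" if "e \<in> I" for e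
    using PiM_coordinate_independent[OF D that _ _ int(1), of "\<lambda>_. 1"] mean
    by (simp_all add: P.prob_space)
  then show "integrable (PiM I (\<lambda>_. D)) (\<lambda>x. x e)" "(\<integral>x. x e \<partial>PiM I (\<lambda>_. D)) = 0"
    using ef by auto
  have "integrable (PiM I (\<lambda>_. D)) (\<lambda>x. x e * x f)
    \<and> (\<integral>x. x e * x f \<partial>PiM I (\<lambda>_. D)) = (if e = f then v else 0)"
  proof (cases "e = f")
    case True
    then show ?thesis
      using PiM_coordinate_independent[OF D ef(1) _ _ int(2), of "\<lambda>_. 1"] var
      by (simp add: P.prob_space power2_eq_square)
  next
    case False
    then show ?thesis
      using PiM_coordinate_independent[OF D ef(2) x(1)[OF ef(1)] _ int(1)] mean
      by (simp add: x ef)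
  qed
  then show "integrable (PiM I (\<lambda>_. D)) (\<lambda>x. x e * x f)"
    "(\<integral>x. x e * x f \<partial>PiM I (\<lambda>_. D)) = (if e = f then v else 0)"
    by auto
qed

section \<open>The model at one sample size and errors linear in signal and noise\<close>

locale regression_model =
  fixes n p :: nat and D N :: "real measure" and B :: "(nat \<Rightarrow> real) measure" and \<sigma> \<tau> :: real
  assumes D: "prob_space D" "integrable D (\<lambda>x. x)" "(\<integral>x. x \<partial>D) = 0"
      "integrable D (\<lambda>x. x ^ 2)" "(\<integral>x. x ^ 2 \<partial>D) = 1"
    and N: "prob_space N" "integrable N (\<lambda>x. x)" "(\<integral>x. x \<partial>N) = 0"
      "integrable N (\<lambda>x. x ^ 2)" "(\<integral>x. x ^ 2 \<partial>N) = \<sigma>\<^sup>2"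
    and B: "prob_space B" "\<And>j. j < p \<Longrightarrow> integrable B (\<lambda>b. b j)" "\<And>j. j < p \<Longrightarrow> (\<integral>b. b j \<partial>B) = 0"
      "\<And>j k. j < p \<Longrightarrow> k < p \<Longrightarrow> integrable B (\<lambda>b. b j * b k)"
      "\<And>j k. j < p \<Longrightarrow> k < p \<Longrightarrow> (\<integral>b. b j * b k \<partial>B) = (if j = k then \<tau>\<^sup>2 else 0)"
begin

abbreviation "PX \<equiv> PiM ({..<n} \<times> {..<p}) (\<lambda>_. D)"
abbreviation "P0 \<equiv> PiM {..<p} (\<lambda>_. D)"
abbreviation "PN \<equiv> PiM {..<n} (\<lambda>_. N)"
abbreviation "\<Omega> \<equiv> sample_space n p D N B"

lemma prob_spaces:
  "prob_space PX" "prob_space P0" "prob_space PN" "prob_space (P0 \<Otimes>\<^sub>M PN)"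
  "prob_space (PX \<Otimes>\<^sub>M (P0 \<Otimes>\<^sub>M PN))" "prob_space \<Omega>"
proof -
  show 1: "prob_space PX" "prob_space P0" "prob_space PN"
    by (intro prob_space_PiM D N)+
  then show 2: "prob_space (P0 \<Otimes>\<^sub>M PN)"
    by (intro prob_space_pair)
  with 1 show 3: "prob_space (PX \<Otimes>\<^sub>M (P0 \<Otimes>\<^sub>M PN))"
    by (intro prob_space_pair)
  show "prob_space \<Omega>"
    unfolding sample_space_def by (rule prob_space_pair[OF B(1) 3])
qed

lemma sample_product_integral:
  fixes f h k :: "(nat \<Rightarrow> real) \<Rightarrow> real" and g :: "(nat \<times> nat \<Rightarrow> real) \<Rightarrow> real"
  assumes "integrable B f" "integrable PX g" "integrable P0 h" "integrable PN k"
  shows "integrable \<Omega> (\<lambda>\<omega>. f (fst \<omega>) * (g (fst (snd \<omega>)) * (h (fst (snd (snd \<omega>))) * k (snd (snd (snd \<omega>))))))"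
    and "(\<integral>\<omega>. f (fst \<omega>) * (g (fst (snd \<omega>)) * (h (fst (snd (snd \<omega>))) * k (snd (snd (snd \<omega>))))) \<partial>\<Omega>)
      = (\<integral>x. f x \<partial>B) * ((\<integral>x. g x \<partial>PX) * ((\<integral>x. h x \<partial>P0) * (\<integral>x. k x \<partial>PN)))"
proof -
  note 1 = pair_product_integral[OF prob_spaces(2,3) assms(3,4)]
  note 2 = pair_product_integral[OF prob_spaces(1,4) assms(2) 1(1)]
  note 3 = pair_product_integral[OF B(1) prob_spaces(5) assms(1) 2(1)]
  show "integrable \<Omega> (\<lambda>\<omega>. f (fst \<omega>) * (g (fst (snd \<omega>)) * (h (fst (snd (snd \<omega>))) * k (snd (snd (snd \<omega>))))))"
    using 3(1) by (simp add: sample_space_def)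
  show "(\<integral>\<omega>. f (fst \<omega>) * (g (fst (snd \<omega>)) * (h (fst (snd (snd \<omega>))) * k (snd (snd (snd \<omega>))))) \<partial>\<Omega>)
      = (\<integral>x. f x \<partial>B) * ((\<integral>x. g x \<partial>PX) * ((\<integral>x. h x \<partial>P0) * (\<integral>x. k x \<partial>PN)))"
    using 3(2) 2(2) 1(2) by (simp add: sample_space_def)
qed

lemma design_integral:
  fixes g :: "(nat \<times> nat \<Rightarrow> real) \<Rightarrow> real"
  assumes "integrable PX g"
  shows "(\<integral>\<omega>. g (fst (snd \<omega>)) \<partial>\<Omega>) = (\<integral>x. g x \<partial>PX)"
proof -
  interpret B: prob_space B by (rule B)
  interpret P0: prob_space P0 by (rule prob_spaces)
  interpret PN: prob_space PN by (rule prob_spaces)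
  show ?thesis
    using sample_product_integral(2)[OF _ assms, of "\<lambda>_. 1" "\<lambda>_. 1" "\<lambda>_. 1"]
    by (simp add: B.prob_space P0.prob_space PN.prob_space)
qed

lemma design_integrableD:
  "integrable \<Omega> (\<lambda>\<omega>. g (fst (snd \<omega>))) \<Longrightarrow> integrable PX (g :: _ \<Rightarrow> real)"
  unfolding sample_space_def
  by (rule integrable_pair_fstD[OF prob_spaces(1,4)],
      rule integrable_pair_sndD[OF B(1) prob_spaces(5), of "\<lambda>\<omega>. g (fst \<omega>)"])

lemma design_AE_D:
  "(AE \<omega> in \<Omega>. Q (fst (snd \<omega>))) \<Longrightarrow> AE x in PX. Q x"
  unfolding sample_space_def
  by (rule AE_pair_fstD[OF prob_spaces(1,4)],
      rule AE_pair_sndD[OF B(1) prob_spaces(5), of "\<lambda>\<omega>. Q (fst \<omega>)"])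

text \<open>Signal coefficients and noise terms form one family over a sum type, so a single
  orthogonality computation covers all mixed products.\<close>

definition effect :: "sample \<Rightarrow> nat + nat \<Rightarrow> real" where
  "effect \<omega> s = (case s of Inl k \<Rightarrow> fst \<omega> k | Inr i \<Rightarrow> snd (snd (snd \<omega>)) i)"

lemma effect_moments:
  assumes F: "integrable PX F" and ab: "a < p" "b < p"
    and st: "s \<in> {..<p} <+> {..<n}" "t \<in> {..<p} <+> {..<n}"
  defines "Z \<equiv> \<lambda>\<omega>. F (fst (snd \<omega>)) * (fst (snd (snd \<omega>)) a * fst (snd (snd \<omega>)) b) * (effect \<omega> s * effect \<omega> t)"
  shows "integrable \<Omega> Z"
    and "(\<integral>\<omega>. Z \<omega> \<partial>\<Omega>) = (if a = b \<and> s = t then (case s of Inl _ \<Rightarrow> \<tau>\<^sup>2 | Inr _ \<Rightarrow> \<sigma>\<^sup>2) * (\<integral>x. F x \<partial>PX) else 0)"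
proof -
  interpret B: prob_space B by (rule B)
  interpret PN: prob_space PN by (rule prob_spaces)
  note D0 = iid_second_moments[OF D(1,2,4,3,5), of a "{..<p}" b]
  note N0 = iid_second_moments[OF N(1,2,4,3,5), of _ "{..<n}"]
  have h: "integrable P0 (\<lambda>x. x a * x b)" "(\<integral>x. x a * x b \<partial>P0) = (if a = b then 1 else 0)"
    using D0 ab by auto
  \<comment> \<open>Each product of two effects factors into a function of \<open>\<beta>\<close>
    and a function of the noise; the mixed cases have mean zero because both factors do.\<close>
  have "\<exists>f k. integrable B f \<and> integrable PN k \<and> (\<forall>\<omega>. effect \<omega> s * effect \<omega> t = f (fst \<omega>) * k (snd (snd (snd \<omega>))))
      \<and> (\<integral>b. f b \<partial>B) * (\<integral>e. k e \<partial>PN) = (if s = t then (case s of Inl _ \<Rightarrow> \<tau>\<^sup>2 | Inr _ \<Rightarrow> \<sigma>\<^sup>2) else 0)"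
  proof (cases s; cases t)
    fix j k assume [simp]: "s = Inl j" "t = Inl k"
    show ?thesis
      using st by (intro exI[of _ "\<lambda>b. b j * b k"] exI[of _ "\<lambda>_. 1"]) (auto simp: effect_def B PN.prob_space)
  next
    fix j i assume [simp]: "s = Inl j" "t = Inr i"
    show ?thesis
      using st N0(3,4)[of i i] by (intro exI[of _ "\<lambda>b. b j"] exI[of _ "\<lambda>e. e i"]) (auto simp: effect_def B)
  next
    fix i k assume [simp]: "s = Inr i" "t = Inl k"
    show ?thesis
      using st N0(3,4)[of i i] by (intro exI[of _ "\<lambda>b. b k"] exI[of _ "\<lambda>e. e i"]) (auto simp: effect_def B)
  next
    fix i k assume [simp]: "s = Inr i" "t = Inr k"
    show ?thesis
      using st N0(1,2)[of i k] by (intro exI[of _ "\<lambda>_. 1"] exI[of _ "\<lambda>e. e i * e k"]) (auto simp: effect_def B.prob_space)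
  qed
  then obtain f k where *: "integrable B f \<and> integrable PN k
      \<and> (\<forall>\<omega>. effect \<omega> s * effect \<omega> t = f (fst \<omega>) * k (snd (snd (snd \<omega>))))
      \<and> (\<integral>b. f b \<partial>B) * (\<integral>e. k e \<partial>PN) = (if s = t then (case s of Inl _ \<Rightarrow> \<tau>\<^sup>2 | Inr _ \<Rightarrow> \<sigma>\<^sup>2) else 0)"
    by (elim exE) (rule that)
  note fk = *[THEN conjunct1] *[THEN conjunct2, THEN conjunct1]
    *[THEN conjunct2, THEN conjunct2, THEN conjunct1, rule_format]
    *[THEN conjunct2, THEN conjunct2, THEN conjunct2]
  have Z: "Z = (\<lambda>\<omega>. f (fst \<omega>) * (F (fst (snd \<omega>)) * ((\<lambda>x. x a * x b) (fst (snd (snd \<omega>))) * k (snd (snd (snd \<omega>))))))"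
    unfolding Z_def fk(3) by (simp add: mult_ac)
  note P = sample_product_integral[OF fk(1) F h(1) fk(2)]
  show "integrable \<Omega> Z"
    unfolding Z by (rule P(1))
  have "(\<integral>\<omega>. Z \<omega> \<partial>\<Omega>) = (\<integral>x. f x \<partial>B) * ((\<integral>x. F x \<partial>PX) * ((if a = b then 1 else 0) * (\<integral>x. k x \<partial>PN)))"
    unfolding Z h(2)[symmetric] by (rule P(2))
  also have "\<dots> = ((\<integral>b. f b \<partial>B) * (\<integral>e. k e \<partial>PN)) * (if a = b then 1 else 0) * (\<integral>x. F x \<partial>PX)"
    by (simp only: mult_ac)
  finally show "(\<integral>\<omega>. Z \<omega> \<partial>\<Omega>) = (if a = b \<and> s = t then (case s of Inl _ \<Rightarrow> \<tau>\<^sup>2 | Inr _ \<Rightarrow> \<sigma>\<^sup>2) * (\<integral>x. F x \<partial>PX) else 0)"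
    unfolding fk(4) by simp
qed

text \<open>Index the summands by pairs of a test coordinate and an effect. Test coordinates are
  orthonormal, effects are uncorrelated, and both are independent of the design, so only the
  diagonal of the expanded square survives.\<close>

lemma linear_error_second_moment:
  assumes W: "\<And>a k. a < p \<Longrightarrow> k < p \<Longrightarrow> square_integrable PX (W a k)"
    and U: "\<And>a i. a < p \<Longrightarrow> i < n \<Longrightarrow> square_integrable PX (U a i)"
  shows "(\<integral>\<omega>. (\<Sum>a<p. fst (snd (snd \<omega>)) a * ((\<Sum>k<p. W a k (fst (snd \<omega>)) * fst \<omega> k)
      + (\<Sum>i<n. U a i (fst (snd \<omega>)) * snd (snd (snd \<omega>)) i)))\<^sup>2 \<partial>\<Omega>)
    = \<tau>\<^sup>2 * (\<Sum>a<p. \<Sum>k<p. \<integral>x. (W a k x)\<^sup>2 \<partial>PX) + \<sigma>\<^sup>2 * (\<Sum>a<p. \<Sum>i<n. \<integral>x. (U a i x)\<^sup>2 \<partial>PX)"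
proof -
  define C where "C a s = (case s of Inl k \<Rightarrow> W a k | Inr i \<Rightarrow> U a i)" for a s
  define v where "v s = (case s of Inl (_::nat) \<Rightarrow> \<tau>\<^sup>2 | Inr (_::nat) \<Rightarrow> \<sigma>\<^sup>2)" for s
  define S where "S = {..<p} <+> {..<n}"
  have sumS: "(\<Sum>s\<in>S. g s) = (\<Sum>k<p. g (Inl k)) + (\<Sum>i<n. g (Inr i))" for g :: "nat + nat \<Rightarrow> real"
    unfolding S_def by (simp add: sum.Plus)
  have C: "square_integrable PX (C a s)" if "a < p" "s \<in> S" for a s
    using W U that by (auto simp: C_def S_def)
  define y where "y \<omega> t = C (fst t) (snd t) (fst (snd \<omega>)) * fst (snd (snd \<omega>)) (fst t) * effect \<omega> (snd t)"
    for \<omega> :: sample and t :: "nat \<times> (nat + nat)"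
  let ?T = "{..<p} \<times> S"
  have expand: "(\<Sum>a<p. fst (snd (snd \<omega>)) a * ((\<Sum>k<p. W a k (fst (snd \<omega>)) * fst \<omega> k)
      + (\<Sum>i<n. U a i (fst (snd \<omega>)) * snd (snd (snd \<omega>)) i))) = (\<Sum>t\<in>?T. y \<omega> t)" for \<omega>
    unfolding sum.cartesian_product' sumS
    by (simp add: y_def C_def effect_def distrib_left sum_distrib_left mult_ac)
  have yy: "integrable \<Omega> (\<lambda>\<omega>. y \<omega> t * y \<omega> t')"
    "(\<integral>\<omega>. y \<omega> t * y \<omega> t' \<partial>\<Omega>) = (if t = t' then v (snd t) * (\<integral>x. (C (fst t) (snd t) x)\<^sup>2 \<partial>PX) else 0)"
    if t: "t \<in> ?T" "t' \<in> ?T" for t t'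
  proof -
    have *: "y \<omega> t * y \<omega> t' = (\<lambda>x. C (fst t) (snd t) x * C (fst t') (snd t') x) (fst (snd \<omega>))
        * (fst (snd (snd \<omega>)) (fst t) * fst (snd (snd \<omega>)) (fst t')) * (effect \<omega> (snd t) * effect \<omega> (snd t'))" for \<omega>
      by (simp add: y_def mult_ac)
    have F: "integrable PX (\<lambda>x. C (fst t) (snd t) x * C (fst t') (snd t') x)"
      using t by (intro square_integrable_mult C) auto
    note m = effect_moments[OF F, of "fst t" "fst t'" "snd t" "snd t'"]
    show "integrable \<Omega> (\<lambda>\<omega>. y \<omega> t * y \<omega> t')"
      unfolding * by (rule m(1)) (use t in \<open>auto simp: S_def\<close>)
    have "(\<integral>\<omega>. y \<omega> t * y \<omega> t' \<partial>\<Omega>) = (if fst t = fst t' \<and> snd t = snd t' then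
        (case snd t of Inl _ \<Rightarrow> \<tau>\<^sup>2 | Inr _ \<Rightarrow> \<sigma>\<^sup>2) * (\<integral>x. C (fst t) (snd t) x * C (fst t') (snd t') x \<partial>PX) else 0)"
      unfolding * by (rule m(2)) (use t in \<open>auto simp: S_def\<close>)
    then show "(\<integral>\<omega>. y \<omega> t * y \<omega> t' \<partial>\<Omega>)
        = (if t = t' then v (snd t) * (\<integral>x. (C (fst t) (snd t) x)\<^sup>2 \<partial>PX) else 0)"
      by (auto simp: v_def power2_eq_square prod_eq_iff)
  qed
  have "(\<integral>\<omega>. (\<Sum>t\<in>?T. y \<omega> t)\<^sup>2 \<partial>\<Omega>) = (\<integral>\<omega>. (\<Sum>t\<in>?T. \<Sum>t'\<in>?T. y \<omega> t * y \<omega> t') \<partial>\<Omega>)"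
    by (simp add: power2_eq_square sum_product)
  also have "\<dots> = (\<Sum>t\<in>?T. \<Sum>t'\<in>?T. \<integral>\<omega>. y \<omega> t * y \<omega> t' \<partial>\<Omega>)"
    by (subst Bochner_Integration.integral_sum; (intro sum.cong refl Bochner_Integration.integral_sum
        Bochner_Integration.integrable_sum)?) (simp_all only: yy(1))
  also have "\<dots> = (\<Sum>t\<in>?T. \<Sum>t'\<in>?T. if t = t' then v (snd t) * (\<integral>x. (C (fst t) (snd t) x)\<^sup>2 \<partial>PX) else 0)"
    by (intro sum.cong refl) (rule yy(2))
  also have "\<dots> = (\<Sum>t\<in>?T. v (snd t) * (\<integral>x. (C (fst t) (snd t) x)\<^sup>2 \<partial>PX))"
  proof (rule sum.cong)
    have "finite ?T" by (simp add: S_def)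
    then show "(\<Sum>t'\<in>?T. if t = t' then v (snd t) * (\<integral>x. (C (fst t) (snd t) x)\<^sup>2 \<partial>PX) else 0)
        = v (snd t) * (\<integral>x. (C (fst t) (snd t) x)\<^sup>2 \<partial>PX)" if "t \<in> ?T" for t
      using that by (subst sum.delta') simp_all
  qed simp
  also have "\<dots> = \<tau>\<^sup>2 * (\<Sum>a<p. \<Sum>k<p. \<integral>x. (W a k x)\<^sup>2 \<partial>PX) + \<sigma>\<^sup>2 * (\<Sum>a<p. \<Sum>i<n. \<integral>x. (U a i x)\<^sup>2 \<partial>PX)"
    unfolding sum.cartesian_product' sumS
    by (simp add: v_def C_def sum.distrib sum_distrib_left)
  finally show ?thesis
    unfolding expand .
qed

end

section \<open>Moments of the design\<close>

lemma sum_centered_squares_le: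
  fixes y :: "'a \<Rightarrow> real"
  assumes "finite A" "A \<noteq> {}"
  defines "m \<equiv> (\<Sum>i\<in>A. y i) / real (card A)"
  shows "(\<Sum>i\<in>A. (y i - m)\<^sup>2) \<le> (\<Sum>i\<in>A. (y i)\<^sup>2)"
proof -
  have c: "real (card A) > 0"
    using assms by (simp add: card_gt_0_iff)
  have "(\<Sum>i\<in>A. (y i - m)\<^sup>2) = (\<Sum>i\<in>A. (y i)\<^sup>2 - 2 * m * y i + m\<^sup>2)"
    by (intro sum.cong refl) (simp add: power2_diff mult_ac)
  also have "\<dots> = (\<Sum>i\<in>A. (y i)\<^sup>2) - 2 * m * (\<Sum>i\<in>A. y i) + real (card A) * m\<^sup>2"
    by (simp add: sum.distrib sum_subtractf sum_distrib_left)
  also have "(\<Sum>i\<in>A. y i) = real (card A) * m"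
    using c by (simp add: m_def)
  also have "(\<Sum>i\<in>A. (y i)\<^sup>2) - 2 * m * (real (card A) * m) + real (card A) * m\<^sup>2
      = (\<Sum>i\<in>A. (y i)\<^sup>2) - real (card A) * m\<^sup>2"
    by (simp add: power2_eq_square)
  also have "\<dots> \<le> (\<Sum>i\<in>A. (y i)\<^sup>2)"
    by simp
  finally show ?thesis .
qed

lemma integral_double_sum:
  fixes f :: "'i \<Rightarrow> 'k \<Rightarrow> 'a \<Rightarrow> real"
  assumes int: "\<And>i k. i \<in> A \<Longrightarrow> k \<in> C \<Longrightarrow> integrable M (f i k)"
  shows "(\<integral>x. (\<Sum>i\<in>A. \<Sum>k\<in>C. f i k x) \<partial>M) = (\<Sum>i\<in>A. \<Sum>k\<in>C. \<integral>x. f i k x \<partial>M)"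
proof -
  have "(\<integral>x. (\<Sum>i\<in>A. \<Sum>k\<in>C. f i k x) \<partial>M) = (\<Sum>i\<in>A. \<integral>x. (\<Sum>k\<in>C. f i k x) \<partial>M)"
    by (intro Bochner_Integration.integral_sum Bochner_Integration.integrable_sum int)
  also have "\<dots> = (\<Sum>i\<in>A. \<Sum>k\<in>C. \<integral>x. f i k x \<partial>M)"
    by (intro sum.cong refl Bochner_Integration.integral_sum int)
  finally show ?thesis .
qed

text \<open>An entry of \<open>K x - I\<close>: the deviation of the sample covariance of the
  whitened design from its mean up to centering.\<close>

definition gram_error :: "nat \<Rightarrow> (nat \<times> nat \<Rightarrow> real) \<Rightarrow> nat \<Rightarrow> nat \<Rightarrow> real" where
  "gram_error n x a l = (\<Sum>i<n. centered_rows n x a i * x (i, l)) - (if a = l then 1 else 0)"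

lemma centered_rows_update: "a \<noteq> b \<Longrightarrow> centered_rows n (x((i, b) := y)) a k = centered_rows n x a k"
  by (simp add: centered_rows_def col_mean_def)

lemma gram_error_update:
  "a \<noteq> b \<Longrightarrow> l \<noteq> b \<Longrightarrow> gram_error n (x((i, b) := y)) a l = gram_error n x a l"
  by (simp add: gram_error_def centered_rows_update)

locale regression_moments = regression_model +
  assumes n: "0 < n" and D4: "integrable D (\<lambda>x. x ^ 4)"
begin

abbreviation "\<mu>\<^sub>4 \<equiv> (\<integral>x. x ^ 4 \<partial>D)"

lemma entry_moments:
  assumes "i < n" "k < n" "a < p" "b < p"
  shows "integrable PX (\<lambda>x. x (i, a))" "(\<integral>x. x (i, a) \<partial>PX) = 0"
    "integrable PX (\<lambda>x. x (i, a) * x (k, b))"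
    "(\<integral>x. x (i, a) * x (k, b) \<partial>PX) = (if i = k \<and> a = b then 1 else 0)"
proof -
  have "(i, a) \<in> {..<n} \<times> {..<p}" "(k, b) \<in> {..<n} \<times> {..<p}"
    using assms by auto
  note m = iid_second_moments[OF D(1,2,4,3,5) this]
  show "integrable PX (\<lambda>x. x (i, a))" "(\<integral>x. x (i, a) \<partial>PX) = 0"
    "integrable PX (\<lambda>x. x (i, a) * x (k, b))"
    by (rule m)+
  show "(\<integral>x. x (i, a) * x (k, b) \<partial>PX) = (if i = k \<and> a = b then 1 else 0)"
    using m(2) by simp
qed

lemma square_integrable_entry:
  assumes "i < n" "a < p"
  shows "square_integrable PX (\<lambda>x. x (i, a))"
  using entry_moments(1)[of i i a a] entry_moments(3)[of i i a a] assms
  by (simp add: square_integrable_def power2_eq_square)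

text \<open>The two entries may coincide, so independence is no help;
  \<open>u^2 v^2 \<le> u^4 + v^4\<close> reduces the claim to fourth moments.\<close>

lemma square_integrable_entry_mult:
  assumes "i < n" "k < n" "a < p" "b < p"
  shows "square_integrable PX (\<lambda>x. x (i, a) * x (k, b))"
proof -
  interpret P: prob_space PX by (rule prob_spaces)
  have pow4: "integrable PX (\<lambda>x. x (j, c) ^ 4)" if "j < n" "c < p" for j c
    using PiM_coordinate_independent(1)[OF D(1) _ _ _ D4, of "(j, c)" "{..<n} \<times> {..<p}" "\<lambda>_. 1"] that
    by simp
  have meas: "(\<lambda>x. x (i, a) * x (k, b)) \<in> borel_measurable PX"
    using entry_moments(3)[OF assms] by auto
  have "integrable PX (\<lambda>x. (x (i, a) * x (k, b))\<^sup>2)"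
  proof (rule Bochner_Integration.integrable_bound)
    show "integrable PX (\<lambda>x. x (i, a) ^ 4 + x (k, b) ^ 4)"
      using assms by (intro Bochner_Integration.integrable_add pow4)
    have "norm ((u * v)\<^sup>2) \<le> norm (u ^ 4 + v ^ 4)" for u v :: real
    proof -
      have "2 * u\<^sup>2 * v\<^sup>2 \<le> (u\<^sup>2)\<^sup>2 + (v\<^sup>2)\<^sup>2" "0 \<le> u\<^sup>2 * v\<^sup>2"
        by (rule sum_squares_bound) simp
      then have "u\<^sup>2 * v\<^sup>2 \<le> (u\<^sup>2)\<^sup>2 + (v\<^sup>2)\<^sup>2"
        by linarith
      then show ?thesis
        by (simp add: power_mult_distrib)
    qed
    then show "AE x in PX. norm ((x (i, a) * x (k, b))\<^sup>2) \<le> norm (x (i, a) ^ 4 + x (k, b) ^ 4)"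
      by blast
  qed (use meas in measurable)
  with meas show ?thesis
    by (simp add: square_integrable_def)
qed

text \<open>The form \<open>x_l . F x_l\<close> has the expected trace of \<open>F\<close> as its
  mean: off the diagonal one of the two centered entries can be split off, on the diagonal its
  square has mean one.\<close>

lemma integral_column_quadratic:
  assumes l: "l < p" and F: "\<And>i k. i < n \<Longrightarrow> k < n \<Longrightarrow> integrable PX (F i k)"
    and indep: "\<And>i k j x y. F i k (x((j, l) := y)) = F i k x"
  shows "integrable PX (\<lambda>x. \<Sum>i<n. \<Sum>k<n. F i k x * (x (i, l) * x (k, l)))"
    and "(\<integral>x. (\<Sum>i<n. \<Sum>k<n. F i k x * (x (i, l) * x (k, l))) \<partial>PX) = (\<Sum>i<n. \<integral>x. F i i x \<partial>PX)"
proof -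
  have ik: "integrable PX (\<lambda>x. F i k x * (x (i, l) * x (k, l)))
      \<and> (\<integral>x. F i k x * (x (i, l) * x (k, l)) \<partial>PX) = (if i = k then \<integral>x. F i k x \<partial>PX else 0)"
    if "i < n" "k < n" for i k
  proof (cases "i = k")
    case True
    then show ?thesis
      using PiM_coordinate_independent[OF D(1) _ F[OF that] indep D(4), of i] that l D(5)
      by (simp add: power2_eq_square)
  next
    case False
    have e: "(i, l) \<in> {..<n} \<times> {..<p}" "(k, l) \<in> {..<n} \<times> {..<p}"
      using that l by auto
    note 1 = PiM_coordinate_independent[OF D(1) e(2) F[OF that] indep D(2)]
    have "(\<lambda>x. F i k x * x (k, l)) (x((i, l) := y)) = F i k x * x (k, l)" for x y
      using False indep by simp
    note 2 = PiM_coordinate_independent[OF D(1) e(1) 1(1) this D(2)]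
    show ?thesis
      using 2 False D(3) by (simp add: mult_ac)
  qed
  then show "integrable PX (\<lambda>x. \<Sum>i<n. \<Sum>k<n. F i k x * (x (i, l) * x (k, l)))"
    by (intro Bochner_Integration.integrable_sum) auto
  have "(\<integral>x. (\<Sum>i<n. \<Sum>k<n. F i k x * (x (i, l) * x (k, l))) \<partial>PX)
      = (\<Sum>i<n. \<Sum>k<n. \<integral>x. F i k x * (x (i, l) * x (k, l)) \<partial>PX)"
    using ik by (intro integral_double_sum) auto
  also have "\<dots> = (\<Sum>i<n. \<Sum>k<n. if i = k then \<integral>x. F i k x \<partial>PX else 0)"
    using ik by (intro sum.cong refl) auto
  finally show "(\<integral>x. (\<Sum>i<n. \<Sum>k<n. F i k x * (x (i, l) * x (k, l))) \<partial>PX) = (\<Sum>i<n. \<integral>x. F i i x \<partial>PX)"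
    by simp
qed

lemma square_integrable_centered_rows:
  assumes "a < p" "i < n"
  shows "square_integrable PX (\<lambda>x. centered_rows n x a i)"
proof -
  have "square_integrable PX (\<lambda>x. (1 / real n) * x (i, a) + (- 1 / (real n)\<^sup>2) * (\<Sum>k<n. x (k, a)))"
    by (intro square_integrable_add square_integrable_cmult square_integrable_sum prob_spaces
        square_integrable_entry) (use assms in auto)
  moreover have "(1 / real n) * x (i, a) + (- 1 / (real n)\<^sup>2) * (\<Sum>k<n. x (k, a)) = centered_rows n x a i" for x
    by (simp add: centered_rows_def col_mean_def diff_divide_distrib power2_eq_square)
  ultimately show ?thesis by simp
qed

lemma centered_rows_second_moment:
  assumes a: "a < p"
  shows "(\<Sum>i<n. \<integral>x. (centered_rows n x a i)\<^sup>2 \<partial>PX) \<le> 1 / real n"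
proof -
  have le: "(\<Sum>i<n. (centered_rows n x a i)\<^sup>2) \<le> (\<Sum>i<n. x (i, a) * x (i, a)) / (real n)\<^sup>2" for x
  proof -
    have "(\<Sum>i<n. (centered_rows n x a i)\<^sup>2) = (\<Sum>i<n. (x (i, a) - (\<Sum>i<n. x (i, a)) / real (card {..<n}))\<^sup>2) / (real n)\<^sup>2"
      by (simp add: centered_rows_def col_mean_def power_divide sum_divide_distrib)
    also have "\<dots> \<le> (\<Sum>i<n. (x (i, a))\<^sup>2) / (real n)\<^sup>2"
      using n by (intro divide_right_mono sum_centered_squares_le) auto
    finally show ?thesis by (simp add: power2_eq_square)
  qed
  have int: "integrable PX (\<lambda>x. (centered_rows n x a i)\<^sup>2)" if "i < n" for i
    using square_integrable_centered_rows[OF a that] by (simp add: square_integrable_def)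
  have "(\<Sum>i<n. \<integral>x. (centered_rows n x a i)\<^sup>2 \<partial>PX) = (\<integral>x. (\<Sum>i<n. (centered_rows n x a i)\<^sup>2) \<partial>PX)"
    using int by (subst Bochner_Integration.integral_sum) auto
  also have "\<dots> \<le> (\<integral>x. (\<Sum>i<n. x (i, a) * x (i, a)) / (real n)\<^sup>2 \<partial>PX)"
    using le int a
    by (intro integral_mono Bochner_Integration.integrable_sum Bochner_Integration.integrable_divide entry_moments)
      auto
  also have "\<dots> = (\<Sum>i<n. \<integral>x. x (i, a) * x (i, a) \<partial>PX) / (real n)\<^sup>2"
    using a by (simp add: Bochner_Integration.integral_sum entry_moments)
  also have "\<dots> = 1 / real n"
    using a n by (simp add: entry_moments power2_eq_square)
  finally show ?thesis .
qed

lemma square_integrable_gram_error: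
  assumes "a < p" "l < p"
  shows "square_integrable PX (\<lambda>x. gram_error n x a l)"
proof -
  have "square_integrable PX (\<lambda>x. (1 / real n) * (\<Sum>i<n. x (i, a) * x (i, l))
      + (- 1 / (real n)\<^sup>2) * (\<Sum>i<n. \<Sum>k<n. x (k, a) * x (i, l)) + (if a = l then - 1 else 0))"
    by (intro square_integrable_add square_integrable_cmult square_integrable_sum prob_spaces
        square_integrable_entry_mult square_integrable_const) (use assms in auto)
  moreover have "(1 / real n) * (\<Sum>i<n. x (i, a) * x (i, l))
      + (- 1 / (real n)\<^sup>2) * (\<Sum>i<n. \<Sum>k<n. x (k, a) * x (i, l)) + (if a = l then - 1 else 0) = gram_error n x a l" for x
  proof -
    have e: "(\<Sum>k<n. x (k, a) * x (i, l)) = (\<Sum>k<n. x (k, a)) * x (i, l)" for i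
      by (simp only: sum_distrib_right)
    have "centered_rows n x a i * x (i, l)
        = (1 / real n) * (x (i, a) * x (i, l)) + (- 1 / (real n)\<^sup>2) * (\<Sum>k<n. x (k, a) * x (i, l))" for i
      unfolding e using n by (simp add: centered_rows_def col_mean_def power2_eq_square field_simps)
    then have "(\<Sum>i<n. centered_rows n x a i * x (i, l))
        = (1 / real n) * (\<Sum>i<n. x (i, a) * x (i, l)) + (- 1 / (real n)\<^sup>2) * (\<Sum>i<n. \<Sum>k<n. x (k, a) * x (i, l))"
      by (simp only: sum.distrib sum_distrib_left)
    then show ?thesis
      by (simp add: gram_error_def)
  qed
  ultimately show ?thesis by simp
qed

text \<open>One of the two column indices differs from \<open>a\<close>. The corresponding factor is
  linear in that column with coefficients from column \<open>a\<close>, and the other factor does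
  not contain the column, so the mean is zero.\<close>

lemma gram_error_uncorrelated:
  assumes "a < p" "l < p" "l' < p" "l \<noteq> l'"
  shows "(\<integral>x. gram_error n x a l * gram_error n x a l' \<partial>PX) = 0"
proof -
  have *: "(\<integral>x. gram_error n x a l * gram_error n x a l' \<partial>PX) = 0"
    if "l < p" "l' < p" "l \<noteq> l'" "a \<noteq> l" for l l'
  proof -
    let ?F = "\<lambda>i x. centered_rows n x a i * gram_error n x a l'"
    have int: "integrable PX (?F i)" if "i < n" for i
      using \<open>a < p\<close> \<open>l' < p\<close> that
      by (intro square_integrable_mult square_integrable_centered_rows square_integrable_gram_error)
    have i: "integrable PX (\<lambda>x. ?F i x * x (i, l)) \<and> (\<integral>x. ?F i x * x (i, l) \<partial>PX) = 0" if "i < n" for i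
      using PiM_coordinate_independent[OF D(1) _ int[OF that] _ D(2), of "(i, l)"] that \<open>l < p\<close> \<open>l \<noteq> l'\<close> \<open>a \<noteq> l\<close> D(3)
      by (simp add: centered_rows_update gram_error_update)
    have "(\<integral>x. gram_error n x a l * gram_error n x a l' \<partial>PX) = (\<integral>x. (\<Sum>i<n. ?F i x * x (i, l)) \<partial>PX)"
    proof (rule Bochner_Integration.integral_cong)
      fix x
      have "gram_error n x a l = (\<Sum>i<n. centered_rows n x a i * x (i, l))"
        using \<open>a \<noteq> l\<close> by (simp add: gram_error_def)
      then show "gram_error n x a l * gram_error n x a l' = (\<Sum>i<n. ?F i x * x (i, l))"
        by (simp add: sum_distrib_right sum_distrib_left mult_ac)
    qed simp
    also have "\<dots> = 0"
      using i by (subst Bochner_Integration.integral_sum) auto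
    finally show ?thesis .
  qed
  show ?thesis
  proof (cases "a = l")
    case True
    then show ?thesis
      using *[of l' l] assms by (simp add: mult.commute)
  qed (use * assms in blast)
qed

text \<open>Column \<open>l\<close> is independent of column \<open>a\<close>, so the mean square is
  the expected squared norm of the centered row.\<close>

lemma gram_error_off_diagonal:
  assumes "a < p" "l < p" "a \<noteq> l"
  shows "(\<integral>x. (gram_error n x a l)\<^sup>2 \<partial>PX) \<le> 1 / real n"
proof -
  have "(gram_error n x a l)\<^sup>2
      = (\<Sum>i<n. \<Sum>k<n. (centered_rows n x a i * centered_rows n x a k) * (x (i, l) * x (k, l)))" for x
    using assms by (simp add: gram_error_def power2_eq_square sum_product mult_ac)
  then have "(\<integral>x. (gram_error n x a l)\<^sup>2 \<partial>PX)
      = (\<integral>x. (\<Sum>i<n. \<Sum>k<n. (centered_rows n x a i * centered_rows n x a k) * (x (i, l) * x (k, l))) \<partial>PX)"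
    by simp
  also have "\<dots> = (\<Sum>i<n. \<integral>x. centered_rows n x a i * centered_rows n x a i \<partial>PX)"
    using assms
    by (intro integral_column_quadratic square_integrable_mult square_integrable_centered_rows)
      (auto simp: centered_rows_update)
  also have "\<dots> \<le> 1 / real n"
    using centered_rows_second_moment[OF assms(1)] by (simp add: power2_eq_square)
  finally show ?thesis .
qed

lemma gram_error_diagonal:
  assumes a: "a < p"
  shows "(\<integral>x. (gram_error n x a a)\<^sup>2 \<partial>PX) \<le> (\<mu>\<^sub>4 + 1) / real n"
proof -
  interpret P: prob_space PX by (rule prob_spaces)
  interpret D: prob_space D by (rule D)
  define s where "s x = (\<Sum>i<n. (x (i, a))\<^sup>2) / real n" for x :: "nat \<times> nat \<Rightarrow> real"
  define m where "m x = (\<Sum>i<n. x (i, a)) / real n" for x :: "nat \<times> nat \<Rightarrow> real"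
  have R: "gram_error n x a a = s x - (m x)\<^sup>2 - 1" for x
  proof -
    have "(\<Sum>i<n. centered_rows n x a i * x (i, a)) = (\<Sum>i<n. (x (i, a))\<^sup>2 / real n - (m x / real n) * x (i, a))"
      by (intro sum.cong refl)
        (simp add: centered_rows_def col_mean_def m_def power2_eq_square left_diff_distrib diff_divide_distrib)
    also have "\<dots> = s x - (m x / real n) * (\<Sum>i<n. x (i, a))"
      by (simp only: sum_subtractf s_def sum_divide_distrib sum_distrib_left)
    also have "\<dots> = s x - (m x)\<^sup>2"
      by (simp add: m_def power2_eq_square)
    finally show ?thesis by (simp add: gram_error_def)
  qed
  have m_le: "(m x)\<^sup>2 \<le> s x" for x
  proof -
    have "(\<Sum>i<n. x (i, a))\<^sup>2 \<le> real n * (\<Sum>i<n. (x (i, a))\<^sup>2)"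
      using Cauchy_Schwarz_ineq_sum[of "\<lambda>_. 1" "\<lambda>i. x (i, a)" "{..<n}"] by simp
    then show ?thesis
      using n by (simp add: m_def s_def power_divide field_simps power2_eq_square)
  qed
  \<comment> \<open>In the expansion of \<open>((s - 1) - m^2)^2\<close> the term \<open>m^4\<close>
    is absorbed by \<open>m^4 \<le> m^2 s\<close>. The two remaining means are
    \<open>(\<mu>\<^sub>4 - 1) / n\<close> and \<open>2 / n\<close>, the origin of
    \<open>\<mu>\<^sub>4 + 1\<close>.\<close>
  have pointwise: "(gram_error n x a a)\<^sup>2 \<le> (s x - 1)\<^sup>2 + 2 * (m x)\<^sup>2" for x
  proof -
    have "(m x)\<^sup>2 * (m x)\<^sup>2 \<le> (m x)\<^sup>2 * s x"
      by (rule mult_left_mono[OF m_le]) simp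
    moreover have "0 \<le> (m x)\<^sup>2 * s x"
      by (rule mult_nonneg_nonneg[OF _ order_trans[OF zero_le_power2 m_le]]) simp
    ultimately show ?thesis
      unfolding R by (simp add: power2_eq_square algebra_simps)
  qed
  have sq1: "integrable D (\<lambda>y. (y ^ 2 - 1) ^ 2)" "(\<integral>y. (y ^ 2 - 1) ^ 2 \<partial>D) = \<mu>\<^sub>4 - 1"
    "integrable D (\<lambda>y. y ^ 2 - 1)" "(\<integral>y. y ^ 2 - 1 \<partial>D) = 0"
  proof -
    have eq: "(y ^ 2 - 1) ^ 2 = y ^ 4 - 2 * y ^ 2 + 1" for y :: real
      by (simp add: power2_diff flip: power_mult)
    show "integrable D (\<lambda>y. (y ^ 2 - 1) ^ 2)" "(\<integral>y. (y ^ 2 - 1) ^ 2 \<partial>D) = \<mu>\<^sub>4 - 1"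
      "integrable D (\<lambda>y. y ^ 2 - 1)" "(\<integral>y. y ^ 2 - 1 \<partial>D) = 0"
      using D4 D(4,5) by (simp_all add: eq D.prob_space)
  qed
  have z: "integrable PX (\<lambda>x. ((x (i, a))\<^sup>2 - 1) * ((x (k, a))\<^sup>2 - 1))
      \<and> (\<integral>x. ((x (i, a))\<^sup>2 - 1) * ((x (k, a))\<^sup>2 - 1) \<partial>PX) = (if i = k then \<mu>\<^sub>4 - 1 else 0)"
    if "i < n" "k < n" for i k
  proof -
    have e: "(i, a) \<in> {..<n} \<times> {..<p}" "(k, a) \<in> {..<n} \<times> {..<p}"
      using that a by auto
    show ?thesis
    proof (cases "i = k")
      case True
      then show ?thesis
        using PiM_coordinate_independent[OF D(1) e(1) _ _ sq1(1), of "\<lambda>_. 1"] sq1(2)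
        by (simp add: P.prob_space power2_eq_square)
    next
      case False
      have "integrable PX (\<lambda>x. (x (i, a))\<^sup>2 - 1)"
        using PiM_coordinate_independent(1)[OF D(1) e(1) _ _ sq1(3), of "\<lambda>_. 1"] by simp
      then show ?thesis
        using PiM_coordinate_independent[OF D(1) e(2) _ _ sq1(3), of "\<lambda>x. (x (i, a))\<^sup>2 - 1"] False sq1(4)
        by simp
    qed
  qed
  have s1: "(s x - 1)\<^sup>2 = (\<Sum>i<n. \<Sum>k<n. ((x (i, a))\<^sup>2 - 1) * ((x (k, a))\<^sup>2 - 1)) / (real n)\<^sup>2" for x
  proof -
    have "s x - 1 = (\<Sum>i<n. (x (i, a))\<^sup>2 - 1) / real n"
      using n by (simp add: s_def sum_subtractf diff_divide_distrib)
    then show ?thesis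
      by (simp add: power_divide sum_product[symmetric] power2_eq_square[of "sum _ _"])
  qed
  have m2: "(m x)\<^sup>2 = (\<Sum>i<n. \<Sum>k<n. x (i, a) * x (k, a)) / (real n)\<^sup>2" for x
    by (simp add: m_def power_divide sum_product[symmetric] power2_eq_square[of "sum _ _"])
  have Is: "integrable PX (\<lambda>x. (s x - 1)\<^sup>2)" "(\<integral>x. (s x - 1)\<^sup>2 \<partial>PX) = (\<mu>\<^sub>4 - 1) / real n"
  proof -
    show "integrable PX (\<lambda>x. (s x - 1)\<^sup>2)"
      unfolding s1 using z by (intro Bochner_Integration.integrable_sum Bochner_Integration.integrable_divide) auto
    have "(\<integral>x. (s x - 1)\<^sup>2 \<partial>PX)
        = (\<Sum>i<n. \<Sum>k<n. \<integral>x. ((x (i, a))\<^sup>2 - 1) * ((x (k, a))\<^sup>2 - 1) \<partial>PX) / (real n)\<^sup>2"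
      unfolding s1 using z by (subst integral_double_sum[symmetric]) auto
    also have "\<dots> = (\<Sum>i<n. \<Sum>k<n. if i = k then \<mu>\<^sub>4 - 1 else 0) / (real n)\<^sup>2"
      using z by (intro arg_cong2[where f = "(/)"] sum.cong refl) auto
    also have "\<dots> = (\<mu>\<^sub>4 - 1) / real n"
      using n by (simp add: power2_eq_square)
    finally show "(\<integral>x. (s x - 1)\<^sup>2 \<partial>PX) = (\<mu>\<^sub>4 - 1) / real n" .
  qed
  have Im: "integrable PX (\<lambda>x. (m x)\<^sup>2)" "(\<integral>x. (m x)\<^sup>2 \<partial>PX) = 1 / real n"
  proof -
    show "integrable PX (\<lambda>x. (m x)\<^sup>2)"
      unfolding m2 using a
      by (intro Bochner_Integration.integrable_sum Bochner_Integration.integrable_divide entry_moments) auto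
    have "(\<integral>x. (m x)\<^sup>2 \<partial>PX) = (\<Sum>i<n. \<Sum>k<n. \<integral>x. x (i, a) * x (k, a) \<partial>PX) / (real n)\<^sup>2"
      unfolding m2 using a by (subst integral_double_sum[symmetric]) (auto intro: entry_moments(3))
    also have "\<dots> = (\<Sum>i<n. \<Sum>k<n. if i = k then 1 else 0) / (real n)\<^sup>2"
      using a by (intro arg_cong2[where f = "(/)"] sum.cong refl) (auto simp: entry_moments(4))
    also have "\<dots> = 1 / real n"
      using n by (simp add: power2_eq_square)
    finally show "(\<integral>x. (m x)\<^sup>2 \<partial>PX) = 1 / real n" .
  qed
  have "(\<integral>x. (gram_error n x a a)\<^sup>2 \<partial>PX) \<le> (\<integral>x. (s x - 1)\<^sup>2 + 2 * (m x)\<^sup>2 \<partial>PX)"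
    using square_integrable_gram_error[OF a a] Is(1) Im(1) pointwise
    by (intro integral_mono) (auto simp: square_integrable_def)
  also have "\<dots> = (\<mu>\<^sub>4 - 1) / real n + 2 * (1 / real n)"
    using Is Im by simp
  also have "\<dots> = (\<mu>\<^sub>4 + 1) / real n"
    by (simp add: add_divide_distrib diff_divide_distrib)
  finally show ?thesis .
qed

end

lemma borel_measurable_gs_proj:
  assumes x: "\<And>j b. j < n \<Longrightarrow> b \<in> set bs \<Longrightarrow> (\<lambda>x. x (j, b)) \<in> borel_measurable M"
    and ik: "i < n" "k < n"
  shows "(\<lambda>x. gs_proj n x bs i k) \<in> borel_measurable M"
  using x ik
proof (induction bs arbitrary: i k)
  case (Cons b bs)
  have Q: "(\<lambda>x. gs_proj n x bs i k) \<in> borel_measurable M" if "i < n" "k < n" for i k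
    using Cons.prems(1) that by (intro Cons.IH) auto
  have u: "(\<lambda>x. \<Sum>l<n. gs_proj n x bs i l * x (l, b)) \<in> borel_measurable M" if "i < n" for i
    using that Cons.prems(1) by (intro borel_measurable_sum borel_measurable_times Q) auto
  have s: "(\<lambda>x. \<Sum>i<n. (\<Sum>l<n. gs_proj n x bs i l * x (l, b))\<^sup>2) \<in> borel_measurable M"
    by (intro borel_measurable_sum borel_measurable_power u) auto
  show ?case
    unfolding gs_proj.simps Let_def using Cons.prems(2,3)
    by (intro borel_measurable_diff borel_measurable_divide borel_measurable_times Q u s)
qed simp

context regression_moments
begin

text \<open>Uncorrelatedness within a row removes the cross terms. What is left weights the squared
  entries of \<open>S\<close> by column sums of second moments, each at most \<open>p / n\<close>
  plus one diagonal term, and those squares add up to the trace of \<open>S S\<close>.\<close>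

lemma gram_error_weighted:
  assumes S: "S \<in> carrier_mat p p" "transpose_mat S = S"
  shows "(\<Sum>a<p. \<Sum>k<p. \<integral>x. (\<Sum>l<p. gram_error n x a l * S $$ (l, k))\<^sup>2 \<partial>PX)
    \<le> trace_mat (S * S) * ((real p + \<mu>\<^sub>4 + 1) / real n)"
proof -
  have sym: "S $$ (i, j) = S $$ (j, i)" if "i < p" "j < p" for i j
    using S that by (metis carrier_matD index_transpose_mat(1))
  define c where "c a l = (\<integral>x. (gram_error n x a l)\<^sup>2 \<partial>PX)" for a l
  have \<mu>: "0 \<le> \<mu>\<^sub>4"
    by (intro integral_nonneg_AE) auto
  have c_le: "c a l \<le> 1 / real n + (if a = l then (\<mu>\<^sub>4 + 1) / real n else 0)" if "a < p" "l < p" for a l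
    using gram_error_off_diagonal[OF that] gram_error_diagonal[OF that(1)] by (auto simp: c_def intro: add_increasing)
  have int: "integrable PX (\<lambda>x. gram_error n x a l * gram_error n x a l')" if "a < p" "l < p" "l' < p" for a l l'
    using that by (intro square_integrable_mult square_integrable_gram_error)
  have ak: "(\<integral>x. (\<Sum>l<p. gram_error n x a l * S $$ (l, k))\<^sup>2 \<partial>PX) = (\<Sum>l<p. c a l * (S $$ (l, k))\<^sup>2)"
    if "a < p" for a k
  proof -
    have "(\<integral>x. (\<Sum>l<p. gram_error n x a l * S $$ (l, k))\<^sup>2 \<partial>PX)
        = (\<integral>x. (\<Sum>l<p. \<Sum>l'<p. (gram_error n x a l * gram_error n x a l') * (S $$ (l, k) * S $$ (l', k))) \<partial>PX)"
      by (simp add: power2_eq_square sum_product mult_ac)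
    also have "\<dots> = (\<Sum>l<p. \<Sum>l'<p. \<integral>x. (gram_error n x a l * gram_error n x a l') * (S $$ (l, k) * S $$ (l', k)) \<partial>PX)"
      using that by (intro integral_double_sum integrable_mult_left int) auto
    also have "\<dots> = (\<Sum>l<p. \<Sum>l'<p. if l = l' then c a l * (S $$ (l, k))\<^sup>2 else 0)"
      using that gram_error_uncorrelated
      by (intro sum.cong refl) (auto simp: c_def power2_eq_square)
    finally show ?thesis by simp
  qed
  have "(\<Sum>a<p. \<Sum>k<p. \<integral>x. (\<Sum>l<p. gram_error n x a l * S $$ (l, k))\<^sup>2 \<partial>PX)
      = (\<Sum>a<p. \<Sum>k<p. \<Sum>l<p. c a l * (S $$ (l, k))\<^sup>2)"
    by (intro sum.cong refl) (simp add: ak)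
  also have "\<dots> \<le> (\<Sum>a<p. \<Sum>k<p. \<Sum>l<p. (1 / real n + (if a = l then (\<mu>\<^sub>4 + 1) / real n else 0)) * (S $$ (l, k))\<^sup>2)"
    by (intro sum_mono mult_right_mono c_le) auto
  also have "\<dots> = (\<Sum>k<p. \<Sum>l<p. \<Sum>a<p. (1 / real n + (if a = l then (\<mu>\<^sub>4 + 1) / real n else 0)) * (S $$ (l, k))\<^sup>2)"
    by (rule sum_rotate3)
  also have "\<dots> = (\<Sum>k<p. \<Sum>l<p. ((real p + \<mu>\<^sub>4 + 1) / real n) * (S $$ (l, k))\<^sup>2)"
    by (intro sum.cong refl) (simp add: sum.distrib flip: sum_distrib_right add: add_divide_distrib)
  also have "\<dots> = trace_mat (S * S) * ((real p + \<mu>\<^sub>4 + 1) / real n)"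
  proof -
    have "trace_mat (S * S) = (\<Sum>k<p. \<Sum>l<p. (S $$ (l, k))\<^sup>2)"
      using S(1) by (simp add: trace_mat_def scalar_prod_def lessThan_atLeast0 power2_eq_square sym)
    moreover have "(\<Sum>k<p. \<Sum>l<p. c * (S $$ (l, k))\<^sup>2) = (\<Sum>k<p. \<Sum>l<p. (S $$ (l, k))\<^sup>2) * c" for c
      unfolding sum_distrib_right by (simp only: mult.commute)
    ultimately show ?thesis
      by (simp only:)
  qed
  finally show ?thesis .
qed

text \<open>
  Given the other columns, the squared distance of a column to their span has conditional mean
  \<open>m = n - p + 1\<close>, and \<open>1 / t \<ge> 2 / m - t / m\<^sup>2\<close> replaces Jensen's inequality.
\<close>

lemma dual_row_second_moment_ge:
  assumes L: "\<And>i. i < n \<Longrightarrow> square_integrable PX (L a i)"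
    and dual: "AE x in PX. \<forall>a<p. \<forall>b<p. (\<Sum>i<n. L a i x * x (i, b)) = (if a = b then 1 else 0)"
    and a: "a < p" and pn: "p \<le> n"
  shows "1 / (real n - real p + 1) \<le> (\<Sum>i<n. \<integral>x. (L a i x)\<^sup>2 \<partial>PX)"
proof -
  interpret P: prob_space PX by (rule prob_spaces)
  define bs where "bs = filter (\<lambda>b. b \<noteq> a) [0..<p]"
  define m where "m = real n - real p + 1"
  define Q where "Q i k x = gs_proj n x bs i k" for i k x
  have set_bs: "set bs = {..<p} - {a}" and dist: "distinct bs"
    by (auto simp: bs_def)
  have "length bs = card (set bs)"
    using dist by (simp add: distinct_card)
  \<comment> \<open>There are \<open>p - 1\<close> other columns, which is the source of the
    \<open>+ 1\<close> in \<open>m\<close>; it keeps \<open>m\<close> positive also for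
    \<open>p = n\<close>.\<close>
  then have len: "real (length bs) = real p - 1"
    using a by (simp add: set_bs of_nat_diff)
  have m: "0 < m"
    using pn by (simp add: m_def)
  have trace: "AE x in PX. (\<Sum>i<n. Q i i x) = m"
    using dual
  proof eventually_elim
    case (elim x)
    have "(\<Sum>i<n. gs_proj n x bs i i) = real n - real (length bs)"
      by (rule gs_proj_trace[OF dist, where L = "\<lambda>b i. L b i x"]) (use elim set_bs in auto)
    then show ?case
      by (simp add: Q_def len m_def)
  qed
  have Q_int: "integrable PX (Q i k)" if "i < n" "k < n" for i k
  proof (rule P.integrable_const_bound[of _ 1])
    show "Q i k \<in> borel_measurable PX"
      unfolding Q_def using that entry_moments(1)
      by (intro borel_measurable_gs_proj) (auto simp: set_bs)
    show "AE x in PX. norm (Q i k x) \<le> 1"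
      using gs_proj_bounded[OF that] by (simp add: Q_def)
  qed
  have Q_indep: "Q i k (x((j, a) := y)) = Q i k x" for i k j x y
    unfolding Q_def by (subst gs_proj_update) (simp_all add: set_bs)
  note quad = integral_column_quadratic[OF a Q_int Q_indep]
  have "(\<integral>x. (\<Sum>i<n. \<Sum>k<n. Q i k x * (x (i, a) * x (k, a))) \<partial>PX) = (\<integral>x. (\<Sum>i<n. Q i i x) \<partial>PX)"
    using Q_int by (subst quad(2)) (auto simp: Bochner_Integration.integral_sum)
  also have "\<dots> = (\<integral>x. m \<partial>PX)"
    using trace Q_int by (intro integral_cong_AE) auto
  finally have Eq: "(\<integral>x. (\<Sum>i<n. \<Sum>k<n. Q i k x * (x (i, a) * x (k, a))) \<partial>PX) = m"
    by (simp add: P.prob_space)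
  have L2: "integrable PX (\<lambda>x. (L a i x)\<^sup>2)" if "i < n" for i
    using L[OF that] by (simp add: square_integrable_def)
  \<comment> \<open>The affine minorant touches \<open>1 / t\<close> at the mean
    \<open>t = m\<close>, so averaging loses nothing in this bound.\<close>
  have "1 / m = 2 / m - m / m\<^sup>2"
    using m by (simp add: power2_eq_square field_simps)
  also have "\<dots> = (\<integral>x. 2 / m - (\<Sum>i<n. \<Sum>k<n. Q i k x * (x (i, a) * x (k, a))) / m\<^sup>2 \<partial>PX)"
    using quad(1) Eq by (simp add: P.prob_space)
  also have "\<dots> \<le> (\<integral>x. (\<Sum>i<n. (L a i x)\<^sup>2) \<partial>PX)"
  proof (rule integral_mono_AE)
    show "integrable PX (\<lambda>x. 2 / m - (\<Sum>i<n. \<Sum>k<n. Q i k x * (x (i, a) * x (k, a))) / m\<^sup>2)"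
      using quad(1) by auto
    show "integrable PX (\<lambda>x. \<Sum>i<n. (L a i x)\<^sup>2)"
      using L2 by auto
    show "AE x in PX. 2 / m - (\<Sum>i<n. \<Sum>k<n. Q i k x * (x (i, a) * x (k, a))) / m\<^sup>2 \<le> (\<Sum>i<n. (L a i x)\<^sup>2)"
      using dual
    proof eventually_elim
      case (elim x)
      show ?case
        unfolding Q_def by (rule dual_row_norm_ge[OF _ _ m]) (use elim a set_bs in auto)
    qed
  qed
  also have "\<dots> = (\<Sum>i<n. \<integral>x. (L a i x)\<^sup>2 \<partial>PX)"
    using L2 by (simp add: Bochner_Integration.integral_sum)
  finally show ?thesis
    by (simp add: m_def)
qed

section \<open>Square integrability of least squares and the risk as a quadratic in the mixing
  weight\<close>

lemma Hmat_eq: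
  assumes pd: "pd_mat Sig" and Sig: "Sig \<in> carrier_mat p p"
  shows "Hmat \<Omega> n p Sig = real n \<cdot>\<^sub>m Sig"
proof (rule eq_matI)
  fix j k assume "j < dim_row (real n \<cdot>\<^sub>m Sig)" "k < dim_col (real n \<cdot>\<^sub>m Sig)"
  then have jk: "j < p" "k < p" using Sig by auto
  let ?S = "mat_sqrt Sig"
  note S = mat_sqrt_pd[OF pd Sig]
  have sym: "?S $$ (i, j) = ?S $$ (j, i)" if "i < p" "j < p" for i j
    using S that by (metis carrier_matD index_transpose_mat(1))
  define g where "g x = (\<Sum>i<n. \<Sum>l<p. \<Sum>l'<p. (x (i, l) * x (i, l')) * (?S $$ (l, j) * ?S $$ (l', k)))"
    for x :: "nat \<times> nat \<Rightarrow> real"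
  have XX: "(transpose_mat (design n p Sig \<omega>) * design n p Sig \<omega>) $$ (j, k) = g (fst (snd \<omega>))" for \<omega>
  proof -
    let ?X = "design n p Sig \<omega>"
    have X: "?X = mat n p (fst (snd \<omega>)) * ?S"
      by (rule design_eq[OF pd Sig])
    have Xc: "?X \<in> carrier_mat n p"
      by (simp add: design_def)
    have "?X $$ (i, j) = (\<Sum>l<p. fst (snd \<omega>) (i, l) * ?S $$ (l, j))" if "i < n" "j < p" for i j
      unfolding X using S(1) that by (simp add: scalar_prod_def lessThan_atLeast0)
    moreover have "(transpose_mat ?X * ?X) $$ (j, k) = (\<Sum>i<n. ?X $$ (i, j) * ?X $$ (i, k))"
      using Xc jk by (simp add: scalar_prod_def lessThan_atLeast0)
    ultimately show ?thesis
      using jk by (simp add: g_def sum_product mult_ac)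
  qed
  have int: "integrable PX (\<lambda>x. (x (i, l) * x (i, l')) * (?S $$ (l, j) * ?S $$ (l', k)))" if "i < n" "l < p" "l' < p" for i l l'
    using that by (intro integrable_mult_left entry_moments)
  have "(\<integral>x. g x \<partial>PX) = (\<Sum>i<n. \<integral>x. (\<Sum>l<p. \<Sum>l'<p. (x (i, l) * x (i, l')) * (?S $$ (l, j) * ?S $$ (l', k))) \<partial>PX)"
    unfolding g_def using int by (intro Bochner_Integration.integral_sum Bochner_Integration.integrable_sum) auto
  also have "\<dots> = (\<Sum>i<n. \<Sum>l<p. \<Sum>l'<p. \<integral>x. (x (i, l) * x (i, l')) * (?S $$ (l, j) * ?S $$ (l', k)) \<partial>PX)"
    using int by (intro sum.cong refl integral_double_sum) auto
  also have "\<dots> = (\<Sum>i<n. \<Sum>l<p. \<Sum>l'<p. if l = l' then ?S $$ (l, j) * ?S $$ (l', k) else 0)"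
    by (intro sum.cong refl) (auto simp: entry_moments)
  also have "\<dots> = real n * (\<Sum>l<p. ?S $$ (j, l) * ?S $$ (l, k))"
    using jk by (simp add: sym)
  also have "(\<Sum>l<p. ?S $$ (j, l) * ?S $$ (l, k)) = (?S * ?S) $$ (j, k)"
    using S(1) jk by (simp add: scalar_prod_def lessThan_atLeast0)
  finally have "(\<integral>x. g x \<partial>PX) = real n * Sig $$ (j, k)"
    using S(3) by simp
  moreover have "integrable PX g"
    unfolding g_def using int by (intro Bochner_Integration.integrable_sum) auto
  ultimately show "Hmat \<Omega> n p Sig $$ (j, k) = (real n \<cdot>\<^sub>m Sig) $$ (j, k)"
    using jk Sig by (simp add: Hmat_def XX design_integral)
qed (use Sig in \<open>simp_all add: Hmat_def\<close>)

text \<open>Written out in the entries of \<open>x\<close> and of the inverse, the expression is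
  measurable because the entries of \<open>minv\<close> are, by their integrability.\<close>

lemma ols_rows_entry:
  assumes S: "S \<in> carrier_mat p p" and ai: "a < p" "i < n"
  defines "X \<equiv> \<lambda>x. mat n p x * S"
  shows "ols_rows n p S x $$ (a, i) = (\<Sum>l<p. S $$ (a, l) * (\<Sum>k<p. minv (transpose_mat (X x) * X x) $$ (l, k)
    * (\<Sum>j<p. x (i, j) * S $$ (j, k))))"
proof -
  let ?A = "transpose_mat (X x) * X x"
  have X: "X x \<in> carrier_mat n p"
    unfolding X_def by (rule mult_carrier_mat[OF mat_carrier S])
  then have XT: "transpose_mat (X x) \<in> carrier_mat p n" and "?A \<in> carrier_mat p p"
    by auto
  then have M: "minv ?A \<in> carrier_mat p p"
    by (intro minv_carrier)
  have MX: "minv ?A * transpose_mat (X x) \<in> carrier_mat p n"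
    by (rule mult_carrier_mat[OF M XT])
  have Xk: "X x $$ (i, k) = (\<Sum>j<p. x (i, j) * S $$ (j, k))" if "k < p" for k
    using S ai that by (simp add: X_def scalar_prod_def lessThan_atLeast0)
  have MXl: "(minv ?A * transpose_mat (X x)) $$ (l, i) = (\<Sum>k<p. minv ?A $$ (l, k) * X x $$ (i, k))" if "l < p" for l
  proof -
    have "(minv ?A * transpose_mat (X x)) $$ (l, i) = row (minv ?A) l \<bullet> col (transpose_mat (X x)) i"
      using M XT that ai by (intro index_mult_mat) auto
    also have "\<dots> = (\<Sum>k<p. minv ?A $$ (l, k) * X x $$ (i, k))"
      using M X that ai by (simp add: scalar_prod_def lessThan_atLeast0)
    finally show ?thesis .
  qed
  have "ols_rows n p S x $$ (a, i) = row S a \<bullet> col (minv ?A * transpose_mat (X x)) i"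
    unfolding ols_rows_def Let_def X_def using S MX[unfolded X_def] ai by (intro index_mult_mat) auto
  also have "\<dots> = (\<Sum>l<p. S $$ (a, l) * (minv ?A * transpose_mat (X x)) $$ (l, i))"
  proof -
    have "col (minv ?A * transpose_mat (X x)) i $ l = (minv ?A * transpose_mat (X x)) $$ (l, i)" if "l < p" for l
      using MX ai that by (intro index_col) auto
    then show ?thesis
      using S M ai by (simp add: scalar_prod_def lessThan_atLeast0 del: index_mult_mat(1))
  qed
  also have "\<dots> = (\<Sum>l<p. S $$ (a, l) * (\<Sum>k<p. minv ?A $$ (l, k) * X x $$ (i, k)))"
    by (intro sum.cong refl arg_cong2[where f = "(*)"] MXl) auto
  also have "\<dots> = (\<Sum>l<p. S $$ (a, l) * (\<Sum>k<p. minv ?A $$ (l, k) * (\<Sum>j<p. x (i, j) * S $$ (j, k))))"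
    by (intro sum.cong refl arg_cong2[where f = "(*)"] Xk) auto
  finally show ?thesis .
qed

text \<open>A squared entry is at most the squared norm of its row, which is a diagonal entry of
  \<open>S A^-1 S\<close> and thus linear in the inverse. This is how the assumed mean of the
  inverse controls the risk.\<close>

lemma square_integrable_ols_rows:
  assumes S: "S \<in> carrier_mat p p" "transpose_mat S = S"
    and T: "T \<in> carrier_mat p p" "S * T = 1\<^sub>m p" "T * S = 1\<^sub>m p"
  defines "A \<equiv> \<lambda>x. transpose_mat (mat n p x * S) * (mat n p x * S)"
  assumes inv: "AE x in PX. invertible_mat (A x)"
    and int: "\<And>l k. l < p \<Longrightarrow> k < p \<Longrightarrow> integrable PX (\<lambda>x. minv (A x) $$ (l, k))"
    and ai: "a < p" "i < n"
  shows "square_integrable PX (\<lambda>x. ols_rows n p S x $$ (a, i))"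
proof -
  interpret W: whitened_design n p S T x for x
    by unfold_locales (use S T n in auto)
  have meas: "(\<lambda>x. ols_rows n p S x $$ (a, i)) \<in> borel_measurable PX"
    unfolding ols_rows_entry[OF S(1) ai]
    using int[unfolded A_def] entry_moments(1) ai
    by (intro borel_measurable_sum borel_measurable_times borel_measurable_const) auto
  have "integrable PX (\<lambda>x. (ols_rows n p S x $$ (a, i))\<^sup>2)"
  proof (rule Bochner_Integration.integrable_bound)
    show "integrable PX (\<lambda>x. \<Sum>l<p. S $$ (a, l) * (\<Sum>k<p. minv (A x) $$ (l, k) * S $$ (k, a)))"
      using int by (intro Bochner_Integration.integrable_sum integrable_mult_left integrable_mult_right) auto
    show "(\<lambda>x. (ols_rows n p S x $$ (a, i))\<^sup>2) \<in> borel_measurable PX"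
      using meas by measurable
    show "AE x in PX. norm ((ols_rows n p S x $$ (a, i))\<^sup>2)
        \<le> norm (\<Sum>l<p. S $$ (a, l) * (\<Sum>k<p. minv (A x) $$ (l, k) * S $$ (k, a)))"
      using inv
    proof eventually_elim
      case (elim x)
      have M: "minv (A x) \<in> carrier_mat p p"
        unfolding A_def by (rule W.carriers(6))
      have "(ols_rows n p S x $$ (a, i))\<^sup>2 \<le> (\<Sum>i<n. (ols_rows n p S x $$ (a, i))\<^sup>2)"
        using ai by (intro member_le_sum) auto
      also have "\<dots> = (S * minv (A x) * S) $$ (a, a)"
        unfolding A_def by (rule W.L_row_norm) (use elim ai in \<open>auto simp: A_def\<close>)
      also have "\<dots> = (\<Sum>l<p. S $$ (a, l) * (\<Sum>k<p. minv (A x) $$ (l, k) * S $$ (k, a)))"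
        using S(1) M ai by (simp add: scalar_prod_def lessThan_atLeast0)
      finally show ?case
        by simp
    qed
  qed
  with meas show ?thesis
    by (simp add: square_integrable_def)
qed

lemma risk_quadratic:
  assumes pd: "pd_mat Sig" and Sig: "Sig \<in> carrier_mat p p"
    and inv: "AE \<omega> in \<Omega>. invertible_mat (transpose_mat (design n p Sig \<omega>) * design n p Sig \<omega>)"
    and int: "\<And>j k. j < p \<Longrightarrow> k < p \<Longrightarrow>
      integrable \<Omega> (\<lambda>\<omega>. minv (transpose_mat (design n p Sig \<omega>) * design n p Sig \<omega>) $$ (j, k))"
    and pn: "p \<le> n"
  obtains a b d where
    "\<And>\<alpha>. red_err \<Omega> n p Sig (dot_est \<alpha> (Hmat \<Omega> n p Sig)) = (1 - \<alpha>)\<^sup>2 * a + 2 * \<alpha> * (1 - \<alpha>) * b + \<alpha>\<^sup>2 * d"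
    "red_err \<Omega> n p Sig ols = a"
    "\<sigma>\<^sup>2 * (real p / (real n - real p + 1)) \<le> a"
    "\<sigma>\<^sup>2 * ((real p - 1) / real n) \<le> b" "b \<le> \<sigma>\<^sup>2 * (real p / real n)"
    "d \<le> \<tau>\<^sup>2 * (trace_mat Sig * ((real p + \<mu>\<^sub>4 + 1) / real n)) + \<sigma>\<^sup>2 * (real p / real n)"
proof -
  interpret P: prob_space PX by (rule prob_spaces)
  define S where "S = mat_sqrt Sig"
  note S = mat_sqrt_pd[OF pd Sig, folded S_def]
  obtain T where T: "T \<in> carrier_mat p p" "S * T = 1\<^sub>m p" "T * S = 1\<^sub>m p"
    using pd_sqrt_inverse[OF pd Sig] unfolding S_def by blast
  interpret W: whitened_design n p S T x for x
    by unfold_locales (use S T n in auto)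
  let ?A = "\<lambda>x. transpose_mat (mat n p x * S) * (mat n p x * S)"
  note X = design_eq[OF pd Sig, folded S_def]
  have inv_P: "AE x in PX. invertible_mat (?A x)"
    using inv unfolding X by (rule design_AE_D)
  have int_P: "integrable PX (\<lambda>x. minv (?A x) $$ (l, k))" if "l < p" "k < p" for l k
    using int[OF that] unfolding X by (rule design_integrableD)
  define L where "L a i x = ols_rows n p S x $$ (a, i)" for a i x
  define K where "K a i x = centered_rows n x a i" for a i x
  have L: "square_integrable PX (L a i)" if "a < p" "i < n" for a i
    unfolding L_def using that
    by (intro square_integrable_ols_rows[OF S(1,2) T inv_P int_P]) auto
  have K: "square_integrable PX (K a i)" if "a < p" "i < n" for a i
    unfolding K_def using that by (rule square_integrable_centered_rows)
  have dual: "AE x in PX. \<forall>a<p. \<forall>b<p. (\<Sum>i<n. L a i x * x (i, b)) = (if a = b then 1 else 0)"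
    using inv_P
  proof eventually_elim
    case (elim x)
    then show ?case
      unfolding L_def using W.dual_rows by blast
  qed
  define R where "R a k x = (\<Sum>l<p. gram_error n x a l * S $$ (l, k))" for a k x
  have R: "square_integrable PX (R a k)" if "a < p" for a k
  proof -
    have "square_integrable PX (\<lambda>x. \<Sum>l<p. S $$ (l, k) * gram_error n x a l)"
      using that by (intro square_integrable_sum square_integrable_cmult square_integrable_gram_error prob_spaces) auto
    then show ?thesis
      by (simp add: R_def[abs_def] mult.commute)
  qed
  define a where "a = \<sigma>\<^sup>2 * (\<Sum>a<p. \<Sum>i<n. \<integral>x. (L a i x)\<^sup>2 \<partial>PX)"
  define b where "b = \<sigma>\<^sup>2 * (\<Sum>a<p. \<Sum>i<n. \<integral>x. L a i x * K a i x \<partial>PX)"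
  define d where "d = \<tau>\<^sup>2 * (\<Sum>a<p. \<Sum>k<p. \<integral>x. (R a k x)\<^sup>2 \<partial>PX) + \<sigma>\<^sup>2 * (\<Sum>a<p. \<Sum>i<n. \<integral>x. (K a i x)\<^sup>2 \<partial>PX)"
  have H: "Hmat \<Omega> n p Sig = real n \<cdot>\<^sub>m (S * S)"
    unfolding S(3) by (rule Hmat_eq[OF pd Sig])
  have risk: "red_err \<Omega> n p Sig (dot_est \<alpha> (Hmat \<Omega> n p Sig)) = (1 - \<alpha>)\<^sup>2 * a + 2 * \<alpha> * (1 - \<alpha>) * b + \<alpha>\<^sup>2 * d" for \<alpha>
  proof -
    define U where "U a i x = (1 - \<alpha>) * L a i x + \<alpha> * K a i x" for a i x
    define V where "V a k x = (\<Sum>l<p. ((\<Sum>i<n. U a i x * x (i, l)) - (if a = l then 1 else 0)) * S $$ (l, k))" for a k x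
    have U: "square_integrable PX (U a i)" if "a < p" "i < n" for a i
    proof -
      have "square_integrable PX (\<lambda>x. (1 - \<alpha>) * L a i x + \<alpha> * K a i x)"
        using that by (intro square_integrable_add square_integrable_cmult L K)
      then show ?thesis by (simp add: U_def[abs_def])
    qed
    \<comment> \<open>Since \<open>L x = I\<close>, one has
      \<open>(1 - \<alpha>) I + \<alpha> K x - I = \<alpha> (K x - I)\<close>, but only where the
      Gram matrix is invertible.\<close>
    have VR: "AE x in PX. \<alpha> * R a k x = V a k x" if "a < p" for a k
      using dual
    proof eventually_elim
      case (elim x)
      have "(\<Sum>i<n. U a i x * x (i, l)) - (if a = l then 1 else 0) = \<alpha> * gram_error n x a l" if "l < p" for l
      proof -
        have "(\<Sum>i<n. U a i x * x (i, l)) = (1 - \<alpha>) * (\<Sum>i<n. L a i x * x (i, l)) + \<alpha> * (\<Sum>i<n. K a i x * x (i, l))"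
          by (simp add: U_def distrib_right sum.distrib sum_distrib_left mult.assoc)
        also have "(\<Sum>i<n. L a i x * x (i, l)) = (if a = l then 1 else 0)"
          using elim \<open>a < p\<close> that by blast
        finally show ?thesis
          by (simp add: K_def gram_error_def algebra_simps)
      qed
      then show ?case
        by (simp add: V_def R_def sum_distrib_left mult.assoc)
    qed
    \<comment> \<open>Agreement almost everywhere with a measurable function does not give
      measurability, so it is checked on the explicit form.\<close>
    have V_meas: "V a k \<in> borel_measurable PX" if "a < p" for a k
      unfolding V_def using that U entry_moments(1)
      by (intro borel_measurable_sum borel_measurable_times borel_measurable_diff borel_measurable_const)
        (auto simp: square_integrable_def)
    have V: "square_integrable PX (V a k)" if "a < p" for a k
      by (rule square_integrable_AE_cong[OF square_integrable_cmult[OF R[OF that]] V_meas[OF that] VR[OF that]])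
    have "red_err \<Omega> n p Sig (dot_est \<alpha> (Hmat \<Omega> n p Sig))
        = (\<integral>\<omega>. (\<Sum>a<p. fst (snd (snd \<omega>)) a * ((\<Sum>k<p. V a k (fst (snd \<omega>)) * fst \<omega> k)
            + (\<Sum>i<n. U a i (fst (snd \<omega>)) * snd (snd (snd \<omega>)) i)))\<^sup>2 \<partial>\<Omega>)"
      unfolding red_err_def resp_def X beta_vec_def test_pt_def S_def[symmetric] W.prediction_error[OF H]
      by (simp only: V_def U_def L_def K_def)
    also have "\<dots> = \<tau>\<^sup>2 * (\<Sum>a<p. \<Sum>k<p. \<integral>x. (V a k x)\<^sup>2 \<partial>PX) + \<sigma>\<^sup>2 * (\<Sum>a<p. \<Sum>i<n. \<integral>x. (U a i x)\<^sup>2 \<partial>PX)"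
      by (rule linear_error_second_moment[OF V U])
    also have "(\<Sum>a<p. \<Sum>k<p. \<integral>x. (V a k x)\<^sup>2 \<partial>PX) = \<alpha>\<^sup>2 * (\<Sum>a<p. \<Sum>k<p. \<integral>x. (R a k x)\<^sup>2 \<partial>PX)"
      unfolding sum_distrib_left
    proof (intro sum.cong refl)
      fix a k assume "a \<in> {..<p}" "k \<in> {..<p}"
      then have a: "a < p" by simp
      have "(\<integral>x. (V a k x)\<^sup>2 \<partial>PX) = (\<integral>x. (\<alpha> * R a k x)\<^sup>2 \<partial>PX)"
        using VR[OF a, of k] V[OF a, of k] R[OF a, of k]
        by (intro integral_cong_AE) (auto simp: square_integrable_def)
      then show "(\<integral>x. (V a k x)\<^sup>2 \<partial>PX) = \<alpha>\<^sup>2 * (\<integral>x. (R a k x)\<^sup>2 \<partial>PX)"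
        by (simp add: power_mult_distrib)
    qed
    also have "(\<Sum>a<p. \<Sum>i<n. \<integral>x. (U a i x)\<^sup>2 \<partial>PX) = (\<Sum>a<p. \<Sum>i<n. (1 - \<alpha>)\<^sup>2 * (\<integral>x. (L a i x)\<^sup>2 \<partial>PX)
        + 2 * \<alpha> * (1 - \<alpha>) * (\<integral>x. L a i x * K a i x \<partial>PX) + \<alpha>\<^sup>2 * (\<integral>x. (K a i x)\<^sup>2 \<partial>PX))"
    proof (intro sum.cong refl)
      fix a i assume "a \<in> {..<p}" "i \<in> {..<n}"
      then have ai: "a < p" "i < n" by auto
      have "(U a i x)\<^sup>2 = (1 - \<alpha>)\<^sup>2 * (L a i x)\<^sup>2 + 2 * \<alpha> * (1 - \<alpha>) * (L a i x * K a i x) + \<alpha>\<^sup>2 * (K a i x)\<^sup>2" for x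
        by (simp add: U_def power2_sum power_mult_distrib mult_ac)
      then show "(\<integral>x. (U a i x)\<^sup>2 \<partial>PX) = (1 - \<alpha>)\<^sup>2 * (\<integral>x. (L a i x)\<^sup>2 \<partial>PX)
        + 2 * \<alpha> * (1 - \<alpha>) * (\<integral>x. L a i x * K a i x \<partial>PX) + \<alpha>\<^sup>2 * (\<integral>x. (K a i x)\<^sup>2 \<partial>PX)"
        using L[OF ai] K[OF ai] square_integrable_mult[OF L[OF ai] K[OF ai]]
        by (simp add: square_integrable_def)
    qed
    also have "\<dots> = (1 - \<alpha>)\<^sup>2 * (\<Sum>a<p. \<Sum>i<n. \<integral>x. (L a i x)\<^sup>2 \<partial>PX)
        + 2 * \<alpha> * (1 - \<alpha>) * (\<Sum>a<p. \<Sum>i<n. \<integral>x. L a i x * K a i x \<partial>PX) + \<alpha>\<^sup>2 * (\<Sum>a<p. \<Sum>i<n. \<integral>x. (K a i x)\<^sup>2 \<partial>PX)"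
      by (simp only: sum.distrib sum_distrib_left)
    finally show ?thesis
      unfolding a_def b_def d_def by (simp only: distrib_left mult_ac add_ac)
  qed
  \<comment> \<open>Least squares is the mixture of weight zero; what needs checking is that the
    zero multiple of \<open>breve\<close> has the right length.\<close>
  have "dot_est 0 (Hmat \<Omega> n p Sig) (design n p Sig \<omega>) Y = ols (design n p Sig \<omega>) Y" for \<omega> Y
  proof (rule eq_vecI)
    have dims: "dim_vec (ols (design n p Sig \<omega>) Y) = p" "dim_vec (breve (Hmat \<Omega> n p Sig) (design n p Sig \<omega>) Y) = p"
    proof -
      have "minv (transpose_mat (design n p Sig \<omega>) * design n p Sig \<omega>) \<in> carrier_mat p p"
        by (rule minv_carrier) (auto simp: design_def)
      then show "dim_vec (ols (design n p Sig \<omega>) Y) = p"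
        by (auto simp: ols_def)
      have "minv (Hmat \<Omega> n p Sig) \<in> carrier_mat p p"
        by (rule minv_carrier) (auto simp: Hmat_def)
      then show "dim_vec (breve (Hmat \<Omega> n p Sig) (design n p Sig \<omega>) Y) = p"
        by (auto simp: breve_def)
    qed
    show "dim_vec (dot_est 0 (Hmat \<Omega> n p Sig) (design n p Sig \<omega>) Y) = dim_vec (ols (design n p Sig \<omega>) Y)"
      using dims by (simp add: dot_est_def)
    show "dot_est 0 (Hmat \<Omega> n p Sig) (design n p Sig \<omega>) Y $ i = ols (design n p Sig \<omega>) Y $ i"
      if "i < dim_vec (ols (design n p Sig \<omega>) Y)" for i
      using dims that by (simp add: dot_est_def)
  qed
  then have ols: "red_err \<Omega> n p Sig ols = a"
    using risk[of 0] by (simp add: red_err_def)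
  have "\<sigma>\<^sup>2 * (real p / (real n - real p + 1)) \<le> a"
  proof -
    have "(\<Sum>a<p. 1 / (real n - real p + 1)) \<le> (\<Sum>a<p. \<Sum>i<n. \<integral>x. (L a i x)\<^sup>2 \<partial>PX)"
      using L by (intro sum_mono dual_row_second_moment_ge[OF _ dual _ pn]) auto
    then show ?thesis
      unfolding a_def by (intro mult_left_mono) auto
  qed
  moreover
  have LK: "integrable PX (\<lambda>x. L a i x * K a i x)" if "a < p" "i < n" for a i
    using L[OF that] K[OF that] by (rule square_integrable_mult)
  have bI: "b = \<sigma>\<^sup>2 * (\<integral>x. (\<Sum>a<p. \<Sum>i<n. L a i x * K a i x) \<partial>PX)"
    unfolding b_def using LK by (subst integral_double_sum) auto
  have LKI: "integrable PX (\<lambda>x. \<Sum>a<p. \<Sum>i<n. L a i x * K a i x)"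
    using LK by (intro Bochner_Integration.integrable_sum) auto
  have LK_ge: "AE x in PX. (real p - 1) / real n \<le> (\<Sum>a<p. \<Sum>i<n. L a i x * K a i x)"
    unfolding L_def K_def using inv_P by eventually_elim (rule W.L_centered_bounds)
  have LK_le: "AE x in PX. (\<Sum>a<p. \<Sum>i<n. L a i x * K a i x) \<le> real p / real n"
    unfolding L_def K_def using inv_P by eventually_elim (rule W.L_centered_bounds)
  have "(\<integral>x. (real p - 1) / real n \<partial>PX) \<le> (\<integral>x. (\<Sum>a<p. \<Sum>i<n. L a i x * K a i x) \<partial>PX)"
    using LKI LK_ge by (intro integral_mono_AE) auto
  then have "\<sigma>\<^sup>2 * ((real p - 1) / real n) \<le> b"
    unfolding bI by (intro mult_left_mono) (auto simp: P.prob_space)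
  moreover have "(\<integral>x. (\<Sum>a<p. \<Sum>i<n. L a i x * K a i x) \<partial>PX) \<le> (\<integral>x. real p / real n \<partial>PX)"
    using LKI LK_le by (intro integral_mono_AE) auto
  then have "b \<le> \<sigma>\<^sup>2 * (real p / real n)"
    unfolding bI by (intro mult_left_mono) (auto simp: P.prob_space)
  moreover have "d \<le> \<tau>\<^sup>2 * (trace_mat Sig * ((real p + \<mu>\<^sub>4 + 1) / real n)) + \<sigma>\<^sup>2 * (real p / real n)"
  proof -
    have "(\<Sum>a<p. \<Sum>k<p. \<integral>x. (R a k x)\<^sup>2 \<partial>PX) \<le> trace_mat Sig * ((real p + \<mu>\<^sub>4 + 1) / real n)"
      unfolding R_def using gram_error_weighted[OF S(1,2)] S(3) by simp
    moreover have "(\<Sum>a<p. \<Sum>i<n. \<integral>x. (K a i x)\<^sup>2 \<partial>PX) \<le> (\<Sum>a<p. 1 / real n)"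
      unfolding K_def by (intro sum_mono centered_rows_second_moment) auto
    ultimately show ?thesis
      unfolding d_def by (intro add_mono mult_left_mono) auto
  qed
  ultimately show thesis
    using risk ols by (intro that[of a b d])
qed

end

section \<open>The optimal mixture\<close>

text \<open>\<open>u / (u + e)\<close> decreases in \<open>e\<close>, but increases in
  \<open>u\<close> only for nonnegative \<open>e\<close>. Truncating the upper bound for
  \<open>e\<close> at zero makes the comparison with \<open>a0 - b1\<close> valid whatever the sign
  of \<open>d - b\<close>.\<close>

lemma arg_min_mixture_bounds:
  fixes f :: "real \<Rightarrow> real"
  assumes f: "\<And>\<alpha>. f \<alpha> = (1 - \<alpha>)\<^sup>2 * a + 2 * \<alpha> * (1 - \<alpha>) * b + \<alpha>\<^sup>2 * d"
    and f_nonneg: "\<And>\<alpha>. 0 \<le> f \<alpha>"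
    and a: "0 < a0" "a0 \<le> a" and b: "b0 \<le> b" "b \<le> b1" "0 \<le> b1" "b1 < a0" and d: "d \<le> d1"
  defines "\<alpha>0 \<equiv> (a0 - b1) / ((a0 - b1) + max (d1 - b0) 0)"
  shows "\<alpha>0 \<le> arg_min f (\<lambda>_. True)"
    and "f (arg_min f (\<lambda>_. True)) / a \<le> 1 - \<alpha>0 * (1 - b1 / a0)"
proof -
  define u where "u = a - b"
  define e where "e = d - b"
  define e' where "e' = max (d1 - b0) 0"
  have u: "a0 - b1 \<le> u" "0 < a0 - b1" "0 < u" and e: "e \<le> e'" "0 \<le> e'"
    using a b d by (auto simp: u_def e_def e'_def)
  have f_eq: "f \<alpha> = a - 2 * \<alpha> * u + \<alpha>\<^sup>2 * (u + e)" for \<alpha>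
    by (simp add: f u_def e_def power2_eq_square algebra_simps)
  \<comment> \<open>Otherwise the square term is nonpositive everywhere, and
    \<open>\<alpha> = (a + 1) / (2 u)\<close> makes the affine part \<open>-1\<close>, against
    nonnegativity of \<open>f\<close>.\<close>
  have ue: "0 < u + e"
  proof (rule ccontr)
    assume "\<not> 0 < u + e"
    then have "((a + 1) / (2 * u))\<^sup>2 * (u + e) \<le> 0"
      by (intro mult_nonneg_nonpos) auto
    moreover have "a - 2 * ((a + 1) / (2 * u)) * u = - 1"
      using u by (simp add: field_simps)
    ultimately show False
      using f_nonneg[of "(a + 1) / (2 * u)"] unfolding f_eq by linarith
  qed
  define \<beta> where "\<beta> = u / (u + e)"
  \<comment> \<open>Completing the square shows that a minimizer exists, so the choice behind
    \<open>arg_min\<close> is genuine, and that it is unique, so the chosen value is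
    \<open>\<beta>\<close>.\<close>
  have square: "f \<alpha> = f \<beta> + (u + e) * (\<alpha> - \<beta>)\<^sup>2" for \<alpha>
  proof -
    have *: "(u + e) * \<beta> = u"
      using ue by (simp add: \<beta>_def)
    have "f \<beta> + (u + e) * (\<alpha> - \<beta>)\<^sup>2 = a - 2 * \<beta> * u + \<alpha>\<^sup>2 * (u + e) - 2 * \<alpha> * ((u + e) * \<beta>) + 2 * \<beta> * ((u + e) * \<beta>)"
      by (simp add: f_eq power2_eq_square algebra_simps)
    then show ?thesis
      unfolding * f_eq by simp
  qed
  have "f \<beta> \<le> f \<alpha>" for \<alpha>
    unfolding square[of \<alpha>] using ue by simp
  then have "is_arg_min f (\<lambda>_. True) \<beta>"
    by (simp add: is_arg_min_def not_less)
  then have "is_arg_min f (\<lambda>_. True) (arg_min f (\<lambda>_. True))"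
    unfolding arg_min_def by (rule someI)
  then have "f (arg_min f (\<lambda>_. True)) \<le> f \<beta>"
    by (auto simp: is_arg_min_def not_less)
  then have "(u + e) * (arg_min f (\<lambda>_. True) - \<beta>)\<^sup>2 \<le> 0"
    using square[of "arg_min f (\<lambda>_. True)"] by simp
  then have arg_min: "arg_min f (\<lambda>_. True) = \<beta>"
    using ue by (simp add: mult_le_0_iff)
  have \<beta>: "\<alpha>0 \<le> \<beta>"
  proof -
    have "(a0 - b1) * e \<le> (a0 - b1) * e'"
      using u e by (intro mult_left_mono) auto
    also have "\<dots> \<le> u * e'"
      using u e by (intro mult_right_mono) auto
    finally have "(a0 - b1) * (u + e) \<le> u * ((a0 - b1) + e')"
      by (simp add: algebra_simps)
    then show ?thesis
      unfolding \<alpha>0_def \<beta>_def e'_def[symmetric] using u e ue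
      by (simp add: divide_le_eq le_divide_eq)
  qed
  then show "\<alpha>0 \<le> arg_min f (\<lambda>_. True)"
    by (simp add: arg_min)
  have "b / a \<le> b1 / a0"
    using a b by (intro frac_le) auto
  moreover have "b1 / a0 < 1"
    using a b by simp
  ultimately have "\<alpha>0 * (1 - b1 / a0) \<le> \<beta> * (1 - b / a)"
    using \<beta> u e by (intro mult_mono) (auto simp: \<beta>_def ue less_imp_le)
  moreover have "f \<beta> / a = 1 - \<beta> * (1 - b / a)"
  proof -
    have "f \<beta> = a - 2 * \<beta> * u + \<beta> * ((u + e) * \<beta>)"
      by (simp add: f_eq power2_eq_square algebra_simps)
    also have "(u + e) * \<beta> = u"
      using ue by (simp add: \<beta>_def)
    finally have "f \<beta> = a - \<beta> * u" by simp
    then show ?thesis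
      using a by (simp add: u_def diff_divide_distrib right_diff_distrib)
  qed
  ultimately show "f (arg_min f (\<lambda>_. True)) / a \<le> 1 - \<alpha>0 * (1 - b1 / a0)"
    by (simp add: arg_min)
qed

section \<open>Passage to the limit\<close>

theorem theorem5:
  fixes p :: "nat \<Rightarrow> nat"
    and \<gamma> \<sigma> \<tau> c :: real
    and D :: "real measure"
    and N :: "nat \<Rightarrow> real measure"
    and B :: "nat \<Rightarrow> (nat \<Rightarrow> real) measure"
    and Sig :: "nat \<Rightarrow> real mat"
  defines "\<Omega> \<equiv> \<lambda>n. sample_space n (p n) D (N n) (B n)"
  assumes ratio: "(\<lambda>n. real (p n) / real n) \<longlonglongrightarrow> \<gamma>" and "0 < \<gamma>" and "\<gamma> < 1"
    and p_inf: "filterlim p at_top sequentially"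
    \<comment> \<open>entries of xtilde: i.i.d. law D, mean 0, variance 1, finite 4th and 6th moments\<close>
    and D_prob: "prob_space D" and D_sets: "sets D = sets borel"
    and D_int1: "integrable D (\<lambda>x. x)" and D_mean: "(\<integral>x. x \<partial>D) = 0"
    and D_int2: "integrable D (\<lambda>x. x ^ 2)" and D_var: "(\<integral>x. x ^ 2 \<partial>D) = 1"
    and D_int4: "integrable D (\<lambda>x. x ^ 4)" and D_int6: "integrable D (\<lambda>x. x ^ 6)"
    \<comment> \<open>noise: mean zero, variance sigma^2 > 0\<close>
    and "0 < \<sigma>"
    and N_prob: "\<And>n. prob_space (N n)" and N_sets: "\<And>n. sets (N n) = sets borel"
    and N_int1: "\<And>n. integrable (N n) (\<lambda>e. e)" and N_mean: "\<And>n. (\<integral>e. e \<partial>N n) = 0"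
    and N_int2: "\<And>n. integrable (N n) (\<lambda>e. e ^ 2)" and N_var: "\<And>n. (\<integral>e. e ^ 2 \<partial>N n) = \<sigma> ^ 2"
    \<comment> \<open>beta: E[beta] = 0, E[beta beta^T] = tau^2 I\<close>
    and B_prob: "\<And>n. prob_space (B n)"
    and B_sets: "\<And>n. sets (B n) = sets (PiM {..<p n} (\<lambda>_. borel))"
    and B_int1: "\<And>n j. j < p n \<Longrightarrow> integrable (B n) (\<lambda>b. b j)"
    and B_mean: "\<And>n j. j < p n \<Longrightarrow> (\<integral>b. b j \<partial>B n) = 0"
    and B_int2: "\<And>n j k. j < p n \<Longrightarrow> k < p n \<Longrightarrow> integrable (B n) (\<lambda>b. b j * b k)"
    and B_cov: "\<And>n j k. j < p n \<Longrightarrow> k < p n \<Longrightarrow>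
                  (\<integral>b. b j * b k \<partial>B n) = \<tau> ^ 2 * (if j = k then 1 else 0)"
    \<comment> \<open>Sigma_p positive definite, tr(Sigma) -> c^2\<close>
    and Sig_dim: "\<And>n. Sig n \<in> carrier_mat (p n) (p n)"
    and Sig_pd: "\<And>n. pd_mat (Sig n)"
    and trace_lim: "(\<lambda>n. trace_mat (Sig n)) \<longlonglongrightarrow> c ^ 2"
    \<comment> \<open>(X^T X)^(-1) exists a.s. and E[(X^T X)^(-1)] exists\<close>
    and inv_ae: "\<forall>\<^sub>F n in sequentially. AE \<omega> in \<Omega> n.
          invertible_mat (transpose_mat (design n (p n) (Sig n) \<omega>) * design n (p n) (Sig n) \<omega>)"
    and inv_int: "\<forall>\<^sub>F n in sequentially. \<forall>j < p n. \<forall>k < p n. integrable (\<Omega> n) (\<lambda>\<omega>.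
          index_mat (minv (transpose_mat (design n (p n) (Sig n) \<omega>) * design n (p n) (Sig n) \<omega>)) (j, k))"
  shows "\<forall>\<epsilon> > 0. \<exists>n\<^sub>\<epsilon>. \<forall>n > n\<^sub>\<epsilon>.
      eta (\<Omega> n) n (p n) (Sig n)
        \<le> 1 - (\<gamma> ^ 4 * \<sigma> ^ 2) / ((1 - \<gamma>) * \<gamma> ^ 2 * \<tau> ^ 2 * c ^ 2 + \<gamma> ^ 3 * \<sigma> ^ 2) + \<epsilon>
    \<and> alpha_star (\<Omega> n) n (p n) (Sig n)
        \<ge> (\<gamma> ^ 2 * \<sigma> ^ 2) / ((1 - \<gamma>) * \<gamma> * \<tau> ^ 2 * c ^ 2 + \<gamma> ^ 2 * \<sigma> ^ 2) - \<epsilon>"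
proof -
  \<comment> \<open>The envelopes are the bounds of \<open>risk_quadratic\<close> as sequences, and
    \<open>\<alpha>0\<close> is the weight that \<open>arg_min_mixture_bounds\<close> makes of
    them.\<close>
  define \<mu> where "\<mu> = (\<integral>x. x ^ 4 \<partial>D)"
  define a0 where "a0 n = \<sigma>\<^sup>2 * (real (p n) / (real n - real (p n) + 1))" for n
  define b0 where "b0 n = \<sigma>\<^sup>2 * ((real (p n) - 1) / real n)" for n
  define b1 where "b1 n = \<sigma>\<^sup>2 * (real (p n) / real n)" for n
  define d1 where "d1 n = \<tau>\<^sup>2 * (trace_mat (Sig n) * ((real (p n) + \<mu> + 1) / real n)) + \<sigma>\<^sup>2 * (real (p n) / real n)" for n
  define \<alpha>0 where "\<alpha>0 n = (a0 n - b1 n) / ((a0 n - b1 n) + max (d1 n - b0 n) 0)" for n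
  define \<alpha>' where "\<alpha>' = (\<gamma> ^ 2 * \<sigma> ^ 2) / ((1 - \<gamma>) * \<gamma> * \<tau> ^ 2 * c ^ 2 + \<gamma> ^ 2 * \<sigma> ^ 2)"
  define \<eta>' where "\<eta>' = 1 - (\<gamma> ^ 4 * \<sigma> ^ 2) / ((1 - \<gamma>) * \<gamma> ^ 2 * \<tau> ^ 2 * c ^ 2 + \<gamma> ^ 3 * \<sigma> ^ 2)"
  have bounds: "eta (\<Omega> n) n (p n) (Sig n) \<le> 1 - \<alpha>0 n * (1 - b1 n / a0 n)
      \<and> \<alpha>0 n \<le> alpha_star (\<Omega> n) n (p n) (Sig n)"
    if n: "0 < n" and pn: "p n \<le> n" and pos: "0 < a0 n" "b1 n < a0 n"
      and inv: "AE \<omega> in \<Omega> n. invertible_mat (transpose_mat (design n (p n) (Sig n) \<omega>) * design n (p n) (Sig n) \<omega>)"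
      and int: "\<forall>j<p n. \<forall>k<p n. integrable (\<Omega> n) (\<lambda>\<omega>.
        minv (transpose_mat (design n (p n) (Sig n) \<omega>) * design n (p n) (Sig n) \<omega>) $$ (j, k))" for n
  proof -
    interpret M: regression_moments n "p n" D "N n" "B n" \<sigma> \<tau>
    proof (rule regression_moments.intro)
      show "regression_model (p n) D (N n) (B n) \<sigma> \<tau>"
        by (rule regression_model.intro)
          (fact D_prob D_int1 D_mean D_int2 D_var N_prob N_int1 N_mean N_int2 N_var B_prob
            | (rule B_int1 B_mean B_int2; assumption) | simp add: B_cov)+
      show "regression_moments_axioms n D"
        by (rule regression_moments_axioms.intro) (fact n D_int4)+
    qed
    let ?r = "\<lambda>\<alpha>. red_err (\<Omega> n) n (p n) (Sig n) (dot_est \<alpha> (Hmat (\<Omega> n) n (p n) (Sig n)))"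
    obtain a b d where risk: "\<And>\<alpha>. ?r \<alpha> = (1 - \<alpha>)\<^sup>2 * a + 2 * \<alpha> * (1 - \<alpha>) * b + \<alpha>\<^sup>2 * d"
      and ols: "red_err (\<Omega> n) n (p n) (Sig n) ols = a"
      and abd: "a0 n \<le> a" "b0 n \<le> b" "b \<le> b1 n" "d \<le> d1 n"
      using M.risk_quadratic[OF Sig_pd Sig_dim inv[unfolded \<Omega>_def] int[unfolded \<Omega>_def, rule_format] pn]
      unfolding \<Omega>_def a0_def b0_def b1_def d1_def \<mu>_def by blast
    have "0 \<le> ?r \<alpha>" for \<alpha>
      by (simp add: red_err_def)
    moreover have "0 \<le> b1 n"
      by (simp add: b1_def)
    ultimately show ?thesis
      unfolding eta_def alpha_star_def ols \<alpha>0_def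
      using arg_min_mixture_bounds[OF risk _ pos(1) abd(1,2,3) _ pos(2) abd(4)] by blast
  qed
  have inv_n: "(\<lambda>n. 1 / real n) \<longlonglongrightarrow> 0"
    by (rule lim_1_over_n)
  have ev_n: "\<forall>\<^sub>F n in sequentially. 0 < n"
    by (rule eventually_gt_at_top)
  have a0_lim: "a0 \<longlonglongrightarrow> \<sigma>\<^sup>2 * (\<gamma> / (1 - \<gamma>))"
  proof -
    have "(\<lambda>n. \<sigma>\<^sup>2 * ((real (p n) / real n) / (1 - real (p n) / real n + 1 / real n))) \<longlonglongrightarrow> \<sigma>\<^sup>2 * (\<gamma> / (1 - \<gamma> + 0))"
      using \<open>\<gamma> < 1\<close> by (intro tendsto_intros ratio inv_n) auto
    moreover have "\<forall>\<^sub>F n in sequentially. \<sigma>\<^sup>2 * ((real (p n) / real n) / (1 - real (p n) / real n + 1 / real n)) = a0 n"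
      using ev_n by eventually_elim (simp add: a0_def divide_simps)
    ultimately show ?thesis
      by (simp add: tendsto_cong)
  qed
  have b1_lim: "b1 \<longlonglongrightarrow> \<sigma>\<^sup>2 * \<gamma>"
    unfolding b1_def by (intro tendsto_intros ratio)
  \<comment> \<open>The two bounds for \<open>b\<close> differ by \<open>\<sigma>^2 / n\<close>, the
    cost of centering, and share their limit.\<close>
  have b0_lim: "b0 \<longlonglongrightarrow> \<sigma>\<^sup>2 * \<gamma>"
  proof -
    have "(\<lambda>n. \<sigma>\<^sup>2 * (real (p n) / real n - 1 / real n)) \<longlonglongrightarrow> \<sigma>\<^sup>2 * (\<gamma> - 0)"
      by (intro tendsto_intros ratio inv_n)
    then show ?thesis
      by (simp add: b0_def[abs_def] diff_divide_distrib)
  qed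
  have d1_lim: "d1 \<longlonglongrightarrow> \<tau>\<^sup>2 * (c\<^sup>2 * \<gamma>) + \<sigma>\<^sup>2 * \<gamma>"
  proof -
    have "(\<lambda>n. \<tau>\<^sup>2 * (trace_mat (Sig n) * (real (p n) / real n + (\<mu> + 1) * (1 / real n))) + \<sigma>\<^sup>2 * (real (p n) / real n))
        \<longlonglongrightarrow> \<tau>\<^sup>2 * (c\<^sup>2 * (\<gamma> + (\<mu> + 1) * 0)) + \<sigma>\<^sup>2 * \<gamma>"
      by (intro tendsto_intros ratio inv_n trace_lim)
    then show ?thesis
      by (simp add: d1_def[abs_def] add_divide_distrib add.assoc)
  qed
  have u_pos: "0 < \<sigma>\<^sup>2 * (\<gamma> / (1 - \<gamma>)) - \<sigma>\<^sup>2 * \<gamma>"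
  proof -
    have "\<sigma>\<^sup>2 * (\<gamma> / (1 - \<gamma>)) - \<sigma>\<^sup>2 * \<gamma> = \<sigma>\<^sup>2 * \<gamma>\<^sup>2 / (1 - \<gamma>)"
      using \<open>\<gamma> < 1\<close> by (simp add: field_simps power2_eq_square)
    then show ?thesis
      using \<open>0 < \<gamma>\<close> \<open>\<gamma> < 1\<close> \<open>0 < \<sigma>\<close> by simp
  qed
  have den: "(1 - \<gamma>) * \<tau>\<^sup>2 * c\<^sup>2 + \<gamma> * \<sigma>\<^sup>2 > 0"
    using \<open>0 < \<gamma>\<close> \<open>\<gamma> < 1\<close> \<open>0 < \<sigma>\<close> by (intro add_nonneg_pos) auto
  have \<alpha>0_lim: "\<alpha>0 \<longlonglongrightarrow> \<alpha>'"
  proof -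
    let ?u = "\<sigma>\<^sup>2 * (\<gamma> / (1 - \<gamma>)) - \<sigma>\<^sup>2 * \<gamma>" and ?e = "\<tau>\<^sup>2 * (c\<^sup>2 * \<gamma>)"
    \<comment> \<open>The limits of \<open>d1\<close> and \<open>b0\<close> differ by a nonnegative
      number, so the truncation is invisible in the limit.\<close>
    have e: "max (\<tau>\<^sup>2 * (c\<^sup>2 * \<gamma>) + \<sigma>\<^sup>2 * \<gamma> - \<sigma>\<^sup>2 * \<gamma>) 0 = ?e"
      using \<open>0 < \<gamma>\<close> by simp
    have "\<alpha>0 \<longlonglongrightarrow> ?u / (?u + max (\<tau>\<^sup>2 * (c\<^sup>2 * \<gamma>) + \<sigma>\<^sup>2 * \<gamma> - \<sigma>\<^sup>2 * \<gamma>) 0)"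
      unfolding \<alpha>0_def[abs_def]
    proof (intro tendsto_intros a0_lim b0_lim b1_lim d1_lim)
      have "0 \<le> ?e" using \<open>0 < \<gamma>\<close> by simp
      then show "?u + max (\<tau>\<^sup>2 * (c\<^sup>2 * \<gamma>) + \<sigma>\<^sup>2 * \<gamma> - \<sigma>\<^sup>2 * \<gamma>) 0 \<noteq> 0"
        unfolding e using u_pos by linarith
    qed
    also have "?u / (?u + max (\<tau>\<^sup>2 * (c\<^sup>2 * \<gamma>) + \<sigma>\<^sup>2 * \<gamma> - \<sigma>\<^sup>2 * \<gamma>) 0) = \<alpha>'"
    proof -
      have u: "?u = \<gamma> * (\<gamma> * \<sigma>\<^sup>2) / (1 - \<gamma>)"
        using \<open>\<gamma> < 1\<close> by (simp add: field_simps power2_eq_square)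
      have ue: "?u + ?e = \<gamma> * ((1 - \<gamma>) * \<tau>\<^sup>2 * c\<^sup>2 + \<gamma> * \<sigma>\<^sup>2) / (1 - \<gamma>)"
        using \<open>\<gamma> < 1\<close> by (simp add: field_simps power2_eq_square)
      have "?u / (?u + ?e) = (\<gamma> * \<sigma>\<^sup>2) / ((1 - \<gamma>) * \<tau>\<^sup>2 * c\<^sup>2 + \<gamma> * \<sigma>\<^sup>2)"
        unfolding ue unfolding u using \<open>0 < \<gamma>\<close> \<open>\<gamma> < 1\<close> by simp
      also have "\<dots> = (\<gamma> * (\<gamma> * \<sigma>\<^sup>2)) / (\<gamma> * ((1 - \<gamma>) * \<tau>\<^sup>2 * c\<^sup>2 + \<gamma> * \<sigma>\<^sup>2))"
        using \<open>0 < \<gamma>\<close> by simp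
      also have "\<dots> = \<alpha>'"
        unfolding \<alpha>'_def by (intro arg_cong2[where f = "(/)"]) (simp_all add: power2_eq_square algebra_simps)
      finally show ?thesis
        unfolding e .
    qed
    finally show ?thesis .
  qed
  have \<eta>_lim: "(\<lambda>n. 1 - \<alpha>0 n * (1 - b1 n / a0 n)) \<longlonglongrightarrow> \<eta>'"
  proof -
    have "(\<lambda>n. 1 - \<alpha>0 n * (1 - b1 n / a0 n)) \<longlonglongrightarrow> 1 - \<alpha>' * (1 - \<sigma>\<^sup>2 * \<gamma> / (\<sigma>\<^sup>2 * (\<gamma> / (1 - \<gamma>))))"
      using \<open>0 < \<gamma>\<close> \<open>\<gamma> < 1\<close> \<open>0 < \<sigma>\<close> by (intro tendsto_intros \<alpha>0_lim b1_lim a0_lim) auto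
    also have "1 - \<alpha>' * (1 - \<sigma>\<^sup>2 * \<gamma> / (\<sigma>\<^sup>2 * (\<gamma> / (1 - \<gamma>)))) = 1 - \<gamma> * (\<gamma> * \<alpha>') / \<gamma>"
      using \<open>0 < \<gamma>\<close> \<open>\<gamma> < 1\<close> \<open>0 < \<sigma>\<close> by (simp add: field_simps)
    also have "\<dots> = \<eta>'"
    proof -
      have "\<gamma> * (\<gamma> * \<alpha>') / \<gamma> = (\<gamma> * (\<gamma> * (\<gamma> ^ 2 * \<sigma> ^ 2))) / (\<gamma> * ((1 - \<gamma>) * \<gamma> * \<tau> ^ 2 * c ^ 2 + \<gamma> ^ 2 * \<sigma> ^ 2))"
        unfolding \<alpha>'_def by (simp only: times_divide_eq_right divide_divide_eq_left mult.commute)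
      also have "\<dots> = (\<gamma> ^ 4 * \<sigma> ^ 2) / ((1 - \<gamma>) * \<gamma> ^ 2 * \<tau> ^ 2 * c ^ 2 + \<gamma> ^ 3 * \<sigma> ^ 2)"
        by (intro arg_cong2[where f = "(/)"])
          (simp_all add: power2_eq_square power3_eq_cube power4_eq_xxxx algebra_simps)
      finally show ?thesis
        by (simp add: \<eta>'_def)
    qed
    finally show ?thesis .
  qed
  have ev_p: "\<forall>\<^sub>F n in sequentially. p n \<le> n"
    using order_tendstoD(2)[OF ratio \<open>\<gamma> < 1\<close>] ev_n
    by eventually_elim (simp add: divide_less_eq)
  have ev_a0: "\<forall>\<^sub>F n in sequentially. 0 < a0 n"
    using \<open>0 < \<gamma>\<close> \<open>\<gamma> < 1\<close> \<open>0 < \<sigma>\<close> by (intro order_tendstoD(1)[OF a0_lim]) simp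
  have ev_b1: "\<forall>\<^sub>F n in sequentially. 0 < a0 n - b1 n"
    by (rule order_tendstoD(1)[OF tendsto_diff[OF a0_lim b1_lim] u_pos])
  show ?thesis
    unfolding \<eta>'_def[symmetric] \<alpha>'_def[symmetric]
  proof (intro allI impI)
    fix \<epsilon> :: real assume "0 < \<epsilon>"
    have "\<forall>\<^sub>F n in sequentially. 1 - \<alpha>0 n * (1 - b1 n / a0 n) < \<eta>' + \<epsilon>"
      using \<open>0 < \<epsilon>\<close> by (intro order_tendstoD(2)[OF \<eta>_lim]) simp
    moreover have "\<forall>\<^sub>F n in sequentially. \<alpha>' - \<epsilon> < \<alpha>0 n"
      using \<open>0 < \<epsilon>\<close> by (intro order_tendstoD(1)[OF \<alpha>0_lim]) simp
    ultimately have "\<forall>\<^sub>F n in sequentially. eta (\<Omega> n) n (p n) (Sig n) \<le> \<eta>' + \<epsilon>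
        \<and> alpha_star (\<Omega> n) n (p n) (Sig n) \<ge> \<alpha>' - \<epsilon>"
      using ev_n ev_p ev_a0 ev_b1 inv_ae inv_int
    proof eventually_elim
      case (elim n)
      then show ?case
        using bounds[of n] by auto
    qed
    then show "\<exists>n\<^sub>\<epsilon>. \<forall>n>n\<^sub>\<epsilon>. eta (\<Omega> n) n (p n) (Sig n) \<le> \<eta>' + \<epsilon>
        \<and> alpha_star (\<Omega> n) n (p n) (Sig n) \<ge> \<alpha>' - \<epsilon>"
      unfolding eventually_sequentially by (metis less_imp_le)
  qed
qed

end
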